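(* Let $N\ge 25$ be an integer with $N\ne 30$ and $N\ne 42$, and let a tiling of the regular $N$-gon $R_N$ with triangles of angles $\alpha,\beta,\gamma$ be given, where $\alpha,\beta,\gamma$ are rational multiples of $\pi$. If the equation at every vertex $V_j$ ($j=1,\ldots,N$) of $R_N$ is $2\alpha=\delta_N$, then, after possibly interchanging $\beta$ and $\gamma$, either $\alpha=\gamma=\delta_N/2$ and $\beta=2\pi/N$, or $\alpha=\delta_N/2$, $\beta=\pi/N$ and $\gamma=\pi/2$.
   Context: A tiling of a polygon $A$ is a decomposition of $A$ into finitely many nonoverlapping polygons (pairwise disjoint interiors, union $A$); no other condition is imposed, so two pieces may share a boundary point without sharing a common side. Here all tiles are triangles with angles $\alpha,\beta,\gamma$ (hence similar to each other, possibly of different sizes and possibly reflected). In each tile the three angles are labelled $\alpha,\beta,\gamma$. $\delta_N=(N-2)\pi/N$ is the angle of $R_N$, and $V_1,\ldots,V_N$ are its vertices. If the numbers of angles $\alpha,\beta,\gamma$ of the tiles meeting at $V_j$ are $p_j,q_j,r_j$, respectively, then $p_j\alpha+q_j\beta+r_j\gamma=\delta_N$ is called the equation at the vertex $V_j$; thus the equation at $V_j$ is $2\alpha=\delta_N$ means $(p_j,q_j,r_j)=(2,0,0)$. *)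

theory Defs
  imports "HOL-Analysis.Analysis"
begin

text \<open>The plane is identified with the complex numbers. The \<open>j\<close>-th vertex of the regular \<open>N\<close>-gon
  with centre \<open>c\<close> and first spoke \<open>w \<noteq> 0\<close> is obtained by rotating \<open>c + w\<close> about \<open>c\<close> by \<open>j\<close> steps;
  letting \<open>c\<close> and \<open>w\<close> vary gives regular polygons of every size and position.\<close>

definition ngon_vertex :: "nat \<Rightarrow> complex \<Rightarrow> complex \<Rightarrow> nat \<Rightarrow> complex" where
  "ngon_vertex N c w j = c + w * cis (2 * pi * real j / real N)"

definition regular_ngon :: "nat \<Rightarrow> complex \<Rightarrow> complex \<Rightarrow> complex set" where
  "regular_ngon N c w = convex hull (ngon_vertex N c w ` {1..N})"

definition ngon_angle :: "nat \<Rightarrow> real" where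
  "ngon_angle N = (real N - 2) * pi / real N"

text \<open>The unoriented angle at the middle point \<open>Q\<close>, in the range from \<open>0\<close> to \<open>pi\<close>.\<close>

definition angle_at :: "complex \<Rightarrow> complex \<Rightarrow> complex \<Rightarrow> real" where
  "angle_at P Q R = arccos (((P - Q) \<bullet> (R - Q)) / (norm (P - Q) * norm (R - Q)))"

text \<open>A tile records which of its vertices carries the angle labelled alpha, beta and gamma,
  respectively. Reflected tiles are included, since the angles are unoriented.\<close>

datatype tile = Tile (vertex_\<alpha>: complex) (vertex_\<beta>: complex) (vertex_\<gamma>: complex)

definition tile_set :: "tile \<Rightarrow> complex set" where
  "tile_set t = convex hull {vertex_\<alpha> t, vertex_\<beta> t, vertex_\<gamma> t}"

definition has_angles :: "real \<Rightarrow> real \<Rightarrow> real \<Rightarrow> tile \<Rightarrow> bool" where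
  "has_angles \<alpha> \<beta> \<gamma> t \<longleftrightarrow>
     \<not> collinear {vertex_\<alpha> t, vertex_\<beta> t, vertex_\<gamma> t} \<and>
     angle_at (vertex_\<beta> t) (vertex_\<alpha> t) (vertex_\<gamma> t) = \<alpha> \<and>
     angle_at (vertex_\<alpha> t) (vertex_\<beta> t) (vertex_\<gamma> t) = \<beta> \<and>
     angle_at (vertex_\<alpha> t) (vertex_\<gamma> t) (vertex_\<beta> t) = \<gamma>"

text \<open>Disjointness of interiors also prevents the same triangle from occurring in \<open>T\<close> with two
  different labellings.\<close>

definition tiling :: "complex set \<Rightarrow> real \<Rightarrow> real \<Rightarrow> real \<Rightarrow> tile set \<Rightarrow> bool" where
  "tiling A \<alpha> \<beta> \<gamma> T \<longleftrightarrow>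
     finite T \<and>
     (\<forall>t\<in>T. has_angles \<alpha> \<beta> \<gamma> t) \<and>
     pairwise (\<lambda>s t. interior (tile_set s) \<inter> interior (tile_set t) = {}) T \<and>
     (\<Union>t\<in>T. tile_set t) = A"

text \<open>\<open>vertex_equation T V p q r\<close>: the equation at \<open>V\<close> is
  \<open>p * alpha + q * beta + r * gamma = delta\<close>, that is, exactly \<open>p\<close>, \<open>q\<close>, \<open>r\<close> angles labelled alpha,
  beta, gamma of tiles of \<open>T\<close> have their apex at \<open>V\<close>. When \<open>V\<close> is a vertex of a convex polygon
  tiled by \<open>T\<close>, every tile containing \<open>V\<close> has \<open>V\<close> as one of its vertices.\<close>

definition vertex_equation :: "tile set \<Rightarrow> complex \<Rightarrow> nat \<Rightarrow> nat \<Rightarrow> nat \<Rightarrow> bool" where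
  "vertex_equation T V p q r \<longleftrightarrow>
     card {t \<in> T. vertex_\<alpha> t = V} = p \<and>
     card {t \<in> T. vertex_\<beta> t = V} = q \<and>
     card {t \<in> T. vertex_\<gamma> t = V} = r"

end

theory Submission
  imports Defs "HOL-Computational_Algebra.Polynomial_Factorial"
begin

text \<open>Normalise the polygon to the unit circle, let \<open>n\<close> be an even common denominator of the angles (in
  units of \<open>\<pi>\<close>) and let \<open>k\<close> be coprime to \<open>n\<close>. The automorphism \<open>\<zeta> \<mapsto> \<zeta>\<^sup>k\<close> of the cyclotomic field, extended to a
  semilinear map \<open>\<Phi>\<close> of the plane that commutes with conjugation, maps every tile to a triangle whose
  signed area is a nonnegative multiple of \<open>sin k\<alpha> sin k\<beta> sin k\<gamma>\<close>. Such an area is a sum over the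
  vertices of local terms that add up around a point as angles do; tiles without sides in
  cyclotomic directions can be ignored. So the areas add up to that of the image of the polygon, a
  star polygon, which has the sign of \<open>sin (2\<pi>k/N)\<close>. Hence
  \<open>sin k\<alpha> sin k\<beta> sin k\<gamma> sin (2\<pi>k/N) > 0\<close> for all these \<open>k\<close>.

  On the other hand, every angle label occurs equally often in the whole tiling, while the vertices
  of the polygon only use \<open>\<alpha>\<close>. So at some vertex of the tiling \<open>\<beta>\<close> occurs more often than \<open>\<gamma>\<close>;
  if \<open>\<beta> \<ge> \<gamma>\<close>, this leaves finitely many families \<open>\<gamma> = (1 + m) \<pi> / 2N\<close> with \<open>m = (A N + B) / C\<close>. If \<open>A > 0\<close>, a second vertex
  equation determines \<open>N\<close> up to finitely many values, and these contradict the sign condition. If \<open>A = 0\<close>,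
  the sign condition for a suitable \<open>k\<close> only leaves \<open>m = 1\<close> and \<open>m = 3\<close>.\<close>

section \<open>A semilinear extension of cyclotomic automorphisms\<close>

text \<open>A corner of one tile may lie inside a side of another, so the shoelace terms of the
  sides do not cancel in pairs, and \<open>\<Phi>\<close> is only additive: it need not preserve
  betweenness. What can be compared locally is a function of a point and of a line through it, since
  both rays of the line give the same value and a half circle of directions then contributes
  nothing. The shoelace term of a side in a cyclotomic direction is a difference of two such values,
  one at each end.

  The comparison at a point integrates over the directions leaving it, weighted by the number of
  triangles that contain the direction; only this number matters, so no combinatorial structure of
  the tiling is required. The polygon takes part through its triangulation from the centre, so that
  every balance is a statement about two families of triangles covering generic points equally
  often.

  The sign condition is used as a parity condition: the sign of \<open>sin (pi * t)\<close> is the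
  parity of the floor of \<open>t\<close>, which leaves computations with integers.\<close>

lemma prime_dvd_power_add_diff:
  fixes u v :: "'a::comm_ring_1"
  assumes "prime p"
  shows "of_nat p dvd (u + v) ^ p - u ^ p - v ^ p"
proof -
  have "p > 0" using assms prime_gt_0_nat by blast
  have "{..p} = insert 0 (insert p {1..<p})" using \<open>p > 0\<close> by auto
  then have "(u + v) ^ p - u ^ p - v ^ p = (\<Sum>i\<in>{1..<p}. of_nat (p choose i) * u ^ i * v ^ (p - i))"
    using \<open>p > 0\<close> by (simp add: binomial_ring)
  moreover have "of_nat p dvd (of_nat (p choose i) * u ^ i * v ^ (p - i) :: 'a)" if "i \<in> {1..<p}" for i
  proof -
    have "p dvd (p choose i)" using that assms \<open>p > 0\<close> by (intro dvd_choose_prime) auto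
    then show ?thesis by (metis dvd_mult2 of_nat_dvd_iff of_nat_mult dvd_def)
  qed
  ultimately show ?thesis by (auto intro: dvd_sum)
qed

lemma prime_dvd_int_power_diff:
  fixes a :: int
  assumes "prime p"
  shows "int p dvd a ^ p - a"
proof -
  have nat_case: "int p dvd int m ^ p - int m" for m
  proof (induction m)
    case 0
    then show ?case using prime_gt_0_nat[OF assms] by (simp add: zero_power)
  next
    case (Suc m)
    have eq: "int (Suc m) ^ p - int (Suc m) = ((int m + 1) ^ p - int m ^ p - 1 ^ p) + (int m ^ p - int m)"
      by (simp add: add.commute)
    show ?case
      unfolding eq using prime_dvd_power_add_diff[OF assms, of "int m" 1] Suc by (rule dvd_add)
  qed
  define m where "m = nat (a mod int p)"
  have m: "int m = a mod int p" using prime_gt_0_nat[OF assms] by (simp add: m_def)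
  have "int p dvd a - int m" by (simp add: m mod_eq_dvd_iff[symmetric])
  moreover have "a - int m dvd a ^ p - int m ^ p"
    by (simp add: power_diff_sumr2)
  ultimately have "int p dvd (a ^ p - int m ^ p) - (a - int m) + (int m ^ p - int m)"
    using nat_case by (meson dvd_add dvd_diff dvd_trans)
  then show ?thesis by (simp add: algebra_simps)
qed

text \<open>Modulo \<open>p\<close>, raising to the \<open>p\<close>-th power is additive and fixes
  the integers, so all it does is replace \<open>X\<close> by \<open>X ^ p\<close>; the induction
  peels off the constant coefficient.\<close>

lemma prime_dvd_poly_power_diff:
  fixes f :: "int poly"
  assumes "prime p"
  shows "of_nat p dvd f ^ p - pcompose f (monom 1 p)"
proof (induction f)
  case 0
  then show ?case using prime_gt_0_nat[OF assms] by (simp add: zero_power)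
next
  case (pCons a f)
  define X :: "int poly" where "X = monom 1 1"
  have X: "pCons a f = [:a:] + X * f" by (simp add: X_def monom_altdef)
  have "int p dvd a ^ p - a" by (rule prime_dvd_int_power_diff[OF assms])
  then obtain b where b: "a ^ p - a = int p * b" by (auto simp: dvd_def)
  have "[:a:] ^ p - [:a:] = [:a ^ p - a:]" by (simp add: poly_const_pow)
  also have "\<dots> = of_nat p * [:b:]" by (simp add: b of_nat_poly)
  finally have 1: "of_nat p dvd [:a:] ^ p - [:a:]" by (metis dvd_triv_left)
  have 2: "of_nat p dvd X ^ p * (f ^ p - pcompose f (monom 1 p))"
    using pCons by simp
  have "pCons a f ^ p - pcompose (pCons a f) (monom 1 p)
     = (([:a:] + X * f) ^ p - [:a:] ^ p - (X * f) ^ p) + (([:a:] ^ p - [:a:])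
       + X ^ p * (f ^ p - pcompose f (monom 1 p)))"
    unfolding X by (simp add: pcompose_add pcompose_mult X_def monom_power pcompose_pCons algebra_simps
       power_mult_distrib pcompose_const) (simp add: monom_altdef pcompose_pCons)
  then show ?case using 1 2 prime_dvd_power_add_diff[OF assms, of "[:a:]" "X * f"]
    by (simp only: dvd_add)
qed

section \<open>Integer polynomials at a root of unity\<close>

definition ceval :: "int poly \<Rightarrow> complex \<Rightarrow> complex" where
  "ceval f z = poly (map_poly of_int f) z"

lemma ceval_pCons [simp]: "ceval (pCons a f) z = of_int a + z * ceval f z"
  by (simp add: ceval_def map_poly_pCons)

lemma ceval_0 [simp]: "ceval 0 z = 0"
  by (simp add: ceval_def)

lemma ceval_add [simp]: "ceval (f + g) z = ceval f z + ceval g z"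
proof -
  have "map_poly of_int (f + g) = (map_poly of_int f + map_poly of_int g :: complex poly)"
    by (intro poly_eqI) (simp add: coeff_map_poly)
  then show ?thesis by (simp add: ceval_def)
qed

lemma ceval_smult [simp]: "ceval (Polynomial.smult a f) z = of_int a * ceval f z"
  by (induction f) (simp_all add: algebra_simps)

lemma ceval_mult [simp]: "ceval (f * g) z = ceval f z * ceval g z"
  by (induction f) (simp_all add: algebra_simps)

lemma ceval_1 [simp]: "ceval 1 z = 1"
  by (simp add: ceval_def)

lemma ceval_power [simp]: "ceval (f ^ n) z = ceval f z ^ n"
  by (induction n) simp_all

lemma ceval_minus [simp]: "ceval (- f) z = - ceval f z"
  using ceval_add[of f "- f" z] by (simp add: eq_neg_iff_add_eq_0 add.commute)

lemma ceval_diff [simp]: "ceval (f - g) z = ceval f z - ceval g z"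
  using ceval_add[of f "- g" z] by simp

lemma ceval_of_nat [simp]: "ceval (of_nat m) z = of_nat m"
  by (induction m) simp_all

lemma ceval_monom [simp]: "ceval (monom a m) z = of_int a * z ^ m"
  by (simp add: ceval_def map_poly_monom poly_monom)

lemma ceval_pcompose_monom [simp]: "ceval (pcompose f (monom 1 m)) z = ceval f (z ^ m)"
  by (induction f) (simp_all add: pcompose_pCons)

text \<open>The primitive part of a nonzero integer polynomial of least degree vanishing at
  \<open>z\<close> divides all the others: pseudo-division stays within the integers, and Gauss's
  lemma removes the constant that it introduces. It is monic up to sign because it divides
  \<open>X ^ n - 1\<close>.\<close>

lemma integer_minimal_polynomial:
  assumes "n > 0" and "z ^ n = 1"
  obtains f :: "int poly" where "lead_coeff f = 1" and "degree f > 0"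
    and "\<And>g. ceval g z = 0 \<longleftrightarrow> f dvd g"
proof -
  define P where "P g \<longleftrightarrow> g \<noteq> 0 \<and> ceval g z = 0" for g :: "int poly"
  define u :: "int poly" where "u = monom 1 n - 1"
  have degu: "degree u = n" and lcu: "lead_coeff u = 1"
  proof -
    have "degree (monom 1 n - 1 :: int poly) = degree (monom 1 n + (- 1) :: int poly)" by simp
    also have "\<dots> = n" using assms(1) by (subst degree_add_eq_left) (auto simp: degree_monom_eq)
    finally show d: "degree u = n" by (simp add: u_def)
    show "lead_coeff u = 1" unfolding d using assms(1) by (simp add: u_def)
  qed
  have "P u" using assms lcu by (auto simp: P_def u_def)
  then obtain f0 where f0: "P f0" "\<And>g. P g \<Longrightarrow> degree f0 \<le> degree g"
    using exists_least_iff[of "\<lambda>d. \<exists>g. P g \<and> degree g = d"] by (metis linorder_not_less)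
  define f1 where "f1 = primitive_part f0"
  have f0_eq: "f0 = Polynomial.smult (content f0) f1" by (simp add: f1_def)
  have c0: "content f0 \<noteq> 0" using f0(1) by (simp add: P_def)
  have f1: "f1 \<noteq> 0" "ceval f1 z = 0" "content f1 = 1"
  proof -
    show "f1 \<noteq> 0" using f0(1) by (auto simp: f1_def P_def)
    have "ceval f0 z = of_int (content f0) * ceval f1 z" by (subst f0_eq) simp
    then show "ceval f1 z = 0" using f0(1) c0 unfolding P_def
      by (metis mult_eq_0_iff of_int_eq_0_iff)
    show "content f1 = 1" using f0(1) by (simp add: f1_def P_def content_primitive_part)
  qed
  have degf1: "degree f1 = degree f0" by (simp add: f1_def)
  have dvd: "f1 dvd g" if "ceval g z = 0" for g
  proof -
    obtain q r where qr: "pseudo_divmod g f1 = (q, r)" by fastforce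
    define c where "c = lead_coeff f1 ^ (Suc (degree g) - degree f1)"
    have c: "c \<noteq> 0" using f1(1) by (simp add: c_def)
    have eq: "Polynomial.smult c g = f1 * q + r" using pseudo_divmod(1)[OF f1(1) qr] by (simp add: c_def)
    have "r = 0 \<or> degree r < degree f1" using pseudo_divmod(2)[OF f1(1) qr] .
    moreover have "ceval r z = 0"
    proof -
      have "ceval (Polynomial.smult c g) z = 0" using that by simp
      then show ?thesis using f1(2) by (simp add: eq)
    qed
    ultimately have "r = 0" using f0(2)[of r] degf1 by (fastforce simp: P_def)
    then have "f1 dvd Polynomial.smult c g" using eq by simp
    then have "fract_poly f1 dvd fract_poly (Polynomial.smult c g)" by (rule fract_poly_dvd)
    then have "fract_poly f1 dvd fract_poly g" using c by (simp add: fract_poly_smult dvd_smult_iff)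
    then show ?thesis using f1(3) by (rule fract_poly_dvdD)
  qed
  have "f1 dvd u" using \<open>P u\<close> dvd by (simp add: P_def)
  then obtain h where h: "u = f1 * h" by (auto simp: dvd_def)
  have "lead_coeff f1 * lead_coeff h = 1" using lcu by (simp add: h lead_coeff_mult)
  then have lc: "lead_coeff f1 = 1 \<or> lead_coeff f1 = -1" by (auto simp: zmult_eq_1_iff)
  define f where "f = Polynomial.smult (lead_coeff f1) f1"
  have f: "lead_coeff f = 1" using lc by (auto simp: f_def)
  have dvd_iff: "f dvd g \<longleftrightarrow> f1 dvd g" for g using lc by (auto simp: f_def)
  show ?thesis
  proof (rule that[of f])
    show "lead_coeff f = 1" by (rule f)
    show iff: "ceval g z = 0 \<longleftrightarrow> f dvd g" for g
      unfolding dvd_iff using dvd f1(2) by (auto simp: dvd_def)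
    show "degree f > 0"
    proof (rule ccontr)
      assume "\<not> degree f > 0"
      then have "f = [:1:]" using f by (metis degree_eq_zeroE gr0I lead_coeff_pCons(2) pCons_0_0 lead_coeff_pCons)
      then show False using iff[of f] by simp
    qed
  qed
qed

lemma monic_division:
  fixes f g :: "int poly"
  assumes "lead_coeff f = 1"
  obtains q r where "g = f * q + r" and "r = 0 \<or> degree r < degree f"
proof -
  have f0: "f \<noteq> 0" using assms by auto
  obtain q r where qr: "pseudo_divmod g f = (q, r)" by fastforce
  show ?thesis
    using pseudo_divmod[OF f0 qr] assms by (intro that[of q r]) simp_all
qed

text \<open>This is the irreducibility of the cyclotomic polynomials in Landau's form. For a large
  prime \<open>p\<close>, the Frobenius congruence shows that the remainder of
  \<open>f (X ^ p)\<close> modulo the minimal polynomial \<open>f\<close> is divisible by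
  \<open>p\<close>; its coefficients are bounded independently of \<open>p\<close>, so it vanishes.
  Hence \<open>p\<close>-th powers of roots of \<open>f\<close> are roots of \<open>f\<close>, and
  up to a multiple of \<open>n\<close> the exponent \<open>k\<close> is a product of large
  primes.\<close>

lemma root_of_unity_conjugate:
  fixes z :: complex
  assumes n: "n > 0" and z: "z ^ n = 1" and k: "coprime k n" and g: "ceval g z = 0"
  shows "ceval g (z ^ k) = 0"
proof -
  obtain f where "lead_coeff f = 1 \<and> degree f > 0 \<and> (\<forall>g. ceval g z = 0 \<longleftrightarrow> f dvd g)"
    using integer_minimal_polynomial[OF n z] by metis
  then have lc: "lead_coeff f = 1" and degf: "degree f > 0" and f: "\<And>g. ceval g z = 0 \<longleftrightarrow> f dvd g"
    by blast+
  have small: "r = 0" if "ceval r z = 0" "r = 0 \<or> degree r < degree f" for r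
    using that f by (metis dvd_imp_degree_le linorder_not_less)
  have "\<exists>r. (\<exists>q. pcompose f (monom 1 m) = f * q + r) \<and> (r = 0 \<or> degree r < degree f)" for m
    using monic_division[OF lc, of "pcompose f (monom 1 m)"] by metis
  then obtain r where r: "\<And>m. \<exists>q. pcompose f (monom 1 m) = f * q + r m"
     "\<And>m. r m = 0 \<or> degree (r m) < degree f" by metis
  have fz: "ceval f z = 0" using f by simp
  have r_eval: "ceval (r m) z = ceval f (z ^ m)" for m
  proof -
    obtain q where "pcompose f (monom 1 m) = f * q + r m" using r(1) by blast
    then have "ceval (pcompose f (monom 1 m)) z = ceval (f * q + r m) z" by simp
    then show ?thesis using fz by simp
  qed
  \<comment> \<open>A bound for all coefficients of the \<open>n\<close> possible remainders: the
    remainder of \<open>f (X ^ m)\<close> is determined by its value at \<open>z\<close>, hence by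
    \<open>m mod n\<close>.\<close>
  define A where "A = (\<Sum>m<n. \<Sum>i\<le>degree (r m). nat \<bar>coeff (r m) i\<bar>)"
  have A: "nat \<bar>coeff (r m) i\<bar> \<le> A" if "m < n" for m i
  proof (cases "i \<le> degree (r m)")
    case True
    have "nat \<bar>coeff (r m) i\<bar> \<le> (\<Sum>i\<le>degree (r m). nat \<bar>coeff (r m) i\<bar>)"
      using True by (intro member_le_sum) auto
    also have "\<dots> \<le> A" unfolding A_def
      using that by (intro member_le_sum) auto
    finally show ?thesis .
  qed (simp add: coeff_eq_0)
  have power_mod: "z ^ m = z ^ (m mod n)" for m
    by (metis div_mult_mod_eq mult.commute mult_1 power_add power_mult power_one z)
  have large_prime: "ceval f (y ^ p) = 0" if p: "prime p" "p > A" and y: "ceval f y = 0" for p y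
  proof -
    obtain h where h: "f ^ p - pcompose f (monom 1 p) = of_nat p * h"
      using prime_dvd_poly_power_diff[OF p(1), of f] by (auto simp: dvd_def)
    obtain q s where qs: "h = f * q + s" "s = 0 \<or> degree s < degree f"
      using monic_division[OF lc] by metis
    define m where "m = p mod n"
    have "m < n" using n by (simp add: m_def)
    have "ceval (f ^ p - pcompose f (monom 1 p)) z = of_nat p * ceval s z"
      by (simp add: h qs(1) fz)
    then have "- ceval (r m) z = of_nat p * ceval s z"
      using fz not_prime_0 p(1) power_mod[of p] by (cases "p = 0") (simp_all add: r_eval m_def power_0_left)
    then have "ceval (r m + Polynomial.smult (int p) s) z = 0"
      by simp (metis add.right_inverse)
    moreover have "degree (r m + Polynomial.smult (int p) s) < degree f"
      using r(2)[of m] qs(2) degf by (intro degree_add_less) (auto intro: le_less_trans[OF degree_smult_le])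
    ultimately have eq: "r m + Polynomial.smult (int p) s = 0" using small by blast
    have "coeff (r m) i = 0" for i
    proof -
      have "coeff (r m) i = int p * (- coeff s i)"
        using arg_cong[OF eq, of "\<lambda>t. coeff t i"] by simp
      then have "int p dvd coeff (r m) i" by simp
      moreover have "\<bar>coeff (r m) i\<bar> < int p" using A[OF \<open>m < n\<close>, of i] p(2) by linarith
      ultimately show ?thesis using dvd_imp_le_int[of "coeff (r m) i" "int p"] by linarith
    qed
    then have "r m = 0" by (simp add: poly_eq_iff)
    then have "ceval f (z ^ p) = 0" using r_eval[of m] power_mod[of p] by (simp add: m_def)
    then have "ceval (pcompose f (monom 1 p)) z = 0" by simp
    \<comment> \<open>Divisibility carries the statement from \<open>z\<close> to every root
      \<open>y\<close> of \<open>f\<close>, so that primes can be applied one after another.\<close>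
    then have "f dvd pcompose f (monom 1 p)" using f by blast
    then obtain t where "pcompose f (monom 1 p) = f * t" by (auto simp: dvd_def)
    then have "ceval (pcompose f (monom 1 p)) y = ceval (f * t) y" by simp
    then show ?thesis using y by simp
  qed
  have large_factors: "ceval f (y ^ d) = 0"
    if "d > 0" "\<And>p. prime p \<Longrightarrow> p dvd d \<Longrightarrow> p > A" "ceval f y = 0" for d y
    using that
  proof (induction d arbitrary: y rule: prime_divisors_induct)
    case zero
    then show ?case by simp
  next
    case (unit d)
    then show ?case by simp
  next
    case (factor p d)
    have "ceval f ((y ^ p) ^ d) = 0"
    proof (rule factor.IH)
      show "d > 0" using factor.prems(1) by simp
      show "\<And>q. prime q \<Longrightarrow> q dvd d \<Longrightarrow> q > A" using factor.prems(2) by simp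
      show "ceval f (y ^ p) = 0"
        using factor.prems factor.hyps by (intro large_prime) auto
    qed
    then show ?case by (simp add: power_mult)
  qed
  text \<open>Landau's trick: \<open>k\<close> may be changed modulo \<open>n\<close> so as to get rid of all small prime factors.\<close>
  define S where "S = {p. prime p \<and> p \<le> A \<and> \<not> p dvd k}"
  have finS: "finite S" by (rule finite_subset[of _ "{..A}"]) (auto simp: S_def)
  define d where "d = k + n * \<Prod>S"
  have "\<Prod>S > 0" using finS by (intro prod_pos) (auto simp: S_def prime_gt_0_nat)
  then have "d > 0" using n by (simp add: d_def)
  have "p > A" if p: "prime p" "p dvd d" for p
  proof (rule ccontr)
    assume "\<not> p > A"
    show False
    proof (cases "p dvd k")
      case True
      then have "p dvd n * \<Prod>S" using p(2) by (simp add: d_def dvd_add_right_iff)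
      moreover have "\<not> p dvd n" using True k p(1) by (meson coprime_common_divisor not_prime_unit)
      ultimately have "p dvd \<Prod>S" using p(1) by (simp add: prime_dvd_mult_iff)
      then obtain q where q: "q \<in> S" "p dvd q" using finS p(1) by (auto simp: prime_dvd_prod_iff)
      then have "p = q" using p(1) by (auto simp: S_def primes_dvd_imp_eq)
      then show False using q True by (simp add: S_def)
    next
      case False
      then have "p \<in> S" using p(1) \<open>\<not> p > A\<close> by (simp add: S_def)
      then have "p dvd n * \<Prod>S" using finS by (simp add: dvd_prod_eqI)
      then show False using p(2) False by (simp add: d_def dvd_add_left_iff)
    qed
  qed
  then have "ceval f (z ^ d) = 0" using large_factors \<open>d > 0\<close> fz by blast
  moreover have "z ^ d = z ^ k" by (simp add: d_def power_add power_mult z)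
  moreover obtain t where "g = f * t" using g f by (auto simp: dvd_def)
  ultimately show ?thesis by simp
qed

text \<open>It makes sending \<open>z ^ i\<close> to \<open>z ^ (k * i)\<close> well defined on the
  rational span of the powers of \<open>z\<close>. Clearing denominators reduces it to integer
  polynomials; the exponents are indexed and may repeat, so that equal powers need not be
  merged.\<close>

lemma rational_relation_conjugate:
  fixes z :: complex and c :: "'i \<Rightarrow> rat"
  assumes "n > 0" and "z ^ n = 1" and "coprime k n" and "finite I"
    and "(\<Sum>i\<in>I. of_rat (c i) * z ^ e i) = 0"
  shows "(\<Sum>i\<in>I. of_rat (c i) * z ^ (k * e i)) = 0"
proof -
  define D where "D = (\<Prod>i\<in>I. snd (quotient_of (c i)))"
  have D0: "D \<noteq> 0" using assms(4) quotient_of_denom_pos' by (auto simp: D_def) (metis less_irrefl)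
  have "\<exists>m. of_int D * c i = of_int m" if "i \<in> I" for i
  proof -
    obtain a b where ab: "quotient_of (c i) = (a, b)" by fastforce
    have "b dvd D" unfolding D_def using that assms(4) ab by (metis dvd_prodI snd_conv)
    then obtain m where "D = b * m" by (auto simp: dvd_def)
    moreover have "b \<noteq> 0" using quotient_of_denom_pos[OF ab] by simp
    ultimately have "of_int D * c i = of_int (m * a)" using quotient_of_div[OF ab] by simp
    then show ?thesis by blast
  qed
  then obtain m where m: "\<And>i. i \<in> I \<Longrightarrow> of_int D * c i = of_int (m i)" by metis
  have m': "complex_of_int (m i) = of_int D * of_rat (c i)" if "i \<in> I" for i
    using arg_cong[OF m[OF that], of "of_rat :: rat \<Rightarrow> complex"] by (simp add: of_rat_mult)
  define g where "g = (\<Sum>i\<in>I. monom (m i) (e i))"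
  have ev: "ceval g y = of_int D * (\<Sum>i\<in>I. of_rat (c i) * y ^ e i)" for y
  proof -
    have "ceval (\<Sum>i\<in>J. monom (m i) (e i)) y = (\<Sum>i\<in>J. of_int (m i) * y ^ e i)" if "finite J" for J
      using that by induction simp_all
    then show ?thesis using assms(4) by (simp add: g_def m' sum_distrib_left mult.assoc)
  qed
  have "ceval g z = 0" using assms(5) by (simp add: ev)
  then have "ceval g (z ^ k) = 0" by (rule root_of_unity_conjugate[OF assms(1-3)])
  then show ?thesis using D0 by (simp add: ev power_mult)
qed

section \<open>The complex plane as a rational vector space\<close>

interpretation rat_complex: vector_space "\<lambda>(q::rat) (z::complex). of_rat q * z"
  by unfold_locales (simp_all add: algebra_simps of_rat_add of_rat_mult)

interpretation rat_complex_pair: vector_space_pair "\<lambda>(q::rat) (z::complex). of_rat q * z"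
  "\<lambda>(q::rat) (z::complex). of_rat q * z"
  by unfold_locales

text \<open>\<open>\<Phi>\<close> stands in for the extension of a Galois automorphism to the coordinates of the tiles,
  which need not be algebraic.\<close>

lemma cyclotomic_semilinear_map:
  fixes z :: complex
  assumes n: "n > 0" and z: "z ^ n = 1" and k: "coprime k n"
  obtains \<Phi> :: "complex \<Rightarrow> complex" where "\<And>x y. \<Phi> (x + y) = \<Phi> x + \<Phi> y"
    and "\<And>x. \<Phi> (z * x) = z ^ k * \<Phi> x" and "\<And>x. \<Phi> (cnj x) = cnj (\<Phi> x)" and "\<Phi> 1 = 1"
proof -
  define P where "P = range (\<lambda>i::nat. z ^ i)"
  \<comment> \<open>A basis of the span that consists of powers of \<open>z\<close>: on it the
    prescribed value is the \<open>k\<close>-th power, and outside the span the extension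
    \<open>L\<close> is arbitrary.\<close>
  obtain B where B: "B \<subseteq> P" "rat_complex.independent B" "P \<subseteq> rat_complex.span B"
    by (rule rat_complex.maximal_independent_subset)
  define scale where "scale = (\<lambda>(q::rat) (z::complex). of_rat q * z)"
  have "\<exists>L. Vector_Spaces.linear scale scale L \<and> (\<forall>x\<in>B. L x = x ^ k)"
    unfolding scale_def by (rule rat_complex_pair.linear_independent_extend[OF B(2)])
  then obtain L where L1: "Vector_Spaces.linear scale scale L" and L2: "\<forall>x\<in>B. L x = x ^ k"
    by (elim exE conjE)
  note L = L1[unfolded scale_def] bspec[OF L2]
  have L_add: "L (x + y) = L x + L y" for x y using L(1) by (rule rat_complex_pair.linear_add)
  have L_scale: "L (of_rat q * x) = of_rat q * L x" for q x using L(1) by (rule rat_complex_pair.linear_scale)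
  have L_sum: "L (\<Sum>i\<in>I. f i) = (\<Sum>i\<in>I. L (f i))" for I and f :: "complex \<Rightarrow> complex"
    using L(1) by (rule rat_complex_pair.linear_sum)
  have L_power: "L (z ^ i) = z ^ (k * i)" for i
  proof -
    have "z ^ i \<in> rat_complex.span B" using B(3) by (auto simp: P_def)
    then have "\<exists>F c. z ^ i = (\<Sum>b\<in>F. of_rat (c b) * b) \<and> finite F \<and> F \<subseteq> B"
      unfolding rat_complex.span_explicit mem_Collect_eq .
    then obtain F c where F: "finite F" "F \<subseteq> B" "z ^ i = (\<Sum>b\<in>F. of_rat (c b) * b)"
      by (elim exE conjE)
    define e where "e b = (SOME j. b = z ^ j)" for b
    have e: "b = z ^ e b" if "b \<in> F" for b
    proof -
      have "\<exists>j. b = z ^ j" using that F(2) B(1) by (auto simp: P_def)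
      then show ?thesis unfolding e_def by (rule someI_ex)
    qed
    \<comment> \<open>The index \<open>None\<close> carries \<open>z ^ i\<close> with coefficient
      -1, so that the expansion in the basis becomes one vanishing relation.\<close>
    define I where "I = insert None (Some ` F)"
    define c' where "c' = case_option (- 1 :: rat) c"
    define e' where "e' = case_option i e"
    have sum_I: "(\<Sum>j\<in>I. h j) = h None + (\<Sum>b\<in>F. h (Some b))" for h :: "complex option \<Rightarrow> complex"
      using F(1) by (simp add: I_def sum.reindex)
    have "(\<Sum>b\<in>F. of_rat (c b) * z ^ e b) = z ^ i"
      unfolding F(3) by (intro sum.cong refl arg_cong2[where f = "(*)"] e[symmetric])
    then have "(\<Sum>j\<in>I. of_rat (c' j) * z ^ e' j) = 0"
      by (simp add: sum_I c'_def e'_def)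
    then have "(\<Sum>j\<in>I. of_rat (c' j) * z ^ (k * e' j)) = 0"
      using F(1) by (intro rational_relation_conjugate[OF n z k]) (auto simp: I_def)
    then have "z ^ (k * i) = (\<Sum>b\<in>F. of_rat (c b) * z ^ (k * e b))"
      by (simp add: sum_I c'_def e'_def)
    also have "\<dots> = (\<Sum>b\<in>F. of_rat (c b) * L b)"
    proof (intro sum.cong refl)
      fix b assume b: "b \<in> F"
      then have "L b = b ^ k" using L2 F(2) by blast
      also have "\<dots> = (z ^ e b) ^ k" by (rule arg_cong[OF e[OF b]])
      finally show "of_rat (c b) * z ^ (k * e b) = of_rat (c b) * L b"
        by (simp add: power_mult[symmetric] mult.commute)
    qed
    also have "\<dots> = L (z ^ i)" unfolding F(3) by (simp add: L_sum L_scale)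
    finally show ?thesis by simp
  qed
  have z0: "z \<noteq> 0" using z n by (auto simp: power_0_left)
  \<comment> \<open>Outside the span of the powers, \<open>L\<close> is only known to be
    rational-linear. The twisted average over multiplication by powers of \<open>z\<close> makes it
    semilinear and keeps the value at 1.\<close>
  define M where "M x = (\<Sum>j<n. L (z ^ j * x) / z ^ (k * j)) / of_nat n" for x
  have M_add: "M (x + y) = M x + M y" for x y
    by (simp add: M_def distrib_left L_add add_divide_distrib sum.distrib)
  have M_z: "M (z * x) = z ^ k * M x" for x
  proof -
    have "(\<Sum>j<n. L (z ^ j * (z * x)) / z ^ (k * j)) = z ^ k * (\<Sum>j<n. L (z ^ Suc j * x) / z ^ (k * Suc j))"
      using z0 by (simp add: sum_distrib_left power_add mult_ac)
    also have "(\<Sum>j<n. L (z ^ Suc j * x) / z ^ (k * Suc j)) = (\<Sum>j<n. L (z ^ j * x) / z ^ (k * j))"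
    proof -
      define F where "F j = L (z ^ j * x) / z ^ (k * j)" for j
      have "(\<Sum>j<n. F (Suc j)) + F 0 = (\<Sum>j<n. F j) + F n"
        using sum.lessThan_Suc_shift[of F n] sum.lessThan_Suc[of F n] by (simp only: add.commute)
      moreover have "F n = F 0" using z by (simp add: F_def mult.commute[of k n] power_mult)
      ultimately show ?thesis by (simp add: F_def)
    qed
    finally show ?thesis by (simp add: M_def)
  qed
  have M_1: "M 1 = 1" using n z0 by (simp add: M_def L_power)
  \<comment> \<open>Averaging with the conjugated map gives compatibility with \<open>cnj\<close>;
    semilinearity survives because \<open>cnj z\<close> is the inverse of \<open>z\<close>.\<close>
  define \<Phi> where "\<Phi> x = (M x + cnj (M (cnj x))) / 2" for x
  have norm_z: "norm z = 1" using power_eq_1_iff[OF z] n by simp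
  have cnj_z: "z * cnj z = 1" using norm_z by (simp add: complex_norm_square[symmetric])
  have M_cnj: "M (cnj z * x) = cnj (z ^ k) * M x" for x
  proof -
    have "M x = M (z * (cnj z * x))" using cnj_z by (simp add: mult.assoc[symmetric])
    also have "\<dots> = z ^ k * M (cnj z * x)" by (rule M_z)
    finally have "cnj (z ^ k) * M x = (cnj z * z) ^ k * M (cnj z * x)"
      by (simp add: power_mult_distrib mult.assoc)
    then show ?thesis using cnj_z by (simp add: mult.commute)
  qed
  show ?thesis
  proof
    show "\<Phi> (x + y) = \<Phi> x + \<Phi> y" for x y by (simp add: \<Phi>_def M_add add_divide_distrib)
    show "\<Phi> (z * x) = z ^ k * \<Phi> x" for x by (simp add: \<Phi>_def M_z M_cnj) (simp add: algebra_simps)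
    show "\<Phi> (cnj x) = cnj (\<Phi> x)" for x by (simp add: \<Phi>_def add.commute)
    show "\<Phi> 1 = 1" by (simp add: \<Phi>_def M_1)
  qed
qed

section \<open>Local structure of a family of triangles at a point\<close>

definition crs :: "complex \<Rightarrow> complex \<Rightarrow> real" where
  "crs u v = Im (cnj u * v)"

lemma crs_expand: "crs u v = Re u * Im v - Im u * Re v"
  by (simp add: crs_def)

lemma crs_zero [simp]: "crs u 0 = 0" "crs 0 u = 0" "crs u u = 0"
  by (simp_all add: crs_expand)

lemma crs_scale_right: "crs u (of_real r * v) = r * crs u v"
  by (simp add: crs_expand algebra_simps)

definition in_triangle :: "complex \<Rightarrow> complex \<Rightarrow> complex \<Rightarrow> complex \<Rightarrow> bool" where
  "in_triangle a b c p \<longleftrightarrow> 0 \<le> crs (b - a) (p - a) \<and> 0 \<le> crs (c - b) (p - b) \<and> 0 \<le> crs (a - c) (p - c)"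

definition off_lines :: "complex \<Rightarrow> complex \<Rightarrow> complex \<Rightarrow> complex \<Rightarrow> bool" where
  "off_lines a b c p \<longleftrightarrow> crs (b - a) (p - a) \<noteq> 0 \<and> crs (c - b) (p - b) \<noteq> 0 \<and> crs (a - c) (p - c) \<noteq> 0"

definition ccw :: "complex \<Rightarrow> complex \<Rightarrow> complex \<Rightarrow> bool" where
  "ccw a b c \<longleftrightarrow> 0 < crs (b - a) (c - a)"

lemma ccw_rotate: "ccw a b c \<Longrightarrow> ccw b c a"
  by (simp add: ccw_def crs_expand algebra_simps)

text \<open>The three cross products are the barycentric coordinates of \<open>p\<close>, scaled by
  twice the signed area of the triangle.\<close>

lemma crs_affine:
  assumes "p = of_real u * a + of_real v * b + of_real w * c" and "u + v + w = 1"
  shows "crs (b - a) (p - a) = w * crs (b - a) (c - a)"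
    and "crs (c - b) (p - b) = u * crs (b - a) (c - a)"
    and "crs (a - c) (p - c) = v * crs (b - a) (c - a)"
proof -
  have u: "u = 1 - v - w" using assms(2) by simp
  show "crs (b - a) (p - a) = w * crs (b - a) (c - a)"
    and "crs (c - b) (p - b) = u * crs (b - a) (c - a)"
    and "crs (a - c) (p - c) = v * crs (b - a) (c - a)"
    unfolding assms(1) u crs_expand by (simp_all add: algebra_simps)
qed

lemma convex_hull_in_triangle:
  assumes "ccw a b c"
  shows "p \<in> convex hull {a, b, c} \<longleftrightarrow> in_triangle a b c p"
proof
  have D: "crs (b - a) (c - a) > 0" using assms by (simp add: ccw_def)
  show "in_triangle a b c p" if p: "p \<in> convex hull {a, b, c}"
  proof -
    obtain u v w where *: "0 \<le> u" "0 \<le> v" "0 \<le> w" "u + v + w = 1"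
      "p = u *\<^sub>R a + v *\<^sub>R b + w *\<^sub>R c"
      using p unfolding convex_hull_3 by blast
    have "p = of_real u * a + of_real v * b + of_real w * c" using * by (simp add: scaleR_conv_of_real)
    from crs_affine[OF this *(4)] show ?thesis using * D by (simp add: in_triangle_def)
  qed
  show "p \<in> convex hull {a, b, c}" if "in_triangle a b c p"
  proof -
    define d where "d = crs (b - a) (c - a)"
    define u where "u = crs (c - b) (p - b) / d"
    define v where "v = crs (a - c) (p - c) / d"
    define w where "w = crs (b - a) (p - a) / d"
    have d: "d > 0" using D by (simp add: d_def)
    have nonneg: "0 \<le> u" "0 \<le> v" "0 \<le> w"
      using that d by (auto simp: in_triangle_def u_def v_def w_def)
    have "crs (c - b) (p - b) + crs (a - c) (p - c) + crs (b - a) (p - a) = d"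
      by (simp add: d_def crs_expand algebra_simps)
    then have sum: "u + v + w = 1" using d by (simp add: u_def v_def w_def add_divide_distrib[symmetric])
    have "of_real d * p = of_real (crs (c - b) (p - b)) * a + of_real (crs (a - c) (p - c)) * b
        + of_real (crs (b - a) (p - a)) * c"
      unfolding d_def by (simp add: complex_eq_iff crs_expand) (simp add: algebra_simps)
    also have "\<dots> = of_real d * (of_real u * a + of_real v * b + of_real w * c)"
      using d by (simp add: u_def v_def w_def distrib_left)
    finally have "p = u *\<^sub>R a + v *\<^sub>R b + w *\<^sub>R c"
      using d by (simp add: scaleR_conv_of_real)
    then show ?thesis using nonneg sum by (auto simp: convex_hull_3)
  qed
qed

lemma in_triangle_interior:
  assumes "ccw a b c" and "in_triangle a b c p" and "off_lines a b c p"
  shows "p \<in> interior (convex hull {a, b, c})"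
proof -
  define U where "U = {p. 0 < crs (b - a) (p - a)} \<inter> {p. 0 < crs (c - b) (p - b)} \<inter> {p. 0 < crs (a - c) (p - c)}"
  have "open U"
    unfolding U_def crs_def by (intro open_Int open_Collect_less continuous_intros)
  moreover have "U \<subseteq> convex hull {a, b, c}"
    by (auto simp: U_def convex_hull_in_triangle[OF assms(1)] in_triangle_def)
  moreover have "p \<in> U"
    using assms(2,3) by (auto simp: U_def in_triangle_def off_lines_def)
  ultimately show ?thesis by (auto simp: interior_def)
qed

text \<open>The directions \<open>u\<close> for which \<open>x + s * u\<close> lies in the triangle for all small positive \<open>s\<close>.\<close>

definition half_plane_cone :: "complex \<Rightarrow> complex \<Rightarrow> complex \<Rightarrow> complex set" where
  "half_plane_cone a b x = {u. 0 < crs (b - a) (x - a) \<or> crs (b - a) (x - a) = 0 \<and> 0 \<le> crs (b - a) u}"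

definition triangle_cone :: "complex \<Rightarrow> complex \<Rightarrow> complex \<Rightarrow> complex \<Rightarrow> complex set" where
  "triangle_cone a b c x = half_plane_cone a b x \<inter> half_plane_cone b c x \<inter> half_plane_cone c a x"

lemma eventually_half_plane:
  "eventually (\<lambda>s::real. (0 \<le> crs (b - a) (x + of_real s * u - a)) = (u \<in> half_plane_cone a b x)) (at_right 0)"
proof -
  define k l where "k = crs (b - a) (x - a)" and "l = crs (b - a) u"
  have eq: "crs (b - a) (x + of_real s * u - a) = k + s * l" for s
    by (simp add: k_def l_def crs_expand algebra_simps)
  have lim: "((\<lambda>s. k + s * l) \<longlongrightarrow> k) (at_right 0)" by (auto intro!: tendsto_eq_intros)
  consider "k > 0" | "k < 0" | "k = 0" by linarith
  then show ?thesis
  proof cases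
    case 1
    then show ?thesis using order_tendstoD(1)[OF lim 1]
      by (elim eventually_mono) (auto simp: eq half_plane_cone_def k_def)
  next
    case 2
    then show ?thesis using order_tendstoD(2)[OF lim 2]
      by (elim eventually_mono) (auto simp: eq half_plane_cone_def k_def)
  next
    case 3
    then show ?thesis using eventually_at_right_less[of "0::real"]
      by (elim eventually_mono) (auto simp: eq half_plane_cone_def zero_le_mult_iff k_def l_def)
  qed
qed

lemma eventually_in_triangle:
  "eventually (\<lambda>s::real. in_triangle a b c (x + of_real s * u) = (u \<in> triangle_cone a b c x)) (at_right 0)"
  using eventually_half_plane[where a = a and b = b and x = x and u = u]
    eventually_half_plane[where a = b and b = c and x = x and u = u]
    eventually_half_plane[where a = c and b = a and x = x and u = u]
  by eventually_elim (simp add: in_triangle_def triangle_cone_def)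

lemma eventually_off_line:
  assumes "crs e u \<noteq> 0"
  shows "eventually (\<lambda>s::real. crs e (x + of_real s * u - a) \<noteq> 0) (at_right 0)"
proof -
  define k l where "k = crs e (x - a)" and "l = crs e u"
  have eq: "crs e (x + of_real s * u - a) = k + s * l" for s
    by (simp add: k_def l_def crs_expand algebra_simps)
  have *: "k + s * l \<noteq> 0" if "s \<noteq> - k / l" for s
    using that assms by (auto simp: l_def field_simps)
  have "eventually (\<lambda>s. s \<noteq> - k / l) (at_right (0::real))"
  proof (cases "k / l < 0")
    case True
    have "((\<lambda>s::real. s) \<longlongrightarrow> 0) (at_right 0)" by simp
    then have "eventually (\<lambda>s::real. s < - k / l) (at_right 0)"
      by (rule order_tendstoD) (use True in simp)
    then show ?thesis by (rule eventually_mono) simp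
  next
    case False
    then show ?thesis using eventually_at_right_less[of "0::real"]
      by (elim eventually_mono) auto
  qed
  then show ?thesis unfolding eq by (rule eventually_mono) (rule *)
qed

definition transversal :: "complex \<Rightarrow> complex \<Rightarrow> complex \<Rightarrow> complex \<Rightarrow> bool" where
  "transversal a b c u \<longleftrightarrow> crs (b - a) u \<noteq> 0 \<and> crs (c - b) u \<noteq> 0 \<and> crs (a - c) u \<noteq> 0"

lemma eventually_off_lines:
  assumes "transversal a b c u"
  shows "eventually (\<lambda>s::real. off_lines a b c (x + of_real s * u)) (at_right 0)"
  unfolding off_lines_def eventually_conj_iff
  using assms eventually_off_line by (simp add: transversal_def)

lemma finite_not_transversal:
  assumes "ccw a b c"
  shows "finite {\<phi>\<in>{0..2 * pi}. \<not> transversal a b c (cis \<phi>)}"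
proof -
  have fin: "finite {\<phi>\<in>{0..2 * pi}. crs e (cis \<phi>) = 0}" if "e \<noteq> 0" for e
  proof -
    define t where "t = Arg e"
    have crs: "crs e (cis \<phi>) = norm e * sin (\<phi> - t)" for \<phi>
    proof -
      have "e = of_real (norm e) * cis t" using that by (simp add: t_def cis_Arg complex_sgn_def scaleR_conv_of_real)
      then have "crs e (cis \<phi>) = crs (of_real (norm e) * cis t) (cis \<phi>)" by simp
      also have "\<dots> = norm e * sin (\<phi> - t)" by (simp add: crs_expand sin_diff algebra_simps)
      finally show ?thesis .
    qed
    have t: "- pi < t" "t \<le> pi" using Arg_bounded[of e] by (auto simp: t_def)
    have "\<phi> \<in> (\<lambda>i. t + of_int i * pi) ` {-5..5}" if \<phi>: "\<phi> \<in> {0..2 * pi}" "crs e (cis \<phi>) = 0" for \<phi>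
    proof -
      have "sin (\<phi> - t) = 0" using \<phi>(2) \<open>e \<noteq> 0\<close> by (simp add: crs)
      then obtain i where i: "\<phi> - t = of_int i * pi" by (auto simp: sin_zero_iff_int2)
      have "of_int i * pi < 5 * pi" "- 5 * pi < of_int i * pi"
        unfolding i[symmetric] using t \<phi>(1) pi_gt_zero by simp_all
      then have "(of_int i :: real) < 5" "- 5 < (of_int i :: real)"
        using pi_gt_zero mult_less_cancel_right_pos by blast+
      then have "i \<in> {-5..5}" by auto
      then show ?thesis using i by (auto intro: image_eqI[of _ _ i])
    qed
    then have "{\<phi>\<in>{0..2 * pi}. crs e (cis \<phi>) = 0} \<subseteq> (\<lambda>i. t + of_int i * pi) ` {-5..5}" by blast
    then show ?thesis by (rule finite_subset) simp
  qed
  have "b - a \<noteq> 0" "c - b \<noteq> 0" "a - c \<noteq> 0"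
    using assms by (auto simp: ccw_def crs_expand)
  then have "finite ({\<phi>\<in>{0..2 * pi}. crs (b - a) (cis \<phi>) = 0} \<union> {\<phi>\<in>{0..2 * pi}. crs (c - b) (cis \<phi>) = 0}
     \<union> {\<phi>\<in>{0..2 * pi}. crs (a - c) (cis \<phi>) = 0})" using fin by blast
  then show ?thesis by (rule rev_finite_subset) (auto simp: transversal_def)
qed

section \<open>Integration over the directions in a sector\<close>

lemma sin_sector_iff:
  assumes "0 \<le> d" "d < 2 * pi" "0 < \<omega>" "\<omega> \<le> pi"
  shows "0 \<le> sin d \<and> 0 \<le> sin (\<omega> - d) \<longleftrightarrow> d \<le> \<omega>"
proof (cases "d \<le> \<omega>")
  case True
  then show ?thesis using assms by (auto intro!: sin_ge_zero)
next
  case False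
  show ?thesis
  proof (cases "d \<le> pi")
    case True
    then have "sin (d - \<omega>) > 0" using False assms by (intro sin_gt_zero) auto
    then have "sin (\<omega> - d) < 0" using sin_minus[of "d - \<omega>"] by simp
    then show ?thesis using False by simp
  next
    case d: False
    then have "sin d < 0" using assms by (intro sin_lt_zero) auto
    then show ?thesis using False by simp
  qed
qed

text \<open>A sector may run across the end of the parameter interval. The condition
  \<open>G (t + pi) = G t + C\<close> makes the integral of \<open>f\<close> over a half turn equal
  to \<open>C\<close> wherever it starts, so the two pieces on either side of the cut combine to
  \<open>G (\<theta> + \<omega>) - G \<theta>\<close>.\<close>

lemma sector_integral:
  fixes G f :: "real \<Rightarrow> complex"
  assumes deriv: "\<And>t. (G has_vector_derivative f t) (at t)"
    and per: "\<And>t. G (t + pi) = G t + C"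
    and \<omega>: "0 < \<omega>" "\<omega> \<le> pi" and \<theta>: "- pi < \<theta>" "\<theta> \<le> pi"
  shows "((\<lambda>\<phi>. if 0 \<le> sin (\<phi> - \<theta>) \<and> 0 \<le> sin (\<theta> + \<omega> - \<phi>) then f \<phi> else 0)
          has_integral (G (\<theta> + \<omega>) - G \<theta>)) {0..2 * pi}"
proof -
  have per2: "G (t + 2 * pi) = G t + 2 * C" for t
    using per[of "t + pi"] per[of t] by (simp add: algebra_simps)
  have FTC: "(f has_integral (G v - G u)) {u..v}" if "u \<le> v" for u v
    using that deriv by (intro fundamental_theorem_of_calculus) (auto intro: has_vector_derivative_at_within)
  have main: "((\<lambda>\<phi>. if 0 \<le> sin (\<phi> - t) \<and> 0 \<le> sin (t + \<omega> - \<phi>) then f \<phi> else 0)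
          has_integral (G (t + \<omega>) - G t)) {0..2 * pi}" if t: "0 \<le> t" "t < 2 * pi" for t
  proof -
    \<comment> \<open>\<open>m\<close> ends the part of the sector before \<open>2 * pi\<close>, and
      \<open>k\<close> ends the part that reappears from 0; for negative \<open>k\<close> the second
      part is empty.\<close>
    define m where "m = min (t + \<omega>) (2 * pi)"
    define k where "k = t + \<omega> - 2 * pi"
    define g where "g = (\<lambda>\<phi>. (if \<phi> \<in> {t..m} then f \<phi> else 0) + (if \<phi> \<in> {0..k} then f \<phi> else 0))"
    have 1: "((\<lambda>\<phi>. if \<phi> \<in> {t..m} then f \<phi> else 0) has_integral (G m - G t)) {0..2 * pi}"
      using t \<omega> by (subst has_integral_restrict) (auto simp: m_def intro!: FTC)
    have 2: "((\<lambda>\<phi>. if \<phi> \<in> {0..k} then f \<phi> else 0) has_integral (if 0 \<le> k then G k - G 0 else 0)) {0..2 * pi}"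
    proof (cases "0 \<le> k")
      case True
      then show ?thesis using t \<omega> pi_gt_zero by (subst has_integral_restrict) (auto simp: k_def intro!: FTC)
    next
      case False
      then show ?thesis by simp
    qed
    have val: "G m - G t + (if 0 \<le> k then G k - G 0 else 0) = G (t + \<omega>) - G t"
      using per2[of k] per2[of 0] by (auto simp: m_def k_def min_def)
    have "(g has_integral (G (t + \<omega>) - G t)) {0..2 * pi}"
      using has_integral_add[OF 1 2] by (simp add: g_def val)
    then show ?thesis
    proof (rule has_integral_spike_finite[rotated 2])
      \<comment> \<open>The end point is left out because for \<open>t = 0\<close> it would give
        \<open>d = 2 * pi\<close>, outside the range required of \<open>d\<close>.\<close>
      show "finite {2 * pi}" by simp
      fix \<phi> assume \<phi>: "\<phi> \<in> {0..2 * pi} - {2 * pi}"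
      define d where "d = (if t \<le> \<phi> then \<phi> - t else \<phi> - t + 2 * pi)"
      have d: "0 \<le> d" "d < 2 * pi" using \<phi> t by (auto simp: d_def)
      have "sin (\<phi> - t) = sin d" "sin (t + \<omega> - \<phi>) = sin (\<omega> - d)"
        using sin_periodic[of "\<phi> - t"] sin_periodic[of "\<omega> - d"] by (auto simp: d_def algebra_simps)
      then have "0 \<le> sin (\<phi> - t) \<and> 0 \<le> sin (t + \<omega> - \<phi>) \<longleftrightarrow> d \<le> \<omega>"
        using sin_sector_iff[OF d \<omega>] by simp
      also have "\<dots> \<longleftrightarrow> \<phi> \<in> {t..m} \<or> \<phi> \<in> {0..k}"
        using \<phi> t \<omega> by (auto simp: d_def m_def k_def)
      finally have iff: "0 \<le> sin (\<phi> - t) \<and> 0 \<le> sin (t + \<omega> - \<phi>) \<longleftrightarrow> \<phi> \<in> {t..m} \<or> \<phi> \<in> {0..k}" .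
      have "\<not> (\<phi> \<in> {t..m} \<and> \<phi> \<in> {0..k})" using \<omega> pi_gt_zero by (auto simp: k_def)
      then show "(if 0 \<le> sin (\<phi> - t) \<and> 0 \<le> sin (t + \<omega> - \<phi>) then f \<phi> else 0) = g \<phi>"
        unfolding iff by (auto simp: g_def)
    qed
  qed
  show ?thesis
  proof (cases "0 \<le> \<theta>")
    case True
    then show ?thesis using main[of \<theta>] \<theta> pi_gt_zero by simp
  next
    case False
    have "((\<lambda>\<phi>. if 0 \<le> sin (\<phi> - (\<theta> + 2 * pi)) \<and> 0 \<le> sin (\<theta> + 2 * pi + \<omega> - \<phi>) then f \<phi> else 0)
          has_integral (G (\<theta> + 2 * pi + \<omega>) - G (\<theta> + 2 * pi))) {0..2 * pi}"
      by (rule main) (use \<theta> False in auto)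
    moreover have "sin (\<phi> - (\<theta> + 2 * pi)) = sin (\<phi> - \<theta>)" "sin (\<theta> + 2 * pi + \<omega> - \<phi>) = sin (\<theta> + \<omega> - \<phi>)" for \<phi>
      using sin_periodic[of "\<phi> - \<theta> - 2 * pi"] sin_periodic[of "\<theta> + \<omega> - \<phi>"] by (simp_all add: algebra_simps)
    moreover have "G (\<theta> + 2 * pi + \<omega>) - G (\<theta> + 2 * pi) = G (\<theta> + \<omega>) - G \<theta>"
      using per2[of \<theta>] per2[of "\<theta> + \<omega>"] by (simp add: algebra_simps)
    ultimately show ?thesis by simp
  qed
qed

text \<open>The corners are permuted cyclically, never swapped, so that \<open>F\<close> always
  receives the apex first and a triangle of the same orientation.\<close>

definition vertex_sum :: "(complex \<Rightarrow> complex \<Rightarrow> complex \<Rightarrow> 'a::monoid_add) \<Rightarrow> complex \<Rightarrow> complex \<Rightarrow> complex \<Rightarrow> complex \<Rightarrow> 'a" where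
  "vertex_sum F a b c x = (if x = a then F a b c else 0) + (if x = b then F b c a else 0) + (if x = c then F c a b else 0)"

definition angle_ccw :: "complex \<Rightarrow> complex \<Rightarrow> complex \<Rightarrow> real" where
  "angle_ccw a b c = Arg ((c - a) / (b - a))"

lemma ccw_distinct:
  assumes "ccw a b c"
  shows "a \<noteq> b" "b \<noteq> c" "a \<noteq> c"
  using assms by (auto simp: ccw_def crs_expand)

lemma crs_cramer: "of_real (crs u v) * w = of_real (crs w v) * u + of_real (crs u w) * v"
  unfolding complex_eq_iff by (simp add: crs_expand algebra_simps)

lemma rcis_Arg_eq: "z = of_real (norm z) * cis (Arg z)"
  using rcis_cmod_Arg[of z] by (simp add: rcis_def)

lemma crs_polar: "crs z (cis \<phi>) = norm z * sin (\<phi> - Arg z)"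
proof -
  have "crs z (cis \<phi>) = crs (of_real (norm z) * cis (Arg z)) (cis \<phi>)"
    using rcis_Arg_eq[of z] by simp
  also have "\<dots> = norm z * sin (\<phi> - Arg z)" by (simp add: crs_expand sin_diff algebra_simps)
  finally show ?thesis .
qed

lemma angle_ccw:
  assumes "ccw a b c"
  shows "0 < angle_ccw a b c" "angle_ccw a b c < pi"
    and "c - a = of_real (norm (c - a)) * cis (Arg (b - a) + angle_ccw a b c)"
proof -
  have ab: "b - a \<noteq> 0" and ac: "c - a \<noteq> 0" using ccw_distinct[OF assms] by auto
  have "(c - a) / (b - a) = (cnj (b - a) * (c - a)) / of_real (norm (b - a) ^ 2)"
    by (subst complex_div_cnj) (simp add: mult.commute)
  then have "Im ((c - a) / (b - a)) = crs (b - a) (c - a) / norm (b - a) ^ 2"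
    by (simp add: crs_def Im_divide_of_real del: of_real_power complex_cnj_diff)
  then have im: "Im ((c - a) / (b - a)) > 0"
    using assms ab by (simp add: ccw_def)
  then show "0 < angle_ccw a b c" "angle_ccw a b c < pi"
    unfolding angle_ccw_def using Arg_lt_pi[of "(c - a) / (b - a)"] by auto
  have "c - a = (b - a) * ((c - a) / (b - a))" using ab by simp
  also have "\<dots> = (of_real (norm (b - a)) * cis (Arg (b - a))) *
      (of_real (norm ((c - a) / (b - a))) * cis (Arg ((c - a) / (b - a))))"
    using rcis_Arg_eq[of "b - a"] rcis_Arg_eq[of "(c - a) / (b - a)"] by simp
  also have "\<dots> = of_real (norm (b - a) * norm ((c - a) / (b - a))) * cis (Arg (b - a) + angle_ccw a b c)"
    by (simp add: cis_mult[symmetric] angle_ccw_def mult_ac)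
  also have "norm (b - a) * norm ((c - a) / (b - a)) = norm (c - a)"
    using ab by (simp add: norm_divide)
  finally show "c - a = of_real (norm (c - a)) * cis (Arg (b - a) + angle_ccw a b c)" .
qed

lemma triangle_cone_rotate: "triangle_cone b c a = triangle_cone a b c"
  by (auto simp: triangle_cone_def fun_eq_iff)

lemma triangle_cone_vertex:
  assumes "ccw a b c"
  shows "cis \<phi> \<in> triangle_cone a b c a \<longleftrightarrow>
    0 \<le> sin (\<phi> - Arg (b - a)) \<and> 0 \<le> sin (Arg (b - a) + angle_ccw a b c - \<phi>)"
proof -
  define \<psi> where "\<psi> = Arg (b - a) + angle_ccw a b c"
  have D: "crs (c - b) (a - b) > 0" using assms by (simp add: ccw_def crs_expand algebra_simps)
  have ab: "norm (b - a) > 0" and ac: "norm (c - a) > 0" using ccw_distinct[OF assms] by auto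
  have "crs (a - c) (cis \<phi>) = crs (- (of_real (norm (c - a)) * cis \<psi>)) (cis \<phi>)"
    using angle_ccw(3)[OF assms] by (simp add: \<psi>_def)
  also have "\<dots> = norm (c - a) * sin (\<psi> - \<phi>)" by (simp add: crs_expand sin_diff algebra_simps)
  finally have ca: "crs (a - c) (cis \<phi>) = norm (c - a) * sin (\<psi> - \<phi>)" .
  have "0 \<le> crs (a - c) (cis \<phi>) \<longleftrightarrow> 0 \<le> sin (\<psi> - \<phi>)"
    unfolding ca using ac by (simp add: zero_le_mult_iff)
  moreover have "0 \<le> crs (b - a) (cis \<phi>) \<longleftrightarrow> 0 \<le> sin (\<phi> - Arg (b - a))"
    unfolding crs_polar using ab by (simp add: zero_le_mult_iff)
  ultimately show ?thesis
    unfolding triangle_cone_def half_plane_cone_def \<psi>_def using D by simp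
qed

lemma triangle_vertex_iff:
  assumes "ccw a b c"
  shows "crs (b - a) (x - a) = 0 \<and> crs (a - c) (x - c) = 0 \<longleftrightarrow> x = a"
proof
  assume *: "crs (b - a) (x - a) = 0 \<and> crs (a - c) (x - c) = 0"
  have "crs (x - a) (c - a) = 0" using * by (simp add: crs_expand algebra_simps)
  then have "of_real (crs (b - a) (c - a)) * (x - a) = 0"
    using * crs_cramer[of "b - a" "c - a" "x - a"] by simp
  then show "x = a" using assms by (simp add: ccw_def)
qed (simp add: crs_expand algebra_simps)

text \<open>Away from the corners the cone at \<open>x\<close> is empty, a half plane or the whole
  plane, and the integral over it is 0, \<open>C\<close> or \<open>2 * C\<close>. The last clause
  records that a nonzero \<open>m\<close> can only come from a point of the triangle that is not a
  corner.\<close>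

lemma triangle_cone_integral:
  fixes G f :: "real \<Rightarrow> complex"
  assumes ccw: "ccw a b c"
    and deriv: "\<And>t. (G has_vector_derivative f t) (at t)"
    and per: "\<And>t. G (t + pi) = G t + C"
  defines "F \<equiv> \<lambda>a b c. G (Arg (b - a) + angle_ccw a b c) - G (Arg (b - a))"
  shows "\<exists>m::nat. ((\<lambda>\<phi>. if cis \<phi> \<in> triangle_cone a b c x then f \<phi> else 0)
          has_integral (vertex_sum F a b c x + of_nat m * C)) {0..2 * pi}
          \<and> (m \<noteq> 0 \<longrightarrow> in_triangle a b c x \<and> x \<notin> {a, b, c})"
proof -
  note sector = sector_integral[OF deriv per]
  have Arg: "- pi < Arg z" "Arg z \<le> pi" for z using Arg_bounded[of z] by auto
  have apex: "((\<lambda>\<phi>. if cis \<phi> \<in> triangle_cone a b c a then f \<phi> else 0) has_integral F a b c) {0..2 * pi}"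
    if "ccw a b c" for a b c
    unfolding triangle_cone_vertex[OF that] F_def
    using angle_ccw[OF that] by (intro sector Arg) auto
  have edge: "((\<lambda>\<phi>. if cis \<phi> \<in> triangle_cone a b c x then f \<phi> else 0) has_integral C) {0..2 * pi}"
    if "ccw a b c" "crs (b - a) (x - a) = 0" "crs (c - b) (x - b) > 0" "crs (a - c) (x - c) > 0" for a b c
  proof -
    have "norm (b - a) > 0" using ccw_distinct[OF that(1)] by simp
    then have iff: "cis \<phi> \<in> triangle_cone a b c x \<longleftrightarrow> 0 \<le> sin (\<phi> - Arg (b - a)) \<and> 0 \<le> sin (Arg (b - a) + pi - \<phi>)" for \<phi>
      using that sin_pi_minus[of "\<phi> - Arg (b - a)"]
      by (simp add: triangle_cone_def half_plane_cone_def crs_polar zero_le_mult_iff algebra_simps)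
    have "G (Arg (b - a) + pi) - G (Arg (b - a)) = C" using per by simp
    then show ?thesis unfolding iff using sector[of pi "Arg (b - a)"] Arg by simp
  qed
  have no_vertex: "vertex_sum F a b c x = 0" if "x \<noteq> a" "x \<noteq> b" "x \<noteq> c"
    using that by (simp add: vertex_sum_def)
  have ccws: "ccw a b c" "ccw b c a" "ccw c a b" using ccw ccw_rotate by blast+
  note distinct = ccw_distinct[OF ccw]
  consider (vertex) "x = a \<or> x = b \<or> x = c"
    | (out) "x \<noteq> a" "x \<noteq> b" "x \<noteq> c" "\<not> in_triangle a b c x"
    | (inner) "x \<noteq> a" "x \<noteq> b" "x \<noteq> c" "crs (b - a) (x - a) > 0" "crs (c - b) (x - b) > 0" "crs (a - c) (x - c) > 0"
    | (e1) "x \<noteq> a" "x \<noteq> b" "x \<noteq> c" "crs (b - a) (x - a) = 0" "crs (c - b) (x - b) > 0" "crs (a - c) (x - c) > 0"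
    | (e2) "x \<noteq> a" "x \<noteq> b" "x \<noteq> c" "crs (c - b) (x - b) = 0" "crs (a - c) (x - c) > 0" "crs (b - a) (x - a) > 0"
    | (e3) "x \<noteq> a" "x \<noteq> b" "x \<noteq> c" "crs (a - c) (x - c) = 0" "crs (b - a) (x - a) > 0" "crs (c - b) (x - b) > 0"
    using triangle_vertex_iff[OF ccws(1), of x] triangle_vertex_iff[OF ccws(2), of x]
      triangle_vertex_iff[OF ccws(3), of x]
    unfolding in_triangle_def by (smt (verit))
  then show ?thesis
  proof cases
    case vertex
    then consider "x = a" | "x = b" | "x = c" by blast
    then show ?thesis
    proof cases
      case 1
      then show ?thesis using distinct apex[OF ccws(1)] by (intro exI[of _ 0]) (simp add: vertex_sum_def)
    next
      case 2
      then show ?thesis using distinct apex[OF ccws(2)]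
        by (intro exI[of _ 0]) (simp add: vertex_sum_def triangle_cone_rotate)
    next
      case 3
      then show ?thesis using distinct apex[OF ccws(3)]
        by (intro exI[of _ 0]) (simp add: vertex_sum_def triangle_cone_rotate[of b c a, symmetric]
          triangle_cone_rotate[of c a b, symmetric])
    qed
  next
    case out
    then have "triangle_cone a b c x = {}"
      by (auto simp: in_triangle_def triangle_cone_def half_plane_cone_def)
    then show ?thesis using out by (intro exI[of _ 0]) (simp add: no_vertex in_triangle_def)
  next
    case inner
    then have "triangle_cone a b c x = UNIV"
      by (auto simp: triangle_cone_def half_plane_cone_def)
    moreover have "(f has_integral (G (2 * pi) - G 0)) {0..2 * pi}"
      using deriv by (intro fundamental_theorem_of_calculus) (auto intro: has_vector_derivative_at_within)
    moreover have "G (2 * pi) - G 0 = 2 * C"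
      using per[of pi] per[of 0] by (simp add: algebra_simps)
    ultimately show ?thesis using inner by (intro exI[of _ 2]) (simp add: no_vertex in_triangle_def)
  next
    case e1
    then show ?thesis using edge[OF ccws(1)] by (intro exI[of _ 1]) (simp add: no_vertex in_triangle_def)
  next
    case e2
    then show ?thesis using edge[OF ccws(2)] by (intro exI[of _ 1]) (simp add: no_vertex in_triangle_def triangle_cone_rotate)
  next
    case e3
    then show ?thesis using edge[OF ccws(3)] by (intro exI[of _ 1]) (simp add: no_vertex in_triangle_def
       triangle_cone_rotate[of b c a, symmetric] triangle_cone_rotate[of c a b, symmetric])
  qed
qed

section \<open>Families of triangles with equal covering\<close>

definition ccw_family :: "'i set \<Rightarrow> ('i \<Rightarrow> complex) \<Rightarrow> ('i \<Rightarrow> complex) \<Rightarrow> ('i \<Rightarrow> complex) \<Rightarrow> bool" where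
  "ccw_family I A B C \<longleftrightarrow> finite I \<and> (\<forall>i\<in>I. ccw (A i) (B i) (C i))"

definition generic_point :: "'i set \<Rightarrow> ('i \<Rightarrow> complex) \<Rightarrow> ('i \<Rightarrow> complex) \<Rightarrow> ('i \<Rightarrow> complex) \<Rightarrow> complex \<Rightarrow> bool" where
  "generic_point I A B C p \<longleftrightarrow> (\<forall>i\<in>I. off_lines (A i) (B i) (C i) p)"

definition cover_count :: "'i set \<Rightarrow> ('i \<Rightarrow> complex) \<Rightarrow> ('i \<Rightarrow> complex) \<Rightarrow> ('i \<Rightarrow> complex) \<Rightarrow> complex \<Rightarrow> nat" where
  "cover_count I A B C p = card {i \<in> I. in_triangle (A i) (B i) (C i) p}"

definition cone_count :: "'i set \<Rightarrow> ('i \<Rightarrow> complex) \<Rightarrow> ('i \<Rightarrow> complex) \<Rightarrow> ('i \<Rightarrow> complex) \<Rightarrow> complex \<Rightarrow> complex \<Rightarrow> nat" where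
  "cone_count I A B C x u = card {i \<in> I. u \<in> triangle_cone (A i) (B i) (C i) x}"

text \<open>A short step from \<open>x\<close> in a direction parallel to no side ends off all side
  lines, and the triangles met there are those whose cone at \<open>x\<close> contains the
  direction. This turns equal covering of generic points into equal cone counts at every
  point.\<close>

lemma eventually_cone_count:
  assumes "ccw_family I A B C" and "\<forall>i\<in>I. transversal (A i) (B i) (C i) u"
  shows "eventually (\<lambda>s::real. generic_point I A B C (x + of_real s * u) \<and>
    cover_count I A B C (x + of_real s * u) = cone_count I A B C x u) (at_right 0)"
proof -
  have "eventually (\<lambda>s::real. \<forall>i\<in>I. off_lines (A i) (B i) (C i) (x + of_real s * u) \<and>
     in_triangle (A i) (B i) (C i) (x + of_real s * u) = (u \<in> triangle_cone (A i) (B i) (C i) x)) (at_right 0)"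
    using assms eventually_in_triangle eventually_off_lines
    by (intro eventually_ball_finite) (auto simp: ccw_family_def eventually_conj_iff)
  then show ?thesis
    by (rule eventually_mono) (auto simp: generic_point_def cover_count_def cone_count_def intro!: arg_cong[where f = card])
qed

lemma finite_nontransversal_directions:
  assumes "ccw_family I A B C"
  shows "finite {\<phi>\<in>{0..2 * pi}. \<not> (\<forall>i\<in>I. transversal (A i) (B i) (C i) (cis \<phi>))}"
proof -
  have "{\<phi>\<in>{0..2 * pi}. \<not> (\<forall>i\<in>I. transversal (A i) (B i) (C i) (cis \<phi>))}
     = (\<Union>i\<in>I. {\<phi>\<in>{0..2 * pi}. \<not> transversal (A i) (B i) (C i) (cis \<phi>)})" by blast
  then show ?thesis using assms finite_not_transversal by (simp add: ccw_family_def)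
qed

lemma family_integral:
  fixes G f :: "real \<Rightarrow> complex" and A B C :: "'i \<Rightarrow> complex"
  assumes fam: "ccw_family I A B C"
    and deriv: "\<And>t. (G has_vector_derivative f t) (at t)"
    and per: "\<And>t. G (t + pi) = G t + K"
  defines "F \<equiv> \<lambda>a b c. G (Arg (b - a) + angle_ccw a b c) - G (Arg (b - a))"
  shows "\<exists>m::nat. ((\<lambda>\<phi>. of_nat (cone_count I A B C x (cis \<phi>)) * f \<phi>)
          has_integral ((\<Sum>i\<in>I. vertex_sum F (A i) (B i) (C i) x) + of_nat m * K)) {0..2 * pi}
     \<and> (m \<noteq> 0 \<longrightarrow> (\<exists>i\<in>I. in_triangle (A i) (B i) (C i) x \<and> x \<notin> {A i, B i, C i}))"
proof -
  have "\<exists>m::nat. ((\<lambda>\<phi>. if cis \<phi> \<in> triangle_cone (A i) (B i) (C i) x then f \<phi> else 0)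
          has_integral (vertex_sum F (A i) (B i) (C i) x + of_nat m * K)) {0..2 * pi}
          \<and> (m \<noteq> 0 \<longrightarrow> in_triangle (A i) (B i) (C i) x \<and> x \<notin> {A i, B i, C i})" if "i \<in> I" for i
    unfolding F_def
    by (rule triangle_cone_integral[OF _ deriv per]) (use fam that in \<open>simp add: ccw_family_def\<close>)
  then have "\<exists>m::'i \<Rightarrow> nat. \<forall>i\<in>I. ((\<lambda>\<phi>. if cis \<phi> \<in> triangle_cone (A i) (B i) (C i) x then f \<phi> else 0)
          has_integral (vertex_sum F (A i) (B i) (C i) x + of_nat (m i) * K)) {0..2 * pi}
          \<and> (m i \<noteq> 0 \<longrightarrow> in_triangle (A i) (B i) (C i) x \<and> x \<notin> {A i, B i, C i})"
    by (intro bchoice ballI)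
  then obtain m where m: "\<And>i. i \<in> I \<Longrightarrow> ((\<lambda>\<phi>. if cis \<phi> \<in> triangle_cone (A i) (B i) (C i) x then f \<phi> else 0)
          has_integral (vertex_sum F (A i) (B i) (C i) x + of_nat (m i) * K)) {0..2 * pi}"
     "\<And>i. i \<in> I \<Longrightarrow> m i \<noteq> 0 \<longrightarrow> in_triangle (A i) (B i) (C i) x \<and> x \<notin> {A i, B i, C i}"
    by (elim exE) (simp only: Ball_def, blast)
  have fin: "finite I" using fam by (simp add: ccw_family_def)
  have "((\<lambda>\<phi>. \<Sum>i\<in>I. if cis \<phi> \<in> triangle_cone (A i) (B i) (C i) x then f \<phi> else 0)
      has_integral (\<Sum>i\<in>I. vertex_sum F (A i) (B i) (C i) x + of_nat (m i) * K)) {0..2 * pi}"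
    using fin m(1) by (rule has_integral_sum)
  moreover have "(\<Sum>i\<in>I. if cis \<phi> \<in> triangle_cone (A i) (B i) (C i) x then f \<phi> else 0)
      = of_nat (cone_count I A B C x (cis \<phi>)) * f \<phi>" for \<phi>
    using fin by (simp add: cone_count_def sum.inter_filter[symmetric])
  moreover have "(\<Sum>i\<in>I. vertex_sum F (A i) (B i) (C i) x + of_nat (m i) * K)
      = (\<Sum>i\<in>I. vertex_sum F (A i) (B i) (C i) x) + of_nat (\<Sum>i\<in>I. m i) * K"
    by (simp add: sum.distrib sum_distrib_right)
  ultimately show ?thesis
    using m(2) fin by (intro exI[of _ "\<Sum>i\<in>I. m i"]) auto
qed

lemma cone_count_eq:
  assumes I: "ccw_family I A B C" and J: "ccw_family J A' B' C'"
    and eq: "\<And>p. generic_point I A B C p \<Longrightarrow> generic_point J A' B' C' p \<Longrightarrow>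
               cover_count I A B C p = cover_count J A' B' C' p"
    and tr: "\<forall>i\<in>I. transversal (A i) (B i) (C i) u" "\<forall>j\<in>J. transversal (A' j) (B' j) (C' j) u"
  shows "cone_count I A B C x u = cone_count J A' B' C' x u"
proof -
  have "eventually (\<lambda>s::real. cone_count I A B C x u = cone_count J A' B' C' x u) (at_right 0)"
    using eventually_cone_count[OF I tr(1), of x] eventually_cone_count[OF J tr(2), of x]
    by eventually_elim (use eq in metis)
  then show ?thesis by simp
qed

text \<open>Equal covering makes the two integrands agree except in finitely many directions. The
  multiples of \<open>K\<close> come from triangles that contain \<open>x\<close> off their corners;
  the clause on \<open>m'\<close> allows them to be ruled out for the triangulation from the centre
  at a vertex of the polygon.\<close>

lemma vertex_sum_balance:
  fixes G f :: "real \<Rightarrow> complex"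
  assumes I: "ccw_family I A B C" and J: "ccw_family J A' B' C'"
    and eq: "\<And>p. generic_point I A B C p \<Longrightarrow> generic_point J A' B' C' p \<Longrightarrow>
               cover_count I A B C p = cover_count J A' B' C' p"
    and deriv: "\<And>t. (G has_vector_derivative f t) (at t)"
    and per: "\<And>t. G (t + pi) = G t + K"
  defines "F \<equiv> \<lambda>a b c. G (Arg (b - a) + angle_ccw a b c) - G (Arg (b - a))"
  shows "\<exists>m m' :: nat. (\<Sum>i\<in>I. vertex_sum F (A i) (B i) (C i) x) + of_nat m * K =
      (\<Sum>j\<in>J. vertex_sum F (A' j) (B' j) (C' j) x) + of_nat m' * K
      \<and> (m' \<noteq> 0 \<longrightarrow> (\<exists>j\<in>J. in_triangle (A' j) (B' j) (C' j) x \<and> x \<notin> {A' j, B' j, C' j}))"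
proof -
  obtain m where m: "((\<lambda>\<phi>. of_nat (cone_count I A B C x (cis \<phi>)) * f \<phi>)
          has_integral ((\<Sum>i\<in>I. vertex_sum F (A i) (B i) (C i) x) + of_nat m * K)) {0..2 * pi}"
    using family_integral[OF I deriv per, of x, folded F_def] by (elim exE conjE)
  obtain m' where m': "((\<lambda>\<phi>. of_nat (cone_count J A' B' C' x (cis \<phi>)) * f \<phi>)
          has_integral ((\<Sum>i\<in>J. vertex_sum F (A' i) (B' i) (C' i) x) + of_nat m' * K)) {0..2 * pi}"
    "m' \<noteq> 0 \<longrightarrow> (\<exists>j\<in>J. in_triangle (A' j) (B' j) (C' j) x \<and> x \<notin> {A' j, B' j, C' j})"
    using family_integral[OF J deriv per, of x, folded F_def] by (elim exE conjE)
  define S where "S = {\<phi>\<in>{0..2 * pi}. \<not> (\<forall>i\<in>I. transversal (A i) (B i) (C i) (cis \<phi>))}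
     \<union> {\<phi>\<in>{0..2 * pi}. \<not> (\<forall>j\<in>J. transversal (A' j) (B' j) (C' j) (cis \<phi>))}"
  have "finite S" unfolding S_def
    using finite_nontransversal_directions[OF I] finite_nontransversal_directions[OF J] by (rule finite_UnI)
  then have "((\<lambda>\<phi>. of_nat (cone_count J A' B' C' x (cis \<phi>)) * f \<phi>)
          has_integral ((\<Sum>i\<in>I. vertex_sum F (A i) (B i) (C i) x) + of_nat m * K)) {0..2 * pi}"
  proof (rule has_integral_spike_finite[OF _ _ m])
    fix \<phi> assume "\<phi> \<in> {0..2 * pi} - S"
    then have "cone_count I A B C x (cis \<phi>) = cone_count J A' B' C' x (cis \<phi>)"
      by (intro cone_count_eq[OF I J eq]) (auto simp: S_def)
    then show "of_nat (cone_count J A' B' C' x (cis \<phi>)) * f \<phi> = of_nat (cone_count I A B C x (cis \<phi>)) * f \<phi>"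
      by simp
  qed
  then have "(\<Sum>i\<in>I. vertex_sum F (A i) (B i) (C i) x) + of_nat m * K =
      (\<Sum>j\<in>J. vertex_sum F (A' j) (B' j) (C' j) x) + of_nat m' * K"
    using m'(1) by (rule has_integral_unique)
  then show ?thesis using m'(2) by blast
qed

lemma angle_deriv: "((\<lambda>t::real. of_real t :: complex) has_vector_derivative 1) (at t)"
  using has_vector_derivative_of_real[OF DERIV_ident] by simp

lemma vertex_sum_of_real:
  "vertex_sum (\<lambda>a b c. of_real (F a b c) :: complex) a b c x = of_real (vertex_sum F a b c x)"
  by (simp add: vertex_sum_def)

text \<open>The case where \<open>G\<close> is the identity: the local term is then the angle
  itself, and a half turn counts \<open>pi\<close>.\<close>

lemma angle_sum_balance:
  assumes I: "ccw_family I A B C" and J: "ccw_family J A' B' C'"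
    and eq: "\<And>p. generic_point I A B C p \<Longrightarrow> generic_point J A' B' C' p \<Longrightarrow>
               cover_count I A B C p = cover_count J A' B' C' p"
  shows "\<exists>m m' :: nat. (\<Sum>i\<in>I. vertex_sum angle_ccw (A i) (B i) (C i) x) + of_nat m * pi =
      (\<Sum>j\<in>J. vertex_sum angle_ccw (A' j) (B' j) (C' j) x) + of_nat m' * pi
      \<and> (m' \<noteq> 0 \<longrightarrow> (\<exists>j\<in>J. in_triangle (A' j) (B' j) (C' j) x \<and> x \<notin> {A' j, B' j, C' j}))"
proof -
  obtain m m' :: nat where *: "(\<Sum>i\<in>I. vertex_sum (\<lambda>a b c. of_real (angle_ccw a b c)) (A i) (B i) (C i) x) + of_nat m * of_real pi =
      (\<Sum>j\<in>J. vertex_sum (\<lambda>a b c. of_real (angle_ccw a b c)) (A' j) (B' j) (C' j) x) + of_nat m' * (of_real pi :: complex)"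
      "m' \<noteq> 0 \<longrightarrow> (\<exists>j\<in>J. in_triangle (A' j) (B' j) (C' j) x \<and> x \<notin> {A' j, B' j, C' j})"
    using vertex_sum_balance[OF I J eq angle_deriv, of "of_real pi" x] by auto
  from *(1) have "complex_of_real ((\<Sum>i\<in>I. vertex_sum angle_ccw (A i) (B i) (C i) x) + of_nat m * pi) =
      of_real ((\<Sum>j\<in>J. vertex_sum angle_ccw (A' j) (B' j) (C' j) x) + of_nat m' * pi)"
    by (simp add: vertex_sum_of_real)
  then show ?thesis using *(2) of_real_eq_iff by blast
qed

lemma angle_sum_le:
  assumes I: "ccw_family I A B C" and le: "\<And>p. generic_point I A B C p \<Longrightarrow> cover_count I A B C p \<le> 1"
  shows "(\<Sum>i\<in>I. vertex_sum angle_ccw (A i) (B i) (C i) x) \<le> 2 * pi"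
proof -
  obtain m :: nat where m: "((\<lambda>\<phi>. of_nat (cone_count I A B C x (cis \<phi>)) * 1)
          has_integral ((\<Sum>i\<in>I. vertex_sum (\<lambda>a b c. of_real (angle_ccw a b c)) (A i) (B i) (C i) x) + of_nat m * of_real pi :: complex)) (cbox 0 (2 * pi))"
    using family_integral[OF I angle_deriv, of "of_real pi" x] by auto
  define S where "S = {\<phi>\<in>{0..2 * pi}. \<not> (\<forall>i\<in>I. transversal (A i) (B i) (C i) (cis \<phi>))}"
  have "norm (of_nat (cone_count I A B C x (cis \<phi>)) * 1 :: complex) \<le> 1" if "\<phi> \<in> cbox 0 (2 * pi) - S" for \<phi>
  proof -
    have "\<forall>i\<in>I. transversal (A i) (B i) (C i) (cis \<phi>)" using that by (auto simp: S_def)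
    from eventually_cone_count[OF I this, of x]
    have "eventually (\<lambda>s::real. cone_count I A B C x (cis \<phi>) \<le> 1) (at_right 0)"
      by (rule eventually_mono) (metis le)
    then show ?thesis by simp
  qed
  moreover have "finite S" unfolding S_def by (rule finite_nontransversal_directions[OF I])
  ultimately have "norm ((\<Sum>i\<in>I. vertex_sum (\<lambda>a b c. of_real (angle_ccw a b c)) (A i) (B i) (C i) x) + of_nat m * of_real pi :: complex)
      \<le> 1 * measure lborel (cbox 0 (2 * pi))"
    by (intro has_integral_bound_spike_finite[OF _ _ m]) auto
  also have "(\<Sum>i\<in>I. vertex_sum (\<lambda>a b c. of_real (angle_ccw a b c)) (A i) (B i) (C i) x) + of_nat m * of_real pi
     = complex_of_real ((\<Sum>i\<in>I. vertex_sum angle_ccw (A i) (B i) (C i) x) + of_nat m * pi)"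
    by (simp add: vertex_sum_of_real)
  finally have "\<bar>(\<Sum>i\<in>I. vertex_sum angle_ccw (A i) (B i) (C i) x) + of_nat m * pi\<bar> \<le> 2 * pi"
    unfolding norm_of_real using pi_gt_zero by simp
  moreover have "0 \<le> of_nat m * pi" by simp
  ultimately show ?thesis by linarith
qed

section \<open>Functions of points and lines\<close>

lemma polynomial_interpolation:
  fixes h :: "'a::field \<Rightarrow> 'a"
  assumes "finite S"
  shows "\<exists>p. \<forall>w\<in>S. poly p w = h w"
  using assms
proof induction
  case (insert w S)
  then obtain p where p: "\<forall>v\<in>S. poly p v = h v" by blast
  define q where "q = (\<Prod>v\<in>S. [:- v, 1:])"
  have q: "poly q w \<noteq> 0" "\<forall>v\<in>S. poly q v = 0"
    using insert.hyps by (auto simp: q_def poly_prod)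
  show ?case
    by (rule exI[of _ "p + smult ((h w - poly p w) / poly q w) q"]) (use p q in auto)
qed simp

text \<open>The square of the direction of a line; it does not depend on the orientation.\<close>

definition line_dir :: "complex \<Rightarrow> complex \<Rightarrow> complex" where
  "line_dir a b = (b - a) / cnj (b - a)"

lemma line_dir_commute: "line_dir b a = line_dir a b"
  by (cases "a = b") (simp_all add: line_dir_def divide_simps algebra_simps)

lemma line_dir_polar:
  assumes "b - a = of_real r * cis t" and "r \<noteq> 0"
  shows "line_dir a b = cis (2 * t)"
proof -
  have "line_dir a b = cis t / cis (- t)"
    unfolding line_dir_def assms(1) using assms(2) by (simp add: cis_cnj)
  then show ?thesis by (simp add: cis_divide)
qed

text \<open>Only finitely many line directions occur, so \<open>h\<close> may be replaced by a polynomial \<open>p\<close>. Then the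
  summand at a vertex is the integral of the derivative of \<open>p (cis 2t)\<close> over the directions pointing into the
  triangle, and the corresponding integral over a full circle or a half circle vanishes.\<close>

lemma line_function_balance:
  fixes h :: "complex \<Rightarrow> complex"
  assumes I: "ccw_family I A B C" and J: "ccw_family J A' B' C'"
    and eq: "\<And>p. generic_point I A B C p \<Longrightarrow> generic_point J A' B' C' p \<Longrightarrow>
               cover_count I A B C p = cover_count J A' B' C' p"
  defines "F \<equiv> \<lambda>a b c. h (line_dir a c) - h (line_dir a b)"
  shows "(\<Sum>i\<in>I. vertex_sum F (A i) (B i) (C i) x) = (\<Sum>j\<in>J. vertex_sum F (A' j) (B' j) (C' j) x)"
proof -
  define lines where "lines a b c = {line_dir a b, line_dir b c, line_dir c a}" for a b c
  define S where "S = (\<Union>i\<in>I. lines (A i) (B i) (C i)) \<union> (\<Union>j\<in>J. lines (A' j) (B' j) (C' j))"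
  have "finite S" using I J by (auto simp: S_def lines_def ccw_family_def)
  then obtain p where p: "\<And>w. w \<in> S \<Longrightarrow> poly p w = h w" using polynomial_interpolation[of S h] by blast
  define G where "G t = poly p (cis (2 * t))" for t
  define f where "f t = 2 * (\<i> * cis (2 * t)) * poly (pderiv p) (cis (2 * t))" for t
  have cis_deriv: "((\<lambda>t. cis (2 * t)) has_vector_derivative 2 * (\<i> * cis (2 * t))) (at t)" for t
  proof -
    have "((\<lambda>t. exp (t *\<^sub>R (2 * \<i>))) has_vector_derivative exp (t *\<^sub>R (2 * \<i>)) * (2 * \<i>)) (at t)"
      by (rule exp_scaleR_has_vector_derivative_right)
    moreover have "exp (t *\<^sub>R (2 * \<i>)) = cis (2 * t)" for t
      by (simp add: cis_conv_exp scaleR_conv_of_real mult_ac)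
    ultimately show ?thesis by (simp add: mult_ac)
  qed
  have deriv: "(G has_vector_derivative f t) (at t)" for t
    unfolding G_def f_def
    using field_vector_diff_chain_at[OF cis_deriv poly_DERIV] by (simp add: o_def)
  have per: "G (t + pi) = G t + 0" for t
  proof -
    have "cis (2 * (t + pi)) = cis (2 * t)" by (simp add: complex_eq_iff distrib_left)
    then show ?thesis by (simp add: G_def)
  qed
  have F: "G (Arg (b - a) + angle_ccw a b c) - G (Arg (b - a)) = F a b c"
    if "ccw a b c" "lines a b c \<subseteq> S" for a b c
  proof -
    have "b - a = of_real (norm (b - a)) * cis (Arg (b - a))" by (rule rcis_Arg_eq)
    then have ab: "line_dir a b = cis (2 * Arg (b - a))"
      by (rule line_dir_polar) (use ccw_distinct[OF that(1)] in simp)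
    have ac: "line_dir a c = cis (2 * (Arg (b - a) + angle_ccw a b c))"
      by (rule line_dir_polar[OF angle_ccw(3)[OF that(1)]]) (use ccw_distinct[OF that(1)] in simp)
    have "line_dir a c = line_dir c a" by (rule line_dir_commute)
    then show ?thesis
      using that(2) p unfolding G_def F_def ab[symmetric] ac[symmetric] by (auto simp: lines_def)
  qed
  have vs: "vertex_sum (\<lambda>a b c. G (Arg (b - a) + angle_ccw a b c) - G (Arg (b - a))) a b c x = vertex_sum F a b c x"
    if "ccw a b c" "lines a b c \<subseteq> S" for a b c
  proof -
    have "ccw b c a" "ccw c a b" using that ccw_rotate by blast+
    moreover have "lines b c a \<subseteq> S" "lines c a b \<subseteq> S" using that by (auto simp: lines_def)
    ultimately show ?thesis
      unfolding vertex_sum_def using F[OF that] F[of b c a] F[of c a b] by (simp only:)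
  qed
  have "(\<Sum>i\<in>I. vertex_sum (\<lambda>a b c. G (Arg (b - a) + angle_ccw a b c) - G (Arg (b - a))) (A i) (B i) (C i) x)
      = (\<Sum>j\<in>J. vertex_sum (\<lambda>a b c. G (Arg (b - a) + angle_ccw a b c) - G (Arg (b - a))) (A' j) (B' j) (C' j) x)"
    using vertex_sum_balance[OF I J eq deriv per] by auto
  moreover have "(\<Sum>i\<in>I. vertex_sum (\<lambda>a b c. G (Arg (b - a) + angle_ccw a b c) - G (Arg (b - a))) (A i) (B i) (C i) x)
     = (\<Sum>i\<in>I. vertex_sum F (A i) (B i) (C i) x)"
    using I by (intro sum.cong refl vs) (auto simp: ccw_family_def S_def)
  moreover have "(\<Sum>i\<in>J. vertex_sum (\<lambda>a b c. G (Arg (b - a) + angle_ccw a b c) - G (Arg (b - a))) (A' i) (B' i) (C' i) x)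
     = (\<Sum>i\<in>J. vertex_sum F (A' i) (B' i) (C' i) x)"
    using J by (intro sum.cong refl vs) (auto simp: ccw_family_def S_def)
  ultimately show ?thesis by simp
qed

definition edge_sum :: "(complex \<Rightarrow> complex \<Rightarrow> 'a::ab_group_add) \<Rightarrow> complex \<Rightarrow> complex \<Rightarrow> complex \<Rightarrow> 'a" where
  "edge_sum E a b c = E a b + E b c + E c a"

text \<open>The local balance holds for a different function \<open>h x\<close> at every point
  \<open>x\<close>. Summed over all corners, the terms regroup by sides: each side collects
  \<open>h\<close> at its end minus \<open>h\<close> at its start, both taken in the direction of
  that side.\<close>

lemma edge_function_balance:
  fixes h :: "complex \<Rightarrow> complex \<Rightarrow> complex"
  assumes I: "ccw_family I A B C" and J: "ccw_family J A' B' C'"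
    and eq: "\<And>p. generic_point I A B C p \<Longrightarrow> generic_point J A' B' C' p \<Longrightarrow>
               cover_count I A B C p = cover_count J A' B' C' p"
  defines "E \<equiv> \<lambda>a b. h b (line_dir a b) - h a (line_dir a b)"
  shows "(\<Sum>i\<in>I. edge_sum E (A i) (B i) (C i)) = (\<Sum>j\<in>J. edge_sum E (A' j) (B' j) (C' j))"
proof -
  define F where "F x a b c = h x (line_dir a c) - h x (line_dir a b)" for x a b c
  define X where "X = (\<Union>i\<in>I. {A i, B i, C i}) \<union> (\<Union>j\<in>J. {A' j, B' j, C' j})"
  have fin: "finite X" "finite I" "finite J" using I J by (auto simp: X_def ccw_family_def)
  have sumX: "(\<Sum>x\<in>X. vertex_sum (F x) a b c x) = edge_sum E a b c" if "{a, b, c} \<subseteq> X" for a b c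
    using that fin(1) unfolding vertex_sum_def
    by (simp add: sum.distrib sum.delta edge_sum_def E_def F_def line_dir_commute[of a c]
        line_dir_commute[of b a] line_dir_commute[of c b] del: sum.delta' cong: if_cong)
  have "(\<Sum>x\<in>X. \<Sum>i\<in>I. vertex_sum (F x) (A i) (B i) (C i) x) = (\<Sum>x\<in>X. \<Sum>j\<in>J. vertex_sum (F x) (A' j) (B' j) (C' j) x)"
    unfolding F_def by (intro sum.cong refl line_function_balance[OF I J eq])
  then have "(\<Sum>i\<in>I. \<Sum>x\<in>X. vertex_sum (F x) (A i) (B i) (C i) x) = (\<Sum>j\<in>J. \<Sum>x\<in>X. vertex_sum (F x) (A' j) (B' j) (C' j) x)"
    by (simp add: sum.swap[of _ I X] sum.swap[of _ J X])
  moreover have "(\<Sum>i\<in>I. \<Sum>x\<in>X. vertex_sum (F x) (A i) (B i) (C i) x) = (\<Sum>i\<in>I. edge_sum E (A i) (B i) (C i))"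
    by (intro sum.cong refl sumX) (auto simp: X_def)
  moreover have "(\<Sum>i\<in>J. \<Sum>x\<in>X. vertex_sum (F x) (A' i) (B' i) (C' i) x) = (\<Sum>i\<in>J. edge_sum E (A' i) (B' i) (C' i))"
    by (intro sum.cong refl sumX) (auto simp: X_def)
  ultimately show ?thesis by simp
qed

section \<open>Conjugate areas\<close>

lemma angle_ccw_ratio:
  assumes "ccw a b c"
  shows "(c - a) / (b - a) = of_real (norm (c - a) / norm (b - a)) * cis (angle_ccw a b c)"
  using rcis_Arg_eq[of "(c - a) / (b - a)"] by (simp add: angle_ccw_def norm_divide)

lemma crs_eq_sin:
  assumes "ccw a b c"
  shows "crs (b - a) (c - a) = norm (b - a) * norm (c - a) * sin (angle_ccw a b c)"
proof -
  have "b - a \<noteq> 0" using ccw_distinct[OF assms] by simp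
  then have "c - a = (b - a) * (of_real (norm (c - a) / norm (b - a)) * cis (angle_ccw a b c))"
    using angle_ccw_ratio[OF assms] by (simp add: field_simps)
  then have "crs (b - a) (c - a) = Im (cnj (b - a) * ((b - a) * (of_real (norm (c - a) / norm (b - a)) * cis (angle_ccw a b c))))"
    by (simp add: crs_def)
  also have "cnj (b - a) * ((b - a) * (of_real (norm (c - a) / norm (b - a)) * cis (angle_ccw a b c)))
    = of_real (norm (b - a) ^ 2 * (norm (c - a) / norm (b - a))) * cis (angle_ccw a b c)"
    by (simp add: complex_norm_square mult_ac del: complex_cnj_diff of_real_power)
  also have "norm (b - a) ^ 2 * (norm (c - a) / norm (b - a)) = norm (b - a) * norm (c - a)"
    by (simp add: power2_eq_square)
  finally show ?thesis by simp
qed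

text \<open>The three quotients of adjacent sides multiply to -1, so the sum of their arguments is
  an odd multiple of \<open>pi\<close>; as each angle lies strictly between 0 and \<open>pi\<close>,
  only \<open>pi\<close> itself is left.\<close>

lemma angle_ccw_sum:
  assumes "ccw a b c"
  shows "angle_ccw a b c + angle_ccw b c a + angle_ccw c a b = pi"
proof -
  have ccws: "ccw b c a" "ccw c a b" using assms ccw_rotate by blast+
  note distinct = ccw_distinct[OF assms]
  define s where "s = angle_ccw a b c + angle_ccw b c a + angle_ccw c a b"
  define l where "l = norm (c - a) / norm (b - a) * (norm (a - b) / norm (c - b)) * (norm (b - c) / norm (a - c))"
  have "of_real l * cis s = ((c - a) / (b - a)) * ((a - b) / (c - b)) * ((b - c) / (a - c))"
    unfolding angle_ccw_ratio[OF assms] angle_ccw_ratio[OF ccws(1)] angle_ccw_ratio[OF ccws(2)]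
    by (simp add: l_def s_def cis_mult[symmetric])
  also have "\<dots> = - 1" using distinct by (simp add: divide_simps) (simp add: algebra_simps)
  finally have eq: "of_real l * cis s = - 1" .
  have "l = 1" using distinct by (simp add: l_def norm_minus_commute)
  then have "cos s = - 1" using eq by (simp add: complex_eq_iff)
  then have "cos (s - pi) = 1" by (simp add: cos_diff)
  then obtain i :: int where i: "s - pi = of_int i * 2 * pi"
    unfolding cos_one_2pi_int by blast
  have "0 < s" "s < 3 * pi"
    using angle_ccw[OF assms] angle_ccw[OF ccws(1)] angle_ccw[OF ccws(2)] by (auto simp: s_def)
  then have "of_int i * (2 * pi) < 1 * (2 * pi)" "(- 1) * (2 * pi) < of_int i * (2 * pi)"
  proof -
    have "of_int i * (2 * pi) = s - pi" using i by simp
    then show "of_int i * (2 * pi) < 1 * (2 * pi)" "(- 1) * (2 * pi) < of_int i * (2 * pi)"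
      using \<open>0 < s\<close> \<open>s < 3 * pi\<close> by linarith+
  qed
  then have "(of_int i :: real) < 1" "(-1 :: real) < of_int i"
    using pi_gt_zero mult_less_cancel_right_pos[of "2 * pi"] by (metis mult_pos_pos zero_less_numeral)+
  then have "i = 0" by linarith
  then show ?thesis using i by (simp add: s_def)
qed

text \<open>Length and direction are kept in one complex identity whose coefficients, for rational
  multiples of \<open>pi\<close>, come from roots of unity; in this form \<open>\<Phi>\<close> can
  be applied to it.\<close>

lemma law_of_sines_ccw:
  assumes "ccw a b c"
  shows "of_real (sin (angle_ccw c a b)) * (c - a) = of_real (sin (angle_ccw b c a)) * (cis (angle_ccw a b c) * (b - a))"
proof -
  have ccws: "ccw b c a" "ccw c a b" using assms ccw_rotate by blast+
  note distinct = ccw_distinct[OF assms]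
  have "crs (c - b) (a - b) = crs (a - c) (b - c)" by (simp add: crs_expand algebra_simps)
  then have "norm (c - b) * norm (a - b) * sin (angle_ccw b c a) = norm (a - c) * norm (b - c) * sin (angle_ccw c a b)"
    using crs_eq_sin[OF ccws(1)] crs_eq_sin[OF ccws(2)] by simp
  then have *: "norm (b - a) * sin (angle_ccw b c a) = norm (c - a) * sin (angle_ccw c a b)"
    using distinct by (simp add: norm_minus_commute)
  have "c - a = (b - a) * (of_real (norm (c - a) / norm (b - a)) * cis (angle_ccw a b c))"
    using angle_ccw_ratio[OF assms] distinct by (simp add: field_simps)
  then have "of_real (sin (angle_ccw c a b)) * (c - a) = of_real (sin (angle_ccw c a b))
      * ((b - a) * (of_real (norm (c - a) / norm (b - a)) * cis (angle_ccw a b c)))" by simp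
  also have "\<dots> = of_real (norm (c - a) * sin (angle_ccw c a b) / norm (b - a)) * (cis (angle_ccw a b c) * (b - a))"
    by simp
  also have "norm (c - a) * sin (angle_ccw c a b) / norm (b - a) = sin (angle_ccw b c a)"
    unfolding *[symmetric] using distinct by simp
  finally show ?thesis .
qed

lemma line_dir_rotate:
  assumes "ccw a b c"
  shows "line_dir a c = line_dir a b * cis (2 * angle_ccw a b c)"
proof -
  note distinct = ccw_distinct[OF assms]
  have ab: "line_dir a b = cis (2 * Arg (b - a))"
    by (rule line_dir_polar[OF rcis_Arg_eq]) (use distinct in simp)
  have ac: "line_dir a c = cis (2 * (Arg (b - a) + angle_ccw a b c))"
    by (rule line_dir_polar[OF angle_ccw(3)[OF assms]]) (use distinct in simp)
  show ?thesis unfolding ab ac by (simp add: cis_mult distrib_left)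
qed

text \<open>\<open>cis (pi / n)\<close> is a root of unity of order \<open>2 * n\<close>; the angles
  that \<open>\<Phi>\<close> multiplies by \<open>k\<close> are the multiples of
  \<open>pi / n\<close>.\<close>

locale cyclotomic_semilinear =
  fixes n k :: nat and \<Phi> :: "complex \<Rightarrow> complex"
  assumes n_pos: "n > 0" and coprime_kn: "coprime k n"
    and additive: "\<Phi> (x + y) = \<Phi> x + \<Phi> y"
    and semilinear_root: "\<Phi> (cis (pi / n) * x) = cis (pi / n) ^ k * \<Phi> x"
    and commutes_cnj: "\<Phi> (cnj x) = cnj (\<Phi> x)"
    and normalised: "\<Phi> 1 = 1"
begin

lemma zero [simp]: "\<Phi> 0 = 0"
  using additive[of 0 0] by simp

lemma diff: "\<Phi> (x - y) = \<Phi> x - \<Phi> y"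
  using additive[of "x - y" y] by simp

lemma semilinear_nat: "\<Phi> (cis (pi * of_nat j / n) * x) = cis (k * (pi * of_nat j / n)) * \<Phi> x"
proof (induction j arbitrary: x)
  case (Suc j)
  have step: "pi * of_nat (Suc j) / n = pi * of_nat j / n + pi / n"
    by (simp add: add_divide_distrib distrib_left)
  have "cis (pi * of_nat (Suc j) / n) * x = cis (pi * of_nat j / n) * (cis (pi / n) * x)"
    unfolding step cis_mult[symmetric] by (rule mult.assoc)
  then have "\<Phi> (cis (pi * of_nat (Suc j) / n) * x) = cis (k * (pi * of_nat j / n)) * (cis (pi / n) ^ k * \<Phi> x)"
    by (simp only: Suc semilinear_root)
  also have "\<dots> = cis (k * (pi * of_nat (Suc j) / n)) * \<Phi> x"
    unfolding step distrib_left cis_mult[symmetric] Complex.DeMoivre by (rule mult.assoc[symmetric])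
  finally show ?case .
qed simp

lemma semilinear_int: "\<Phi> (cis (pi * of_int j / n) * x) = cis (k * (pi * of_int j / n)) * \<Phi> x"
proof (cases "0 \<le> j")
  case True
  then show ?thesis using semilinear_nat[of "nat j" x] by simp
next
  case False
  define m where "m = nat (- j)"
  have j: "of_int j = - real m" using False by (simp add: m_def)
  have "\<Phi> x = \<Phi> (cis (pi * real m / n) * (cis (pi * of_int j / n) * x))"
    by (simp add: mult.assoc[symmetric] cis_mult j)
  also have "\<dots> = cis (k * (pi * real m / n)) * \<Phi> (cis (pi * of_int j / n) * x)"
    by (rule semilinear_nat)
  finally have "cis (- (k * (pi * real m / n))) * \<Phi> x = \<Phi> (cis (pi * of_int j / n) * x)"
    by (simp add: mult.assoc[symmetric] cis_mult)
  then show ?thesis by (simp add: j)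
qed

lemma semilinear_angle:
  fixes t :: real
  assumes "(t::real) * n / pi \<in> \<int>"
  shows "\<Phi> (cis t * x) = cis (k * t) * \<Phi> x"
proof -
  obtain j where "t * n / pi = of_int j" using assms by (auto elim: Ints_cases)
  then have "t = pi * of_int j / n" using n_pos by (simp add: field_simps)
  then show ?thesis using semilinear_int by simp
qed

lemma of_real_image: "\<Phi> (of_real r) = of_real (Re (\<Phi> (of_real r)))"
  using commutes_cnj[of "of_real r"] by (simp add: complex_eq_iff)

text \<open>It is not the sine but \<open>2 * \<i> * sin t = cis t - cis (- t)\<close> that is a
  combination of the given roots of unity. Keeping the factor avoids the question how
  \<open>\<Phi>\<close> acts on \<open>\<i>\<close>.\<close>

lemma semilinear_sin:
  fixes t :: real
  assumes "(t::real) * n / pi \<in> \<int>"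
  shows "2 * \<i> * of_real (sin (k * t)) * \<Phi> x = \<Phi> (2 * \<i> * of_real (sin t) * x)"
proof -
  have eq: "2 * \<i> * of_real (sin t) = cis t - cis (- t)" for t by (simp add: complex_eq_iff)
  have "- t * n / pi \<in> \<int>" using assms Ints_minus[of "t * n / pi"] by simp
  then have "\<Phi> ((cis t - cis (- t)) * x) = (cis (k * t) - cis (k * (- t))) * \<Phi> x"
    using assms by (simp add: left_diff_distrib diff semilinear_angle)
  then show ?thesis by (simp add: eq)
qed

text \<open>\<open>\<Phi>\<close> turns the complex law of sines into the same law with angles
  \<open>k\<close> times as large. The cross product becomes \<open>norm p ^ 2\<close> times
  \<open>sin (k * u) * sin (k * v) / sin (k * w)\<close>; extending the fraction by
  \<open>sin (k * w)\<close> makes the sign symmetric in the three angles.\<close>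

lemma conjugate_area:
  assumes "ccw a b c"
    and "angle_ccw a b c * n / pi \<in> \<int>" "angle_ccw b c a * n / pi \<in> \<int>" "angle_ccw c a b * n / pi \<in> \<int>"
  shows "\<exists>P\<ge>0. crs (\<Phi> b - \<Phi> a) (\<Phi> c - \<Phi> a) =
    sin (k * angle_ccw a b c) * sin (k * angle_ccw b c a) * sin (k * angle_ccw c a b) * P"
proof -
  define u v w where "u = angle_ccw a b c" and "v = angle_ccw b c a" and "w = angle_ccw c a b"
  define p q where "p = \<Phi> (b - a)" and "q = \<Phi> (c - a)"
  have "2 * \<i> * of_real (sin (k * w)) * q = \<Phi> (2 * \<i> * of_real (sin w) * (c - a))"
    unfolding q_def using assms(4) by (intro semilinear_sin) (simp add: w_def)
  also have "2 * \<i> * of_real (sin w) * (c - a) = 2 * \<i> * of_real (sin v) * (cis u * (b - a))"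
    using law_of_sines_ccw[OF assms(1)] by (simp add: u_def v_def w_def)
  also have "\<Phi> \<dots> = 2 * \<i> * of_real (sin (k * v)) * \<Phi> (cis u * (b - a))"
    using assms(3) by (intro semilinear_sin[symmetric]) (simp add: v_def)
  also have "\<Phi> (cis u * (b - a)) = cis (k * u) * p"
    unfolding p_def using assms(2) by (intro semilinear_angle) (simp add: u_def)
  finally have eq: "of_real (sin (k * w)) * q = of_real (sin (k * v)) * (cis (k * u) * p)" by simp
  have "sin (k * w) * crs p q = crs p (of_real (sin (k * w)) * q)" by (simp add: crs_scale_right)
  also have "\<dots> = sin (k * v) * crs p (cis (k * u) * p)" unfolding eq by (simp add: crs_scale_right)
  also have "crs p (cis (k * u) * p) = sin (k * u) * norm p ^ 2"
    unfolding cmod_power2 by (simp add: crs_expand algebra_simps power2_eq_square)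
  finally have area: "sin (k * w) * crs p q = sin (k * v) * (sin (k * u) * norm p ^ 2)" .
  \<comment> \<open>Otherwise \<open>n\<close> would divide \<open>k * j\<close> and so
    \<open>j\<close>, although \<open>w = j * pi / n\<close> lies strictly between 0 and
    \<open>pi\<close>.\<close>
  have "sin (k * w) \<noteq> 0"
  proof
    assume "sin (k * w) = 0"
    then obtain i where i: "k * w = of_int i * pi" by (auto simp: sin_zero_iff_int2)
    obtain j where j: "w * n / pi = of_int j" using assms(4) by (auto simp: w_def elim: Ints_cases)
    have "of_int (int k * j) = real k * (w * n / pi)" by (simp add: j)
    also have "\<dots> = k * w * n / pi" by simp
    also have "\<dots> = of_int (i * int n)" by (simp add: i)
    finally have "int k * j = i * int n" using of_int_eq_iff by blast
    then have "int n dvd int k * j" by simp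
    then have "int n dvd j" using coprime_kn
      by (simp add: coprime_dvd_mult_right_iff coprime_commute)
    moreover have "0 < w" "w < pi" using angle_ccw[OF ccw_rotate[OF ccw_rotate[OF assms(1)]]] by (auto simp: w_def)
    then have "0 < w * n / pi" "w * n / pi < n" using n_pos by (auto simp: field_simps)
    then have "0 < j" "j < int n" using j by linarith+
    ultimately show False using zdvd_imp_le by fastforce
  qed
  then have "crs p q = sin (k * u) * sin (k * v) * sin (k * w) * (norm p ^ 2 / sin (k * w) ^ 2)"
    using area by (simp add: field_simps power2_eq_square)
  moreover have "norm p ^ 2 / sin (k * w) ^ 2 \<ge> 0" by simp
  ultimately show ?thesis
    unfolding diff[symmetric] p_def[symmetric] q_def[symmetric] u_def[symmetric] v_def[symmetric] w_def[symmetric]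
    by blast
qed

text \<open>\<open>line_dir\<close> is the square of the unit direction, so these are the lines
  whose angle with the real axis is a multiple of \<open>pi / n\<close>.\<close>

definition cyclotomic_line :: "complex \<Rightarrow> complex \<Rightarrow> bool" where
  "cyclotomic_line a b \<longleftrightarrow> line_dir a b ^ n = 1"

text \<open>A term of the shoelace formula for the image of the triangle. In other directions
  \<open>\<Phi>\<close> is not controlled along the line, so these sides are dropped.\<close>

definition conjugate_edge :: "complex \<Rightarrow> complex \<Rightarrow> real" where
  "conjugate_edge a b = (if cyclotomic_line a b then crs (\<Phi> a) (\<Phi> b) else 0)"

text \<open>If \<open>D\<close> is the unit direction of the image line, then
  \<open>u ^ k = D ^ 2\<close>, and with \<open>\<zeta> = \<Phi> x / D\<close> the value is
  \<open>- Re \<zeta> * Im \<zeta>\<close>. Along the line \<open>Im \<zeta>\<close> is a constant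
  signed distance from the origin, so a difference of two values is a signed length times this
  distance, which is a shoelace term. Only the square of \<open>D\<close> enters, hence the line but
  not its orientation.\<close>

definition line_weight :: "complex \<Rightarrow> complex \<Rightarrow> complex" where
  "line_weight x u = (if u ^ n = 1 then of_real (- Im (\<Phi> x ^ 2 / u ^ k) / 2) else 0)"

lemma conjugate_edge_eq:
  assumes "a \<noteq> b"
  shows "line_weight b (line_dir a b) - line_weight a (line_dir a b) = of_real (conjugate_edge a b)"
proof (cases "cyclotomic_line a b")
  case True
  define r t where "r = norm (b - a)" and "t = Arg (b - a)"
  have ba: "b - a = of_real r * cis t" unfolding r_def t_def by (rule rcis_Arg_eq)
  then have dir: "line_dir a b = cis (2 * t)" by (rule line_dir_polar) (use assms in \<open>simp add: r_def\<close>)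
  have "cis (of_nat n * (2 * t)) = 1" using True by (simp add: cyclotomic_line_def dir Complex.DeMoivre)
  then have "cos (of_nat n * (2 * t)) = 1" by (simp add: complex_eq_iff)
  then obtain i :: int where "of_nat n * (2 * t) = of_int i * 2 * pi"
    unfolding cos_one_2pi_int by blast
  then have "t * n / pi \<in> \<int>" by (simp add: field_simps)
  \<comment> \<open>\<open>\<Phi>\<close> maps reals to reals because it commutes with conjugation,
    so the image of the side is the real multiple \<open>\<rho>\<close> of \<open>D\<close>.\<close>
  define D \<rho> where "D = cis (k * t)" and "\<rho> = Re (\<Phi> (of_real r))"
  have "\<Phi> (b - a) = \<Phi> (cis t * of_real r)" by (simp add: ba mult.commute)
  also have "\<dots> = D * of_real \<rho>"
    using semilinear_angle[OF \<open>t * n / pi \<in> \<int>\<close>] of_real_image[of r] by (simp add: D_def \<rho>_def)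
  finally have b: "\<Phi> b = \<Phi> a + D * of_real \<rho>" by (simp add: diff algebra_simps)
  have D0: "D \<noteq> 0" and invD: "inverse D = cnj D" by (simp_all add: D_def cis_cnj cis_inverse)
  have uk: "line_dir a b ^ k = D ^ 2" by (simp add: dir D_def Complex.DeMoivre algebra_simps)
  have "\<Phi> b ^ 2 / D ^ 2 - \<Phi> a ^ 2 / D ^ 2 = of_real (2 * \<rho>) * (\<Phi> a * cnj D) + of_real (\<rho> ^ 2)"
  proof -
    have "\<Phi> b ^ 2 / D ^ 2 - \<Phi> a ^ 2 / D ^ 2 = of_real (2 * \<rho>) * (\<Phi> a * inverse D) + of_real (\<rho> ^ 2)"
      using D0 by (simp add: b field_simps power2_eq_square)
    then show ?thesis by (simp add: invD)
  qed
  from arg_cong[OF this, of Im]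
  have "Im (\<Phi> b ^ 2 / D ^ 2) - Im (\<Phi> a ^ 2 / D ^ 2) = 2 * \<rho> * Im (\<Phi> a * cnj D)"
    by (simp only: minus_complex.sel plus_complex.sel Im_complex_of_real times_complex.sel Re_complex_of_real)
  moreover have "crs (\<Phi> a) (\<Phi> b) = - \<rho> * Im (\<Phi> a * cnj D)"
    by (simp add: b crs_expand algebra_simps)
  ultimately have real_eq: "- Im (\<Phi> b ^ 2 / D ^ 2) / 2 - (- Im (\<Phi> a ^ 2 / D ^ 2) / 2) = crs (\<Phi> a) (\<Phi> b)"
    by simp
  have "line_dir a b ^ n = 1" using True by (simp add: cyclotomic_line_def)
  then show ?thesis
    using True unfolding line_weight_def conjugate_edge_def uk
    by (simp only: simp_thms if_True of_real_diff[symmetric] real_eq)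
next
  case False
  then show ?thesis by (simp add: line_weight_def conjugate_edge_def cyclotomic_line_def)
qed

lemma conjugate_area_balance:
  assumes I: "ccw_family I A B C" and J: "ccw_family J A' B' C'"
    and eq: "\<And>p. generic_point I A B C p \<Longrightarrow> generic_point J A' B' C' p \<Longrightarrow>
               cover_count I A B C p = cover_count J A' B' C' p"
  shows "(\<Sum>i\<in>I. edge_sum conjugate_edge (A i) (B i) (C i)) = (\<Sum>j\<in>J. edge_sum conjugate_edge (A' j) (B' j) (C' j))"
proof -
  define E where "E a b = line_weight b (line_dir a b) - line_weight a (line_dir a b)" for a b
  have es: "edge_sum E a b c = of_real (edge_sum conjugate_edge a b c)" if "ccw a b c" for a b c
    using ccw_distinct[OF that] by (simp add: edge_sum_def E_def conjugate_edge_eq)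
  have "(\<Sum>i\<in>I. edge_sum E (A i) (B i) (C i)) = (\<Sum>j\<in>J. edge_sum E (A' j) (B' j) (C' j))"
    unfolding E_def by (rule edge_function_balance[OF I J eq])
  moreover have "(\<Sum>i\<in>I. edge_sum E (A i) (B i) (C i)) = of_real (\<Sum>i\<in>I. edge_sum conjugate_edge (A i) (B i) (C i))"
    using I es by (simp add: ccw_family_def)
  moreover have "(\<Sum>i\<in>J. edge_sum E (A' i) (B' i) (C' i)) = of_real (\<Sum>i\<in>J. edge_sum conjugate_edge (A' i) (B' i) (C' i))"
    using J es by (simp add: ccw_family_def)
  ultimately show ?thesis using of_real_eq_iff by metis
qed

text \<open>Turning from one side to the next multiplies \<open>line_dir\<close> by an
  \<open>n\<close>-th root of unity, so either all three sides are cyclotomic or none is. In the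
  second case the sum is 0 and \<open>P = 0\<close> serves.\<close>

lemma edge_sum_conjugate:
  assumes "ccw a b c"
    and "angle_ccw a b c * n / pi \<in> \<int>" "angle_ccw b c a * n / pi \<in> \<int>" "angle_ccw c a b * n / pi \<in> \<int>"
  shows "\<exists>P\<ge>0. edge_sum conjugate_edge a b c =
    sin (k * angle_ccw a b c) * sin (k * angle_ccw b c a) * sin (k * angle_ccw c a b) * P"
proof -
  have unit: "cis (2 * t) ^ n = 1" if t: "t * n / pi \<in> \<int>" for t :: real
  proof -
    obtain j where "t * n / pi = of_int j" using t by (auto elim: Ints_cases)
    then have "real n * (2 * t) = 2 * pi * of_int j" using n_pos by (simp add: field_simps)
    then have "cis (real n * (2 * t)) = 1" by (simp only: cis_multiple_2pi Ints_of_int)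
    then show ?thesis by (simp only: Complex.DeMoivre)
  qed
  have "line_dir a c ^ n = line_dir a b ^ n"
    using line_dir_rotate[OF assms(1)] unit[OF assms(2)] by (simp add: power_mult_distrib)
  moreover have "line_dir b a ^ n = line_dir b c ^ n"
    using line_dir_rotate[OF ccw_rotate[OF assms(1)]] unit[OF assms(3)] by (simp add: power_mult_distrib)
  ultimately have lines: "cyclotomic_line b c = cyclotomic_line a b" "cyclotomic_line c a = cyclotomic_line a b"
    by (simp_all add: cyclotomic_line_def line_dir_commute[of a b] line_dir_commute[of a c])
  have "crs (\<Phi> a) (\<Phi> b) + crs (\<Phi> b) (\<Phi> c) + crs (\<Phi> c) (\<Phi> a) = crs (\<Phi> b - \<Phi> a) (\<Phi> c - \<Phi> a)"
    by (simp add: crs_expand algebra_simps)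
  then have "edge_sum conjugate_edge a b c = (if cyclotomic_line a b then crs (\<Phi> b - \<Phi> a) (\<Phi> c - \<Phi> a) else 0)"
    by (simp add: edge_sum_def conjugate_edge_def lines)
  then show ?thesis using conjugate_area[OF assms] by (auto intro: exI[of _ 0])
qed

end

section \<open>The triangulation of a regular polygon from its centre\<close>

definition root_vertex :: "nat \<Rightarrow> nat \<Rightarrow> complex" where
  "root_vertex N j = cis (2 * pi * real j / real N)"

text \<open>A constant function, so that the triangles from the centre have the indexed form of
  \<open>ccw_family\<close>.\<close>

definition fan_apex :: "nat \<Rightarrow> complex" where
  "fan_apex j = 0"

lemma root_vertex_norm [simp]: "norm (root_vertex N j) = 1"
  by (simp add: root_vertex_def)

lemma root_vertex_nonzero: "root_vertex N j \<noteq> 0"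
  by (simp add: root_vertex_def)

lemma root_vertex_periodic:
  assumes "N > 0"
  shows "root_vertex N (j + N) = root_vertex N j"
proof -
  have "2 * pi * real (j + N) / real N = 2 * pi * real j / real N + 2 * pi"
    using assms by (simp add: field_simps)
  then show ?thesis unfolding root_vertex_def by (simp add: complex_eq_iff)
qed

lemma root_vertex_inj:
  assumes "N > 0"
  shows "inj_on (root_vertex N) {1..N}"
proof (rule inj_onI)
  fix i j assume ij: "i \<in> {1..N}" "j \<in> {1..N}" and eq: "root_vertex N i = root_vertex N j"
  have "cis (2 * pi * real i / real N - 2 * pi * real j / real N) = 1"
    using eq by (simp add: root_vertex_def cis_divide[symmetric])
  then have "cos (2 * pi * real i / real N - 2 * pi * real j / real N) = 1" by (simp add: complex_eq_iff)
  then obtain l :: int where "2 * pi * real i / real N - 2 * pi * real j / real N = of_int l * 2 * pi"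
    unfolding cos_one_2pi_int by blast
  then have "2 * pi * (real i - real j) = 2 * pi * (of_int l * real N)"
    using assms by (simp add: field_simps)
  then have "real i - real j = of_int l * real N" by simp
  then have "of_int (int i - int j) = (of_int (l * int N) :: real)" by simp
  then have l: "int i - int j = l * int N" using of_int_eq_iff by blast
  moreover have "\<bar>int i - int j\<bar> < int N" using ij by auto
  ultimately have "l = 0"
    using assms by (metis abs_mult abs_of_nat dvd_triv_right dvd_imp_le_int linorder_not_less mult_eq_0_iff of_nat_eq_0_iff abs_ge_zero dvd_0_left_iff mult_zero_left)
  then show "i = j" using l by simp
qed

text \<open>Measured from the outward normal of a side, the vertices of the polygon stand at odd
  multiples of \<open>pi / N\<close>; the bound says that the end points of the side lie farthest
  out.\<close>

lemma cos_odd_multiple_le: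
  assumes "N \<ge> 2"
  shows "cos ((2 * of_int m - 1) * pi / real N) \<le> cos (pi / real N)"
proof -
  define r where "r = m mod int N"
  have r: "0 \<le> r" "r < int N" using assms by (simp_all add: r_def)
  have "m = r + int N * (m div int N)" by (simp add: r_def)
  then have "real_of_int m = real_of_int (r + int N * (m div int N))" by (rule arg_cong)
  then have "of_int m = of_int r + real N * of_int (m div int N)" by simp
  then have "(2 * of_int m - 1) * pi / real N = (2 * of_int r - 1) * pi / real N + 2 * pi * of_int (m div int N)"
    using assms by (simp add: field_simps)
  then have eq: "cos ((2 * of_int m - 1) * pi / real N) = cos ((2 * of_int r - 1) * pi / real N)"
    by (simp add: cos_add)
  show ?thesis
  proof (cases "r = 0")
    case True
    then show ?thesis using eq by simp
  next
    case False
    define x where "x = (2 * of_int r - 1) * pi / real N"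
    have r1: "1 \<le> (of_int r :: real)" "of_int r \<le> real N - 1" using False r by linarith+
    have "pi * 1 \<le> pi * (2 * of_int r - 1)" "pi * (2 * of_int r - 1) \<le> pi * (2 * real N - 1)"
      using r1 by (intro mult_left_mono; simp)+
    then have x: "pi / real N \<le> x" "x \<le> 2 * pi - pi / real N"
      using assms by (simp_all add: x_def field_simps)
    have N: "0 \<le> pi / real N" by simp
    have "cos x \<le> cos (pi / real N)"
    proof (cases "x \<le> pi")
      case True
      then show ?thesis using x N by (intro cos_monotone_0_pi_le) auto
    next
      case False
      then have "cos (2 * pi - x) \<le> cos (pi / real N)" using x N by (intro cos_monotone_0_pi_le) auto
      then show ?thesis by simp
    qed
    then show ?thesis using eq by (simp add: x_def)
  qed
qed

lemma root_vertex_step: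
  assumes "N > 0"
  shows "root_vertex N (j + 1) - root_vertex N j =
    of_real (2 * sin (pi / N)) * cis ((2 * real j + 1) * pi / N + pi / 2)"
proof -
  define s where "s = (2 * real j + 1) * pi / N"
  have "2 * pi * real (j + 1) / N = s + pi / N" "2 * pi * real j / N = s - pi / N"
    using assms by (simp_all add: s_def field_simps)
  then have "root_vertex N (j + 1) - root_vertex N j = cis (s + pi / N) - cis (s - pi / N)"
    by (simp add: root_vertex_def)
  also have "\<dots> = of_real (2 * sin (pi / N)) * cis (s + pi / 2)"
    by (simp add: complex_eq_iff cos_add cos_diff sin_add sin_diff)
  finally show ?thesis by (simp add: s_def)
qed

lemma sin_pi_over_pos: "N \<ge> 2 \<Longrightarrow> 0 < sin (pi / real N)"
  by (intro sin_gt_zero) (auto simp: field_simps)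

lemma polygon_side_half_plane:
  assumes "N \<ge> 2"
  shows "0 \<le> crs (root_vertex N (j + 1) - root_vertex N j) (root_vertex N i - root_vertex N j)"
proof -
  define s where "s = (2 * real j + 1) * pi / N"
  have N: "real N > 0" using assms by simp
  have a: "2 * pi * real j / N = s - pi / N" using N by (simp add: s_def field_simps)
  have b: "2 * pi * real i / N = s + (2 * of_int (int i - int j) - 1) * pi / N" using N by (simp add: s_def field_simps)
  have "crs (root_vertex N (j + 1) - root_vertex N j) (root_vertex N i - root_vertex N j)
     = 2 * sin (pi / N) * (crs (cis (s + pi / 2)) (cis (2 * pi * real i / N)) - crs (cis (s + pi / 2)) (cis (2 * pi * real j / N)))"
  proof -
    have "crs (of_real r * u) (v - v') = r * (crs u v - crs u v')" for r u v v'
      by (simp add: crs_expand algebra_simps)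
    moreover have "N > 0" using assms by simp
    ultimately show ?thesis
      unfolding root_vertex_step[OF \<open>N > 0\<close>] s_def[symmetric]
      unfolding root_vertex_def by (simp only:)
  qed
  also have "crs (cis (s + pi / 2)) (cis (2 * pi * real i / N)) = - cos ((2 * of_int (int i - int j) - 1) * pi / N)"
  proof -
    have "crs (cis (s + pi / 2)) (cis t) = - cos (t - s)" for t
      by (simp add: crs_expand cos_add sin_add cos_diff)
    then show ?thesis unfolding b by simp
  qed
  also have "crs (cis (s + pi / 2)) (cis (2 * pi * real j / N)) = - cos (pi / N)"
  proof -
    have "crs (cis (s + pi / 2)) (cis t) = - cos (t - s)" for t
      by (simp add: crs_expand cos_add sin_add cos_diff)
    then show ?thesis unfolding a by simp
  qed
  finally show ?thesis
    using sin_pi_over_pos[OF assms] cos_odd_multiple_le[OF assms, of "int i - int j"]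
    by (simp del: of_int_diff)
qed

lemma polygon_half_plane:
  assumes "N \<ge> 2" and "p \<in> convex hull (root_vertex N ` {1..N})"
  shows "0 \<le> crs (root_vertex N (j + 1) - root_vertex N j) (p - root_vertex N j)"
proof -
  define e where "e = root_vertex N (j + 1) - root_vertex N j"
  have "convex {p. 0 \<le> crs e (p - root_vertex N j)}"
  proof -
    have "{p. 0 \<le> crs e (p - root_vertex N j)} = {p. crs e (root_vertex N j) \<le> inner (\<i> * e) p}"
      by (auto simp: crs_expand inner_complex_def algebra_simps)
    then show ?thesis by (simp add: convex_halfspace_ge)
  qed
  then have "convex hull (root_vertex N ` {1..N}) \<subseteq> {p. 0 \<le> crs e (p - root_vertex N j)}"
    by (intro hull_minimal) (use polygon_side_half_plane[OF assms(1)] in \<open>auto simp: e_def\<close>)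
  then show ?thesis using assms(2) by (auto simp: e_def)
qed

lemma fan_triangle_ccw:
  assumes "N \<ge> 3"
  shows "ccw 0 (root_vertex N j) (root_vertex N (j + 1))"
proof -
  have "crs (root_vertex N j) (root_vertex N (j + 1)) = sin (2 * pi * real (j + 1) / N - 2 * pi * real j / N)"
    by (simp add: root_vertex_def crs_expand sin_diff)
  also have "2 * pi * real (j + 1) / N - 2 * pi * real j / N = 2 * pi / N"
    using assms by (simp add: field_simps)
  also have "sin (2 * pi / N) > 0" using assms by (intro sin_gt_zero) (auto simp: field_simps)
  finally show ?thesis by (simp add: ccw_def)
qed

lemma fan_angles:
  assumes "N \<ge> 3"
  shows "angle_ccw 0 (root_vertex N j) (root_vertex N (j + 1)) = 2 * pi / N"
    and "angle_ccw (root_vertex N j) (root_vertex N (j + 1)) 0 = pi / 2 - pi / N"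
    and "angle_ccw (root_vertex N (j + 1)) 0 (root_vertex N j) = pi / 2 - pi / N"
proof -
  have N: "real N \<ge> 3" using assms by simp
  define V W where "V = root_vertex N j" and "W = root_vertex N (j + 1)"
  have V: "V = cis (2 * pi * real j / N)" "W = cis (2 * pi * real j / N + 2 * pi / N)"
    using N by (simp_all add: V_def W_def root_vertex_def field_simps)
  have step: "W - V = of_real (2 * sin (pi / N)) * cis (2 * pi * real j / N + pi / N + pi / 2)"
  proof -
    have "(2 * real j + 1) * pi / N = 2 * pi * real j / N + pi / N"
      by (simp add: distrib_right add_divide_distrib)
    then show ?thesis using root_vertex_step[of N j] assms unfolding V_def W_def by simp
  qed
  have sin: "0 < 2 * sin (pi / N)" using sin_pi_over_pos[of N] assms by simp
  have arg: "Arg (of_real r * cis t) = t" if "r > 0" "- pi < t" "t \<le> pi" for r t :: real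
    using that by (simp add: Arg_times_of_real Arg_cis)
  have range: "0 < 2 * pi / N" "2 * pi / N \<le> pi" "0 < pi / 2 - pi / N" "pi / 2 - pi / N \<le> pi"
    using N by (simp_all add: field_simps)
  have "W / V = of_real 1 * cis (2 * pi / N)" by (simp add: V cis_divide)
  then show "angle_ccw 0 V W = 2 * pi / N"
    unfolding angle_ccw_def using arg[of 1 "2 * pi / N"] range by simp
  have "(0 - V) / (W - V) = of_real (1 / (2 * sin (pi / N))) * (cis (2 * pi * real j / N + pi) / cis (2 * pi * real j / N + pi / N + pi / 2))"
    unfolding step by (simp add: V(1) cis_mult[symmetric])
  also have "\<dots> = of_real (1 / (2 * sin (pi / N))) * cis (pi / 2 - pi / N)"
    by (simp add: cis_divide)
  finally show "angle_ccw V W 0 = pi / 2 - pi / N"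
    unfolding angle_ccw_def using arg[of "1 / (2 * sin (pi / N))" "pi / 2 - pi / N"] range sin by simp
  have "(V - W) / (0 - W) = (W - V) / W" by (simp add: minus_divide_left[symmetric] divide_simps)
  also have "\<dots> = of_real (2 * sin (pi / N)) * (cis (2 * pi * real j / N + pi / N + pi / 2) / cis (2 * pi * real j / N + 2 * pi / N))"
    unfolding step by (simp add: V(2))
  also have "\<dots> = of_real (2 * sin (pi / N)) * cis (pi / 2 - pi / N)"
    by (simp add: cis_divide field_simps)
  finally show "angle_ccw W 0 V = pi / 2 - pi / N"
    unfolding angle_ccw_def using arg[of "2 * sin (pi / N)" "pi / 2 - pi / N"] range sin by simp
qed

lemma fan_family:
  assumes "N \<ge> 3"
  shows "ccw_family {1..N} fan_apex (root_vertex N) (\<lambda>j. root_vertex N (j + 1))"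
  using fan_triangle_ccw[OF assms] by (simp add: ccw_family_def fan_apex_def)

text \<open>\<open>q\<close> is a polar angle in units of \<open>2 * pi / N\<close>. It starts at 0
  whereas the sectors are numbered from 1, so the sector with \<open>q\<close> between 0 and 1
  belongs to \<open>j = N\<close>; the last alternative accounts for this wrap.\<close>

lemma sector_condition:
  assumes "N \<ge> 2" and "0 \<le> q" "q < real N" and j: "j \<in> {1..N}"
  shows "0 \<le> sin (2 * pi * (q - real j) / N) \<and> 0 \<le> sin (2 * pi * (real j + 1 - q) / N)
     \<longleftrightarrow> real j \<le> q \<and> q \<le> real j + 1 \<or> real N - 1 \<le> real j - q"
proof -
  have N: "real N > 0" using assms by simp
  define d where "d = (if real j \<le> q then q - real j else q - real j + N)"
  have d: "0 \<le> d" "d < N" using assms j by (auto simp: d_def)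
  have d': "0 \<le> 2 * pi * d / N" "2 * pi * d / N < 2 * pi" using d N by (simp_all add: field_simps)
  have "sin (2 * pi * (q - real j) / N) = sin (2 * pi * d / N)"
  proof (cases "real j \<le> q")
    case False
    have "2 * pi * d / N = 2 * pi * (q - real j) / N + 2 * pi" using False N by (simp add: d_def field_simps)
    then show ?thesis by simp
  qed (simp add: d_def)
  moreover have "sin (2 * pi * (real j + 1 - q) / N) = sin (2 * pi / N - 2 * pi * d / N)"
  proof (cases "real j \<le> q")
    case False
    have "2 * pi * (real j + 1 - q) / N = (2 * pi / N - 2 * pi * d / N) + 2 * pi" using False N by (simp add: d_def field_simps)
    then show ?thesis by simp
  next
    case True
    have "2 * pi * (real j + 1 - q) / N = 2 * pi / N - 2 * pi * d / N" using True N by (simp add: d_def field_simps)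
    then show ?thesis by simp
  qed
  moreover have "0 < 2 * pi / N" "2 * pi / N \<le> pi" using assms by (simp_all add: field_simps)
  ultimately have "0 \<le> sin (2 * pi * (q - real j) / N) \<and> 0 \<le> sin (2 * pi * (real j + 1 - q) / N)
     \<longleftrightarrow> 2 * pi * d / N \<le> 2 * pi / N"
    using sin_sector_iff[OF d'] by simp
  also have "\<dots> \<longleftrightarrow> d \<le> 1" using N by (simp add: field_simps)
  also have "\<dots> \<longleftrightarrow> real j \<le> q \<and> q \<le> real j + 1 \<or> real N - 1 \<le> real j - q"
    using assms j by (auto simp: d_def)
  finally show ?thesis .
qed

lemma crs_root_vertex:
  "crs (root_vertex N j) (of_real r * cis (2 * pi * q / N)) = r * sin (2 * pi * (q - real j) / N)"
  by (simp add: root_vertex_def crs_expand sin_diff algebra_simps diff_divide_distrib)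

lemma polar_index:
  assumes "N > 0"
  obtains q where "0 \<le> q" "q < real N" "p = of_real (norm p) * cis (2 * pi * q / N)"
proof -
  define t where "t = (if 0 \<le> Arg p then Arg p else Arg p + 2 * pi)"
  have t: "0 \<le> t" "t < 2 * pi" using Arg_bounded[of p] pi_gt_zero by (auto simp: t_def)
  have "cis t = cis (Arg p)" by (simp add: t_def complex_eq_iff)
  then have "p = of_real (norm p) * cis t" using rcis_Arg_eq[of p] by simp
  then show ?thesis
    using t assms by (intro that[of "t * N / (2 * pi)"]) (simp_all add: field_simps)
qed

lemma fan_sector_index:
  assumes "N \<ge> 3" and "j \<in> {1..N}" and "in_triangle 0 (root_vertex N j) (root_vertex N (j + 1)) p"
    and "0 \<le> q" "q < real N" "p = of_real (norm p) * cis (2 * pi * q / N)" and "p \<noteq> 0"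
  shows "real j \<le> q \<and> q \<le> real j + 1 \<or> real N - 1 \<le> real j - q"
proof -
  have "0 \<le> crs (root_vertex N j) p" using assms(3) by (simp add: in_triangle_def)
  also have "\<dots> = norm p * sin (2 * pi * (q - real j) / N)"
    using crs_root_vertex[of N j "norm p" q] assms(6) by simp
  finally have 1: "0 \<le> sin (2 * pi * (q - real j) / N)" using assms(7) by (simp add: zero_le_mult_iff)
  have "0 \<le> - crs (root_vertex N (j + 1)) p"
    using assms(3) by (simp add: in_triangle_def crs_expand algebra_simps)
  also have "crs (root_vertex N (j + 1)) p = norm p * sin (2 * pi * (q - real (j + 1)) / N)"
    using crs_root_vertex[of N "j + 1" "norm p" q] assms(6) by simp
  also have "- (norm p * sin (2 * pi * (q - real (j + 1)) / N)) = norm p * sin (2 * pi * (real j + 1 - q) / N)"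
    using sin_minus[of "2 * pi * (q - real (j + 1)) / N"] by (simp add: minus_divide_left algebra_simps)
  finally have 2: "0 \<le> sin (2 * pi * (real j + 1 - q) / N)" using assms(7) by (simp add: zero_le_mult_iff)
  show ?thesis using sector_condition[of N q j] assms 1 2 by simp
qed

lemma root_vertex_mod:
  assumes "i \<in> {1..N}"
  shows "root_vertex N (i mod N) = root_vertex N i"
  using assms root_vertex_periodic[of N 0] by (cases "i = N") auto

lemma root_vertex_Suc_image:
  assumes "j \<in> {1..N}"
  shows "root_vertex N (j + 1) \<in> root_vertex N ` {1..N}"
  using assms root_vertex_periodic[of N 1] by (cases "j = N") (auto simp: add.commute)

lemma sum_root_vertex_shift:
  assumes "N > 0"
  shows "(\<Sum>j\<in>{1..N}. g (root_vertex N (j + 1))) = (\<Sum>j\<in>{1..N}. g (root_vertex N j) :: 'a::ab_group_add)"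
proof -
  define F where "F k = g (root_vertex N (Suc k))" for k
  have "F N = F 0" using root_vertex_periodic[OF assms, of 1] by (simp add: F_def)
  moreover have "(\<Sum>k<N. F (Suc k)) + F 0 = (\<Sum>k<N. F k) + F N"
    using sum.lessThan_Suc_shift[of F N] sum.lessThan_Suc[of F N] by (simp only: add.commute)
  ultimately have "(\<Sum>k<N. F (Suc k)) = (\<Sum>k<N. F k)" by simp
  then show ?thesis by (simp add: sum.atLeast1_atMost_eq F_def)
qed

lemma sum_root_vertex:
  assumes "N \<ge> 3"
  shows "(\<Sum>j\<in>{1..N}. root_vertex N j) = 0"
proof -
  define z where "z = cis (2 * pi / N)"
  have "root_vertex N (j + 1) = z * root_vertex N j" for j
    using assms by (simp add: z_def root_vertex_def cis_mult field_simps)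
  then have "(\<Sum>j\<in>{1..N}. z * root_vertex N j) = (\<Sum>j\<in>{1..N}. root_vertex N j)"
    using sum_root_vertex_shift[of N "\<lambda>v. v"] assms by simp
  then have "(z - 1) * (\<Sum>j\<in>{1..N}. root_vertex N j) = 0"
    by (simp add: left_diff_distrib sum_distrib_left[symmetric])
  moreover have "Im z > 0"
    unfolding z_def cis.sel using assms by (intro sin_gt_zero) (auto simp: field_simps)
  then have "z \<noteq> 1" by auto
  ultimately show ?thesis by simp
qed

lemma zero_in_polygon:
  assumes "N \<ge> 3"
  shows "0 \<in> convex hull (root_vertex N ` {1..N})"
proof -
  have "(\<Sum>j\<in>{1..N}. (1 / real N) *\<^sub>R root_vertex N j) \<in> convex hull (root_vertex N ` {1..N})"
    using assms by (intro convex_sum) (auto intro: hull_inc)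
  then show ?thesis using sum_root_vertex[OF assms] by (simp add: scaleR_sum_right[symmetric])
qed

lemma fan_cover_count:
  assumes N: "N \<ge> 3" and gen: "generic_point {1..N} fan_apex (root_vertex N) (\<lambda>j. root_vertex N (j + 1)) p"
  shows "cover_count {1..N} fan_apex (root_vertex N) (\<lambda>j. root_vertex N (j + 1)) p
    = (if p \<in> convex hull (root_vertex N ` {1..N}) then 1 else 0)"
proof -
  have N0: "N > 0" and N2: "N \<ge> 2" using N by auto
  have off: "crs (root_vertex N j) p \<noteq> 0" if "j \<in> {1..N}" for j
    using gen that by (auto simp: generic_point_def off_lines_def fan_apex_def)
  have p0: "p \<noteq> 0" using off[of 1] N by auto
  obtain q where q: "0 \<le> q" "q < real N" "p = of_real (norm p) * cis (2 * pi * q / N)"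
    using polar_index[OF N0] .
  have qj: "q \<noteq> real j" if "j \<in> {1..N}" for j
  proof
    assume "q = real j"
    then have "crs (root_vertex N j) (of_real (norm p) * cis (2 * pi * q / N)) = 0"
      unfolding crs_root_vertex by simp
    then show False using off[OF that] q(3) by simp
  qed
  have q0: "q \<noteq> 0"
  proof
    assume "q = 0"
    have "sin (2 * pi * (q - real N) / N) = sin (- (2 * pi))" using \<open>q = 0\<close> N0 by simp
    then have "crs (root_vertex N N) (of_real (norm p) * cis (2 * pi * q / N)) = 0"
      unfolding crs_root_vertex by simp
    then show False using off[of N] q(3) N by simp
  qed
  \<comment> \<open>For \<open>q < 1\<close> the sector begins at vertex \<open>N\<close>, which is
    the vertex at angle 0.\<close>
  define i where "i = (if q < 1 then N else nat \<lfloor>q\<rfloor>)"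
  have i: "i \<in> {1..N}" using q N by (auto simp: i_def le_nat_floor) linarith
  have sector_i: "real i \<le> q \<and> q \<le> real i + 1 \<or> real N - 1 \<le> real i - q"
  proof (cases "q < 1")
    case False
    then have "real (nat \<lfloor>q\<rfloor>) = of_int \<lfloor>q\<rfloor>" by simp
    then show ?thesis using False unfolding i_def by simp
  qed (simp add: i_def)
  have unique: "j = i" if j: "j \<in> {1..N}" and "in_triangle 0 (root_vertex N j) (root_vertex N (j + 1)) p" for j
  proof -
    have "real j \<le> q \<and> q \<le> real j + 1 \<or> real N - 1 \<le> real j - q"
      using fan_sector_index[OF N j that(2) q p0] .
    then show ?thesis
    proof
      assume *: "real j \<le> q \<and> q \<le> real j + 1"
      have "q \<noteq> real (j + 1)" using qj[of "j + 1"] q(2) j by (cases "j = N") auto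
      then have "q < real j + 1" using * by simp
      then have "\<lfloor>q\<rfloor> = int j" using * by (simp add: floor_unique)
      then show ?thesis using * j by (auto simp: i_def)
    next
      assume *: "real N - 1 \<le> real j - q"
      then have "real N - 1 < real j" using q(1) q0 by linarith
      then have "j = N" using j by simp
      moreover have "q < 1" using * \<open>j = N\<close> qj[of 1] N by simp
      ultimately show ?thesis by (simp add: i_def)
    qed
  qed
  have sub: "p \<in> convex hull (root_vertex N ` {1..N})"
    if j: "j \<in> {1..N}" and "in_triangle 0 (root_vertex N j) (root_vertex N (j + 1)) p" for j
  proof -
    have "p \<in> convex hull {0, root_vertex N j, root_vertex N (j + 1)}"
      using that convex_hull_in_triangle[OF fan_triangle_ccw[OF N]] by blast
    moreover have "convex hull {0, root_vertex N j, root_vertex N (j + 1)} \<subseteq> convex hull (root_vertex N ` {1..N})"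
      using zero_in_polygon[OF N] root_vertex_Suc_image[OF j] j
      by (intro hull_minimal) (auto intro: hull_inc)
    ultimately show ?thesis by blast
  qed
  \<comment> \<open>The sector gives two of the three inequalities; the third holds because the
    polygon lies on the inner side of each of its sides.\<close>
  have covered: "in_triangle 0 (root_vertex N i) (root_vertex N (i + 1)) p"
    if "p \<in> convex hull (root_vertex N ` {1..N})"
  proof -
    have sin: "0 \<le> sin (2 * pi * (q - real i) / N)" "0 \<le> sin (2 * pi * (real i + 1 - q) / N)"
      using sector_condition[OF N2 q(1,2) i] sector_i by auto
    have "0 \<le> crs (root_vertex N i) p"
      using sin(1) q(3) crs_root_vertex[of N i "norm p" q] by simp
    moreover have "0 \<le> crs (0 - root_vertex N (i + 1)) (p - root_vertex N (i + 1))"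
    proof -
      have "crs (0 - root_vertex N (i + 1)) (p - root_vertex N (i + 1)) = - crs (root_vertex N (i + 1)) p"
        by (simp add: crs_expand algebra_simps)
      also have "crs (root_vertex N (i + 1)) p = norm p * sin (2 * pi * (q - real (i + 1)) / N)"
        using crs_root_vertex[of N "i + 1" "norm p" q] q(3) by simp
      also have "- (norm p * sin (2 * pi * (q - real (i + 1)) / N)) = norm p * sin (2 * pi * (real i + 1 - q) / N)"
        using sin_minus[of "2 * pi * (q - real (i + 1)) / N"] by (simp add: minus_divide_left algebra_simps)
      finally show ?thesis using sin(2) by simp
    qed
    ultimately show ?thesis
      using polygon_half_plane[OF N2 that, of i] by (simp add: in_triangle_def)
  qed
  have "{j \<in> {1..N}. in_triangle 0 (root_vertex N j) (root_vertex N (j + 1)) p}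
     = (if p \<in> convex hull (root_vertex N ` {1..N}) then {i} else {})"
  proof (cases "p \<in> convex hull (root_vertex N ` {1..N})")
    case True
    have "{j \<in> {1..N}. in_triangle 0 (root_vertex N j) (root_vertex N (j + 1)) p} = {i}"
      using unique covered[OF True] i by blast
    then show ?thesis using True by (simp only: if_True)
  next
    case False
    have "{j \<in> {1..N}. in_triangle 0 (root_vertex N j) (root_vertex N (j + 1)) p} = {}"
      using sub False by blast
    then show ?thesis using False by (simp only: if_False)
  qed
  then show ?thesis unfolding cover_count_def fan_apex_def by (simp only: card_1_singleton_iff split: if_split) simp
qed

text \<open>No triangle from the centre passes through a vertex of the polygon without having a
  corner there, so on its side the angle balance at such a vertex has no additional multiples of
  \<open>pi\<close>.\<close>

lemma fan_triangle_vertices: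
  assumes N: "N \<ge> 3" and i: "i \<in> {1..N}" and j: "j \<in> {1..N}"
    and "in_triangle 0 (root_vertex N j) (root_vertex N (j + 1)) (root_vertex N i)"
  shows "root_vertex N i \<in> {root_vertex N j, root_vertex N (j + 1)}"
proof -
  define q where "q = i mod N"
  have N0: "N > 0" using N by simp
  have q: "q < N" "root_vertex N i = root_vertex N q" using N root_vertex_mod[OF i] by (auto simp: q_def)
  have "real j \<le> real q \<and> real q \<le> real j + 1 \<or> real N - 1 \<le> real j - real q"
  proof (rule fan_sector_index[OF N j assms(4)])
    show "root_vertex N i = of_real (norm (root_vertex N i)) * cis (2 * pi * real q / N)"
      unfolding root_vertex_norm using q(2) by (simp add: root_vertex_def)
    show "root_vertex N i \<noteq> 0" by (rule root_vertex_nonzero)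
  qed (use q in auto)
  then have "q = j \<or> q = j + 1 \<or> j = N \<and> q = 0 \<or> j = N \<and> q = 1 \<or> j + 1 = N \<and> q = 0"
    using q(1) j by auto
  then show ?thesis
    using q(2) root_vertex_periodic[OF N0, of 0] root_vertex_periodic[OF N0, of 1] by (auto simp: add.commute)
qed

lemma fan_angle_sum:
  assumes N: "N \<ge> 3"
  defines "S \<equiv> \<lambda>x. \<Sum>j\<in>{1..N}. vertex_sum angle_ccw (fan_apex j) (root_vertex N j) (root_vertex N (j + 1)) x"
  shows "S 0 = 2 * pi"
    and "i \<in> {1..N} \<Longrightarrow> S (root_vertex N i) = pi - 2 * pi / N"
    and "x \<noteq> 0 \<Longrightarrow> x \<notin> root_vertex N ` {1..N} \<Longrightarrow> S x = 0"
proof -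
  note nz = root_vertex_nonzero
  have vs: "vertex_sum angle_ccw (fan_apex j) (root_vertex N j) (root_vertex N (j + 1)) x =
     (if x = 0 then 2 * pi / N else 0) + (if x = root_vertex N j then pi / 2 - pi / N else 0)
      + (if x = root_vertex N (j + 1) then pi / 2 - pi / N else 0)" for j x
    unfolding vertex_sum_def fan_apex_def fan_angles[OF N] ..
  have S: "S x = (if x = 0 then 2 * pi else 0) + 2 * (\<Sum>j\<in>{1..N}. if x = root_vertex N j then pi / 2 - pi / N else 0)" for x
  proof -
    have "(\<Sum>j\<in>{1..N}. if x = root_vertex N (j + 1) then pi / 2 - pi / N else 0)
       = (\<Sum>j\<in>{1..N}. if x = root_vertex N j then pi / 2 - pi / N else 0)"
      using N by (intro sum_root_vertex_shift) simp
    then show ?thesis using N unfolding S_def vs sum.distrib by simp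
  qed
  show "S 0 = 2 * pi" unfolding S using nz by (simp add: eq_commute[of 0])
  show "S x = 0" if "x \<noteq> 0" "x \<notin> root_vertex N ` {1..N}"
    unfolding S using that by (auto intro!: sum.neutral)
  show "S (root_vertex N i) = pi - 2 * pi / N" if i: "i \<in> {1..N}"
  proof -
    have "root_vertex N i = root_vertex N j \<longleftrightarrow> i = j" if "j \<in> {1..N}" for j
      using root_vertex_inj[of N] N i that by (auto dest: inj_onD)
    then have "(\<Sum>j\<in>{1..N}. if root_vertex N i = root_vertex N j then pi / 2 - pi / N else 0)
       = (\<Sum>j\<in>{1..N}. if i = j then pi / 2 - pi / N else 0)"
      by (intro sum.cong refl) simp
    also have "\<dots> = pi / 2 - pi / N" using i by simp
    finally show ?thesis unfolding S using nz by (simp add: algebra_simps)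
  qed
qed

text \<open>Since \<open>\<Phi>\<close> fixes 0, the spokes contribute nothing and only the sides of
  the polygon count. Their directions are multiples of \<open>pi / (2 * N)\<close>, hence the
  divisibility of \<open>n\<close>.\<close>

lemma (in cyclotomic_semilinear) fan_conjugate_area:
  assumes N: "N \<ge> 3" and dvd: "2 * N dvd n"
  shows "(\<Sum>j\<in>{1..N}. edge_sum conjugate_edge (fan_apex j) (root_vertex N j) (root_vertex N (j + 1)))
    = N * sin (2 * pi * k / N)"
proof -
  obtain l where l: "n = 2 * N * l" using dvd by (auto simp: dvd_def)
  have N0: "real N > 0" using N by simp
  have image: "\<Phi> (root_vertex N j) = cis (k * (2 * pi * real j / N))" for j
  proof -
    have "(2 * pi * real j / N) * n / pi = of_int (4 * int j * int l)" using N0 by (simp add: l)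
    then have "(2 * pi * real j / N) * n / pi \<in> \<int>" by (metis Ints_of_int)
    from semilinear_angle[OF this, of 1] show ?thesis by (simp add: root_vertex_def normalised)
  qed
  have "edge_sum conjugate_edge (fan_apex j) (root_vertex N j) (root_vertex N (j + 1)) = sin (2 * pi * k / N)" for j
  proof -
    have dir: "line_dir (root_vertex N j) (root_vertex N (j + 1)) = cis (2 * ((2 * real j + 1) * pi / N + pi / 2))"
      by (rule line_dir_polar[OF root_vertex_step]) (use N sin_pi_over_pos[of N] in auto)
    have "real n * (2 * ((2 * real j + 1) * pi / N + pi / 2)) = 2 * pi * of_int (int l * (2 * (2 * int j + 1) + int N))"
      using N0 by (simp add: l field_simps)
    then have "cis (real n * (2 * ((2 * real j + 1) * pi / N + pi / 2))) = 1"
      by (simp only: cis_multiple_2pi Ints_of_int)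
    then have "cyclotomic_line (root_vertex N j) (root_vertex N (j + 1))"
      unfolding cyclotomic_line_def dir Complex.DeMoivre .
    then have "edge_sum conjugate_edge (fan_apex j) (root_vertex N j) (root_vertex N (j + 1))
       = crs (cis (k * (2 * pi * real j / N))) (cis (k * (2 * pi * real (j + 1) / N)))"
      unfolding edge_sum_def conjugate_edge_def fan_apex_def by (simp add: image)
    also have "\<dots> = sin (k * (2 * pi * real (j + 1) / N) - k * (2 * pi * real j / N))"
      by (simp add: crs_expand sin_diff)
    also have "k * (2 * pi * real (j + 1) / N) - k * (2 * pi * real j / N) = 2 * pi * k / N"
      using N0 by (simp add: field_simps)
    finally show ?thesis .
  qed
  then show ?thesis by simp
qed

section \<open>Tilings of a regular polygon\<close>

lemma crs_divide: "crs (u / w) (v / w) = crs u v / norm w ^ 2"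
proof -
  have "cnj (u / w) * (v / w) = cnj u * v / of_real (norm w ^ 2)"
    by (simp add: complex_norm_square mult.commute del: of_real_power)
  then have "Im (cnj (u / w) * (v / w)) = Im (cnj u * v) / norm w ^ 2"
    by (simp only: Im_divide_of_real)
  then show ?thesis by (simp only: crs_def)
qed

lemma collinear_of_crs:
  assumes "crs (b - a) (c - a) = 0"
  shows "collinear {a, b, c}"
proof (cases "a = b")
  case True
  then show ?thesis by simp
next
  case False
  define s where "s = Re ((c - a) / (b - a))"
  have "(c - a) / (b - a) = cnj (b - a) * (c - a) / of_real (norm (b - a) ^ 2)"
    by (subst complex_div_cnj) (simp add: mult.commute)
  then have "Im ((c - a) / (b - a)) = crs (b - a) (c - a) / norm (b - a) ^ 2"
    by (simp only: Im_divide_of_real crs_def)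
  then have "(c - a) / (b - a) = of_real s" using assms by (simp add: s_def complex_eq_iff)
  then have "c = a + s *\<^sub>R (b - a)" using False by (simp add: field_simps scaleR_conv_of_real)
  moreover have "b = a + 1 *\<^sub>R (b - a)" by simp
  moreover have "a = a + 0 *\<^sub>R (b - a)" by simp
  ultimately have "\<forall>x\<in>{a, b, c}. \<exists>r. x = a + r *\<^sub>R (b - a)" by blast
  then show ?thesis unfolding collinear_alt by blast
qed

lemma angle_at_commute: "angle_at P Q R = angle_at R Q P"
  by (simp add: angle_at_def inner_commute mult.commute)

lemma angle_at_ccw:
  assumes "ccw Q P R"
  shows "angle_at P Q R = angle_ccw Q P R"
proof -
  define \<omega> where "\<omega> = angle_ccw Q P R"
  have PQ: "norm (P - Q) \<noteq> 0" "norm (R - Q) \<noteq> 0" using ccw_distinct[OF assms] by auto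
  have "(R - Q) / (P - Q) = of_real (norm (R - Q) / norm (P - Q)) * cis \<omega>"
    unfolding \<omega>_def by (rule angle_ccw_ratio[OF assms])
  moreover have "(R - Q) / (P - Q) = cnj (P - Q) * (R - Q) / of_real (norm (P - Q) ^ 2)"
    by (subst complex_div_cnj) (simp add: mult.commute)
  ultimately have "cnj (P - Q) * (R - Q) = of_real (norm (P - Q) ^ 2) * (of_real (norm (R - Q) / norm (P - Q)) * cis \<omega>)"
    using PQ by (simp add: field_simps del: complex_cnj_diff)
  also have "\<dots> = of_real (norm (P - Q) * norm (R - Q)) * cis \<omega>"
    using PQ by (simp add: power2_eq_square)
  finally have "Re (cnj (P - Q) * (R - Q)) = norm (P - Q) * norm (R - Q) * cos \<omega>"
    by (simp only:) simp
  moreover have "inner (P - Q) (R - Q) = Re (cnj (P - Q) * (R - Q))"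
    by (simp add: inner_complex_def algebra_simps)
  ultimately have "inner (P - Q) (R - Q) / (norm (P - Q) * norm (R - Q)) = cos \<omega>"
    using PQ by simp
  then show ?thesis
    unfolding angle_at_def using angle_ccw[OF assms] by (simp add: arccos_cos \<omega>_def)
qed

lemma angle_at_normalise:
  assumes "w \<noteq> 0"
  shows "angle_at ((P - c) / w) ((Q - c) / w) ((R - c) / w) = angle_at P Q R"
proof -
  have diff: "(P - c) / w - (Q - c) / w = (P - Q) / w" for P Q by (simp add: diff_divide_distrib)
  have inner: "inner (u / w) (v / w) = inner u v / norm w ^ 2" for u v
  proof -
    have "cnj (u / w) * (v / w) = cnj u * v / of_real (norm w ^ 2)"
      by (simp add: complex_norm_square mult.commute del: of_real_power)
    then have "Re (cnj (u / w) * (v / w)) = Re (cnj u * v) / norm w ^ 2"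
      by (simp only: Re_divide_of_real)
    moreover have "inner x y = Re (cnj x * y)" for x y by (simp add: inner_complex_def)
    ultimately show ?thesis by (simp only:)
  qed
  show ?thesis
    unfolding angle_at_def diff inner norm_divide using assms by (simp add: power2_eq_square)
qed

definition tile_A :: "complex \<Rightarrow> complex \<Rightarrow> tile \<Rightarrow> complex" where
  "tile_A c w t = (vertex_\<alpha> t - c) / w"

definition tile_ccw :: "complex \<Rightarrow> complex \<Rightarrow> tile \<Rightarrow> bool" where
  "tile_ccw c w t \<longleftrightarrow> ccw ((vertex_\<alpha> t - c) / w) ((vertex_\<beta> t - c) / w) ((vertex_\<gamma> t - c) / w)"

text \<open>A clockwise tile has its second and third corners exchanged, which makes every tile
  counterclockwise; whether \<open>\<beta>\<close> or \<open>\<gamma>\<close> sits at the second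
  corner then depends on the tile.\<close>

definition tile_B :: "complex \<Rightarrow> complex \<Rightarrow> tile \<Rightarrow> complex" where
  "tile_B c w t = ((if tile_ccw c w t then vertex_\<beta> t else vertex_\<gamma> t) - c) / w"

definition tile_C :: "complex \<Rightarrow> complex \<Rightarrow> tile \<Rightarrow> complex" where
  "tile_C c w t = ((if tile_ccw c w t then vertex_\<gamma> t else vertex_\<beta> t) - c) / w"

lemmas tile_vertex_defs = tile_A_def tile_B_def tile_C_def

lemma tile_vertices_ccw:
  assumes "w \<noteq> 0" and "has_angles \<alpha> \<beta> \<gamma> t"
  shows "ccw (tile_A c w t) (tile_B c w t) (tile_C c w t)"
proof (cases "tile_ccw c w t")
  case True
  then show ?thesis by (simp add: tile_vertex_defs tile_ccw_def)
next
  case False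
  have diff: "(P - c) / w - (Q - c) / w = (P - Q) / w" for P Q by (simp add: diff_divide_distrib)
  have "crs (vertex_\<beta> t - vertex_\<alpha> t) (vertex_\<gamma> t - vertex_\<alpha> t) \<noteq> 0"
    using assms(2) collinear_of_crs by (auto simp: has_angles_def)
  moreover have "\<not> crs (vertex_\<beta> t - vertex_\<alpha> t) (vertex_\<gamma> t - vertex_\<alpha> t) / norm w ^ 2 > 0"
    using False unfolding tile_ccw_def ccw_def diff crs_divide .
  ultimately have "crs (vertex_\<beta> t - vertex_\<alpha> t) (vertex_\<gamma> t - vertex_\<alpha> t) < 0"
    using assms(1) by (simp add: zero_less_divide_iff)
  then have "crs (vertex_\<gamma> t - vertex_\<alpha> t) (vertex_\<beta> t - vertex_\<alpha> t) / norm w ^ 2 > 0"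
    using assms(1) by (intro divide_pos_pos) (simp_all add: crs_expand algebra_simps)
  then show ?thesis
    using False unfolding tile_vertex_defs ccw_def by (simp only: if_False diff crs_divide)
qed

lemma tile_angles:
  assumes "w \<noteq> 0" and "has_angles \<alpha> \<beta> \<gamma> t"
  shows "angle_ccw (tile_A c w t) (tile_B c w t) (tile_C c w t) = \<alpha>"
    and "angle_ccw (tile_B c w t) (tile_C c w t) (tile_A c w t) = (if tile_ccw c w t then \<beta> else \<gamma>)"
    and "angle_ccw (tile_C c w t) (tile_A c w t) (tile_B c w t) = (if tile_ccw c w t then \<gamma> else \<beta>)"
proof -
  note ccw = tile_vertices_ccw[OF assms, of c]
  have ang: "angle_at (vertex_\<beta> t) (vertex_\<alpha> t) (vertex_\<gamma> t) = \<alpha>"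
      "angle_at (vertex_\<alpha> t) (vertex_\<beta> t) (vertex_\<gamma> t) = \<beta>"
      "angle_at (vertex_\<alpha> t) (vertex_\<gamma> t) (vertex_\<beta> t) = \<gamma>"
    using assms(2) by (auto simp: has_angles_def)
  note ang' = ang ang[unfolded angle_at_commute[of "vertex_\<beta> t" "vertex_\<alpha> t"]
    angle_at_commute[of "vertex_\<alpha> t" "vertex_\<beta> t"] angle_at_commute[of "vertex_\<alpha> t" "vertex_\<gamma> t"]]
  show "angle_ccw (tile_A c w t) (tile_B c w t) (tile_C c w t) = \<alpha>"
    unfolding angle_at_ccw[OF ccw, symmetric] unfolding tile_vertex_defs angle_at_normalise[OF assms(1)]
    using ang' by simp
  show "angle_ccw (tile_B c w t) (tile_C c w t) (tile_A c w t) = (if tile_ccw c w t then \<beta> else \<gamma>)"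
    unfolding angle_at_ccw[OF ccw_rotate[OF ccw], symmetric]
    unfolding tile_vertex_defs angle_at_normalise[OF assms(1)]
    using ang' by simp
  show "angle_ccw (tile_C c w t) (tile_A c w t) (tile_B c w t) = (if tile_ccw c w t then \<gamma> else \<beta>)"
    unfolding angle_at_ccw[OF ccw_rotate[OF ccw_rotate[OF ccw]], symmetric]
    unfolding tile_vertex_defs angle_at_normalise[OF assms(1)]
    using ang' by simp
qed

lemma hull_similarity:
  fixes c w :: complex
  shows "(\<lambda>z. c + w * z) ` (convex hull S) = convex hull ((\<lambda>z. c + w * z) ` S)"
proof -
  have lin: "linear (\<lambda>z::complex. w * z)" by (rule linearI) (simp_all add: algebra_simps)
  have "(\<lambda>z. c + w * z) ` (convex hull S) = (+) c ` ((*) w ` (convex hull S))" by (simp add: image_image)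
  also have "\<dots> = (+) c ` (convex hull ((*) w ` S))" using convex_hull_linear_image[OF lin] by simp
  also have "\<dots> = convex hull ((+) c ` ((*) w ` S))" by (rule convex_hull_translation[symmetric])
  finally show ?thesis by (simp add: image_image)
qed

lemma interior_similarity:
  assumes "w \<noteq> 0"
  shows "interior ((\<lambda>z::complex. c + w * z) ` S) = (\<lambda>z. c + w * z) ` interior S"
proof -
  have lin: "linear (\<lambda>z::complex. w * z)" by (rule linearI) (simp_all add: algebra_simps)
  have inj: "inj (\<lambda>z::complex. w * z)" using assms by (auto intro: injI)
  have "interior ((\<lambda>z. c + w * z) ` S) = interior ((+) c ` ((*) w ` S))" by (simp add: image_image)
  also have "\<dots> = (+) c ` interior ((*) w ` S)" by (rule interior_translation)
  also have "\<dots> = (+) c ` ((*) w ` interior S)" using interior_injective_linear_image[OF lin inj] by simp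
  finally show ?thesis by (simp add: image_image)
qed

lemma similarity_mem_image:
  assumes "w \<noteq> 0"
  shows "c + w * p \<in> (\<lambda>z::complex. c + w * z) ` S \<longleftrightarrow> p \<in> S"
  using assms by auto

lemma tile_set_similarity:
  assumes "w \<noteq> 0"
  shows "tile_set t = (\<lambda>z. c + w * z) ` (convex hull {tile_A c w t, tile_B c w t, tile_C c w t})"
  unfolding hull_similarity tile_set_def using assms by (auto simp: tile_vertex_defs insert_commute)

lemma regular_ngon_similarity:
  "regular_ngon N c w = (\<lambda>z. c + w * z) ` (convex hull (root_vertex N ` {1..N}))"
  unfolding hull_similarity regular_ngon_def by (simp add: image_image ngon_vertex_def root_vertex_def)

lemma tiling_family:
  assumes "w \<noteq> 0" and "tiling A \<alpha> \<beta> \<gamma> T"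
  shows "ccw_family T (tile_A c w) (tile_B c w) (tile_C c w)"
  using assms tile_vertices_ccw by (auto simp: ccw_family_def tiling_def)

lemma tiling_cover_count:
  assumes w: "w \<noteq> 0" and til: "tiling (regular_ngon N c w) \<alpha> \<beta> \<gamma> T"
    and gen: "generic_point T (tile_A c w) (tile_B c w) (tile_C c w) p"
  shows "cover_count T (tile_A c w) (tile_B c w) (tile_C c w) p
    = (if p \<in> convex hull (root_vertex N ` {1..N}) then 1 else 0)"
proof -
  have ccw: "ccw (tile_A c w t) (tile_B c w t) (tile_C c w t)" if "t \<in> T" for t
    using til that tile_vertices_ccw[OF w] by (auto simp: tiling_def)
  have mem: "in_triangle (tile_A c w t) (tile_B c w t) (tile_C c w t) p \<longleftrightarrow> c + w * p \<in> tile_set t" if "t \<in> T" for t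
    unfolding tile_set_similarity[OF w, of t c] similarity_mem_image[OF w] convex_hull_in_triangle[OF ccw[OF that]] ..
  have unique: "s = t" if "s \<in> T" "t \<in> T"
    "in_triangle (tile_A c w s) (tile_B c w s) (tile_C c w s) p"
    "in_triangle (tile_A c w t) (tile_B c w t) (tile_C c w t) p" for s t
  proof (rule ccontr)
    assume "s \<noteq> t"
    have "c + w * p \<in> interior (tile_set r)" if "r \<in> T" "in_triangle (tile_A c w r) (tile_B c w r) (tile_C c w r) p" for r
      unfolding tile_set_similarity[OF w, of r c] interior_similarity[OF w] similarity_mem_image[OF w]
      using gen that by (intro in_triangle_interior ccw) (auto simp: generic_point_def)
    then have "c + w * p \<in> interior (tile_set s) \<inter> interior (tile_set t)" using that by blast
    moreover have "interior (tile_set s) \<inter> interior (tile_set t) = {}"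
      using til that \<open>s \<noteq> t\<close> by (auto simp: tiling_def pairwise_def)
    ultimately show False by blast
  qed
  have "p \<in> convex hull (root_vertex N ` {1..N}) \<longleftrightarrow> (\<exists>t\<in>T. in_triangle (tile_A c w t) (tile_B c w t) (tile_C c w t) p)"
  proof -
    have "p \<in> convex hull (root_vertex N ` {1..N}) \<longleftrightarrow> c + w * p \<in> regular_ngon N c w"
      unfolding regular_ngon_similarity similarity_mem_image[OF w] ..
    also have "\<dots> \<longleftrightarrow> (\<exists>t\<in>T. c + w * p \<in> tile_set t)" using til by (auto simp: tiling_def)
    finally show ?thesis using mem by blast
  qed
  then show ?thesis
  proof (cases "p \<in> convex hull (root_vertex N ` {1..N})")
    case True
    then obtain t where t: "t \<in> T" "in_triangle (tile_A c w t) (tile_B c w t) (tile_C c w t) p"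
      using \<open>_ \<longleftrightarrow> _\<close> by blast
    have "{t \<in> T. in_triangle (tile_A c w t) (tile_B c w t) (tile_C c w t) p} = {t}"
      using t unique by blast
    then show ?thesis using True unfolding cover_count_def by (simp only: if_True) simp
  next
    case False
    then have "{t \<in> T. in_triangle (tile_A c w t) (tile_B c w t) (tile_C c w t) p} = {}"
      using \<open>_ \<longleftrightarrow> _\<close> by blast
    then show ?thesis using False by (simp only: cover_count_def if_False card.empty)
  qed
qed

lemma tile_vertex_sum:
  assumes "w \<noteq> 0" and "has_angles \<alpha> \<beta> \<gamma> t"
  shows "vertex_sum angle_ccw (tile_A c w t) (tile_B c w t) (tile_C c w t) ((V - c) / w)
    = (if vertex_\<alpha> t = V then \<alpha> else 0) + (if vertex_\<beta> t = V then \<beta> else 0) + (if vertex_\<gamma> t = V then \<gamma> else 0)"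
  unfolding vertex_sum_def tile_angles[OF assms] using assms(1) by (auto simp: tile_vertex_defs)

lemma tiling_vertex_sum:
  fixes \<alpha> \<beta> \<gamma> :: real
  assumes "w \<noteq> 0" and til: "tiling A \<alpha> \<beta> \<gamma> T"
  shows "(\<Sum>t\<in>T. vertex_sum angle_ccw (tile_A c w t) (tile_B c w t) (tile_C c w t) ((V - c) / w))
    = card {t \<in> T. vertex_\<alpha> t = V} * \<alpha> + card {t \<in> T. vertex_\<beta> t = V} * \<beta> + card {t \<in> T. vertex_\<gamma> t = V} * \<gamma>"
proof -
  have fin: "finite T" and ang: "\<And>t. t \<in> T \<Longrightarrow> has_angles \<alpha> \<beta> \<gamma> t" using til by (auto simp: tiling_def)
  have count: "(\<Sum>t\<in>T. if P t then x else 0) = card {t \<in> T. P t} * x" for P and x :: real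
    using fin by (simp add: sum.inter_filter[symmetric])
  have "(\<Sum>t\<in>T. vertex_sum angle_ccw (tile_A c w t) (tile_B c w t) (tile_C c w t) ((V - c) / w))
    = (\<Sum>t\<in>T. (if vertex_\<alpha> t = V then \<alpha> else 0) + (if vertex_\<beta> t = V then \<beta> else 0) + (if vertex_\<gamma> t = V then \<gamma> else 0))"
    using ang by (intro sum.cong refl tile_vertex_sum[OF assms(1)])
  then show ?thesis by (simp only: sum.distrib count)
qed


text \<open>The later arithmetic uses nothing else about the tiling. In the last part, weights of
  the labels with sum 0 also sum to 0 over all corners of the tiling, because each label occurs once
  per tile; every vertex of the polygon carries the positive weight \<open>2 * a\<close>, so some
  other point carries a negative one.\<close>

lemma tiling_constraints:
  fixes N :: nat and c w :: complex and \<alpha> \<beta> \<gamma> :: real and T :: "tile set"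
  assumes N: "N \<ge> 3" and w: "w \<noteq> 0"
    and til: "tiling (regular_ngon N c w) \<alpha> \<beta> \<gamma> T"
    and vertex: "\<forall>j\<in>{1..N}. vertex_equation T (ngon_vertex N c w j) 2 0 0"
  shows "0 < \<alpha> \<and> 0 < \<beta> \<and> 0 < \<gamma> \<and> \<alpha> + \<beta> + \<gamma> = pi"
    and "\<alpha> = ngon_angle N / 2"
    and "\<And>(n::nat) (k::nat). \<lbrakk>2 * N dvd n; n > 0; coprime k n; \<alpha> * n / pi \<in> \<int>; \<beta> * n / pi \<in> \<int>; \<gamma> * n / pi \<in> \<int>\<rbrakk>
      \<Longrightarrow> 0 < sin (k * \<alpha>) * sin (k * \<beta>) * sin (k * \<gamma>) * sin (2 * pi * k / N)"
    and "\<And>(a::real) (b::real) (e::real). \<lbrakk>a + b + e = 0; 0 < a\<rbrakk> \<Longrightarrow> \<exists>(p::nat) (q::nat) (r::nat) (z::nat). z \<in> {1::nat, 2} \<and>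
      p * \<alpha> + q * \<beta> + r * \<gamma> = z * pi \<and> a * p + b * q + e * r < 0"
proof -
  define A B C where "A = tile_A c w" and "B = tile_B c w" and "C = tile_C c w"
  note ABC = A_def B_def C_def
  define V where "V = root_vertex N"
  have N2: "N \<ge> 2" and N0: "real N > 0" using N by auto
  have fin: "finite T" and ang: "\<And>t. t \<in> T \<Longrightarrow> has_angles \<alpha> \<beta> \<gamma> t" using til by (auto simp: tiling_def)
  have famT: "ccw_family T A B C" unfolding ABC by (rule tiling_family[OF w til])
  have famJ: "ccw_family {1..N} fan_apex V (\<lambda>j. V (j + 1))" unfolding V_def by (rule fan_family[OF N])
  have cover: "cover_count T A B C p = cover_count {1..N} fan_apex V (\<lambda>j. V (j + 1)) p"
    if "generic_point T A B C p" "generic_point {1..N} fan_apex V (\<lambda>j. V (j + 1)) p" for p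
    using that tiling_cover_count[OF w til] fan_cover_count[OF N] unfolding ABC V_def by metis
  have cover_le: "cover_count T A B C p \<le> 1" if "generic_point T A B C p" for p
    using that tiling_cover_count[OF w til] unfolding ABC by simp
  define cnt where "cnt v P = card {t \<in> T. v t = P}" for v :: "tile \<Rightarrow> complex" and P
  have sumT: "(\<Sum>t\<in>T. vertex_sum angle_ccw (A t) (B t) (C t) ((P - c) / w))
     = cnt vertex_\<alpha> P * \<alpha> + cnt vertex_\<beta> P * \<beta> + cnt vertex_\<gamma> P * \<gamma>" for P
    unfolding ABC cnt_def by (rule tiling_vertex_sum[OF w til])
  have vertex_norm: "(ngon_vertex N c w j - c) / w = V j" for j
    using w by (simp add: ngon_vertex_def V_def root_vertex_def)
  have cnt_vertex: "cnt vertex_\<alpha> (ngon_vertex N c w j) = 2" "cnt vertex_\<beta> (ngon_vertex N c w j) = 0"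
      "cnt vertex_\<gamma> (ngon_vertex N c w j) = 0" if "j \<in> {1..N}" for j
    using vertex that by (auto simp: vertex_equation_def cnt_def)
  have "cnt vertex_\<alpha> (ngon_vertex N c w 1) \<noteq> 0" using cnt_vertex[of 1] N by simp
  then obtain t where t: "t \<in> T" unfolding cnt_def by (metis (no_types, lifting) card.empty empty_Collect_eq)
  have ccw_t: "ccw (A t) (B t) (C t)" using famT t by (simp add: ccw_family_def)
  show angles: "0 < \<alpha> \<and> 0 < \<beta> \<and> 0 < \<gamma> \<and> \<alpha> + \<beta> + \<gamma> = pi"
    using angle_ccw[OF ccw_t] angle_ccw[OF ccw_rotate[OF ccw_t]]
      angle_ccw[OF ccw_rotate[OF ccw_rotate[OF ccw_t]]] angle_ccw_sum[OF ccw_t]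
      tile_angles[OF w ang[OF t], of c]
    unfolding ABC by (auto split: if_splits)
  show "\<alpha> = ngon_angle N / 2"
  proof -
    obtain m m' :: nat where m: "(\<Sum>t\<in>T. vertex_sum angle_ccw (A t) (B t) (C t) (V 1)) + m * pi =
       (\<Sum>j\<in>{1..N}. vertex_sum angle_ccw (fan_apex j) (V j) (V (j + 1)) (V 1)) + m' * pi"
      "m' \<noteq> 0 \<longrightarrow> (\<exists>j\<in>{1..N}. in_triangle (fan_apex j) (V j) (V (j + 1)) (V 1) \<and> V 1 \<notin> {fan_apex j, V j, V (j + 1)})"
      using angle_sum_balance[OF famT famJ cover, of "V 1"] by blast
    have "m' = 0"
      using m(2) fan_triangle_vertices[OF N, of 1] N unfolding V_def fan_apex_def by fastforce
    moreover have "(\<Sum>j\<in>{1..N}. vertex_sum angle_ccw (fan_apex j) (V j) (V (j + 1)) (V 1)) = pi - 2 * pi / N"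
      unfolding V_def by (rule fan_angle_sum(2)[OF N]) (use N in simp)
    moreover have "(\<Sum>t\<in>T. vertex_sum angle_ccw (A t) (B t) (C t) (V 1)) = 2 * \<alpha>"
      using sumT[of "ngon_vertex N c w 1"] cnt_vertex[of 1] N by (simp add: vertex_norm)
    ultimately have eq: "2 * \<alpha> + m * pi = pi - 2 * pi / N" using m(1) by simp
    have "m = 0"
    proof (rule ccontr)
      assume "m \<noteq> 0"
      then have "1 * pi \<le> m * pi" by (intro mult_right_mono) auto
      then show False using eq angles N0 by (smt (verit) divide_pos_pos pi_gt_zero)
    qed
    then show ?thesis using eq N0 by (simp add: ngon_angle_def field_simps)
  qed
  show "0 < sin (k * \<alpha>) * sin (k * \<beta>) * sin (k * \<gamma>) * sin (2 * pi * k / N)"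
    if n: "2 * N dvd n" "n > 0" and k: "coprime k n"
      and int: "\<alpha> * n / pi \<in> \<int>" "\<beta> * n / pi \<in> \<int>" "\<gamma> * n / pi \<in> \<int>" for n k :: nat
  proof -
    \<comment> \<open>\<open>n\<close> is even, so \<open>k\<close> is odd and still coprime to the
      order \<open>2 * n\<close> of \<open>cis (pi / n)\<close>.\<close>
    have "coprime k 2" using coprime_divisors[OF dvd_refl _ k, of 2] n(1) by (meson dvd_trans dvd_triv_left)
    then have k2: "coprime k (2 * n)" using k by simp
    have pos: "0 < 2 * n" using n(2) by simp
    have root: "cis (pi / n) ^ (2 * n) = 1"
      unfolding Complex.DeMoivre using n(2) by simp
    obtain \<Phi> :: "complex \<Rightarrow> complex" where \<Phi>: "\<And>x y. \<Phi> (x + y) = \<Phi> x + \<Phi> y"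
       "\<And>x. \<Phi> (cis (pi / n) * x) = cis (pi / n) ^ k * \<Phi> x" "\<And>x. \<Phi> (cnj x) = cnj (\<Phi> x)" "\<Phi> 1 = 1"
      using cyclotomic_semilinear_map[OF pos root k2] by metis
    interpret cyclotomic_semilinear n k \<Phi>
      by unfold_locales (rule n(2) k \<Phi>)+
    define S where "S = sin (k * \<alpha>) * sin (k * \<beta>) * sin (k * \<gamma>)"
    have "\<exists>P\<ge>0. edge_sum conjugate_edge (A t) (B t) (C t) = S * P" if t: "t \<in> T" for t
    proof -
      have ccw: "ccw (A t) (B t) (C t)" using famT t by (simp add: ccw_family_def)
      note ta = tile_angles[OF w ang[OF t], of c, folded ABC]
      have "\<exists>P\<ge>0. edge_sum conjugate_edge (A t) (B t) (C t) = sin (k * angle_ccw (A t) (B t) (C t))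
         * sin (k * angle_ccw (B t) (C t) (A t)) * sin (k * angle_ccw (C t) (A t) (B t)) * P"
        by (rule edge_sum_conjugate[OF ccw]) (use int in \<open>simp_all add: ta\<close>)
      then show ?thesis unfolding ta S_def by (auto split: if_splits simp: mult_ac)
    qed
    then obtain P where P: "\<And>t. t \<in> T \<Longrightarrow> P t \<ge> 0 \<and> edge_sum conjugate_edge (A t) (B t) (C t) = S * P t"
      by metis
    have "S * (\<Sum>t\<in>T. P t) = (\<Sum>t\<in>T. edge_sum conjugate_edge (A t) (B t) (C t))"
      using P by (simp add: sum_distrib_left)
    also have "\<dots> = N * sin (2 * pi * k / N)"
      using conjugate_area_balance[OF famT famJ cover] fan_conjugate_area[OF N n(1)] by (simp add: V_def)
    finally have eq: "S * (\<Sum>t\<in>T. P t) = N * sin (2 * pi * k / N)" .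
    have "sin (2 * pi * k / N) \<noteq> 0"
    proof
      assume "sin (2 * pi * k / N) = 0"
      then obtain i where "2 * pi * k / N = of_int i * pi" by (auto simp: sin_zero_iff_int2)
      then have "of_int (2 * int k) = (of_int (i * int N) :: real)" using N0 by (simp add: field_simps)
      then have "2 * int k = i * int N" using of_int_eq_iff by blast
      then have "int N dvd int (2 * k)" by simp
      then have "N dvd 2 * k" by (simp only: of_nat_dvd_iff)
      moreover have "coprime N k" using coprime_divisors[OF dvd_refl _ k, of N] n(1)
        by (metis coprime_commute dvd_mult_right)
      ultimately have "N dvd 2" by (simp add: coprime_dvd_mult_left_iff)
      then show False using N dvd_imp_le[of N 2] by simp
    qed
    \<comment> \<open>Multiplying by \<open>sin (2 * pi * k / N)\<close> makes the side of the
      polygon a positive square. As the sum of the \<open>P t\<close> is nonnegative, the other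
      factor has to be positive.\<close>
    then have "0 < N * sin (2 * pi * k / N) ^ 2" using N0 by simp
    also have "\<dots> = (S * sin (2 * pi * k / N)) * (\<Sum>t\<in>T. P t)"
      using eq by (simp add: power2_eq_square mult_ac)
    finally have "0 < S * sin (2 * pi * k / N)"
      using P sum_nonneg[of T P] by (simp add: zero_less_mult_iff)
    then show ?thesis by (simp add: S_def)
  qed
  show "\<exists>(p::nat) (q::nat) (r::nat) (z::nat). z \<in> {1::nat, 2} \<and> p * \<alpha> + q * \<beta> + r * \<gamma> = z * pi \<and> a * p + b * q + e * r < 0"
    if abe: "a + b + e = 0" and a: "0 < a" for a b e :: real
  proof -
    define h where "h P = a * cnt vertex_\<alpha> P + b * cnt vertex_\<beta> P + e * cnt vertex_\<gamma> P" for P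
    define Y where "Y = ngon_vertex N c w ` {1..N}"
    define X where "X = Y \<union> vertex_\<alpha> ` T \<union> vertex_\<beta> ` T \<union> vertex_\<gamma> ` T"
    have finX: "finite X" "Y \<subseteq> X" using fin by (auto simp: X_def Y_def)
    have total: "(\<Sum>P\<in>X. real (cnt v P)) = card T" if "v ` T \<subseteq> X" for v
    proof -
      have "(\<Sum>P\<in>X. cnt v P) = card (\<Union>P\<in>X. {t \<in> T. v t = P})"
        unfolding cnt_def using finX(1) fin by (intro card_UN_disjoint[symmetric]) auto
      also have "(\<Union>P\<in>X. {t \<in> T. v t = P}) = T" using that by blast
      finally show ?thesis by (simp flip: of_nat_sum)
    qed
    have "(\<Sum>P\<in>X. h P) = a * card T + b * card T + e * card T"
    proof -
      have "(\<Sum>P\<in>X. h P) = a * (\<Sum>P\<in>X. real (cnt vertex_\<alpha> P)) + b * (\<Sum>P\<in>X. real (cnt vertex_\<beta> P))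
         + e * (\<Sum>P\<in>X. real (cnt vertex_\<gamma> P))"
        by (simp add: h_def sum.distrib sum_distrib_left)
      also have "(\<Sum>P\<in>X. real (cnt vertex_\<alpha> P)) = card T" by (rule total) (auto simp: X_def)
      also have "(\<Sum>P\<in>X. real (cnt vertex_\<beta> P)) = card T" by (rule total) (auto simp: X_def)
      also have "(\<Sum>P\<in>X. real (cnt vertex_\<gamma> P)) = card T" by (rule total) (auto simp: X_def)
      finally show ?thesis .
    qed
    also have "\<dots> = (a + b + e) * card T" by (simp only: distrib_right)
    finally have "(\<Sum>P\<in>X. h P) = 0" using abe by simp
    moreover have "(\<Sum>P\<in>X. h P) = (\<Sum>P\<in>Y. h P) + (\<Sum>P\<in>X - Y. h P)"
      using finX by (simp add: sum.subset_diff)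
    moreover have "(\<Sum>P\<in>Y. h P) > 0"
    proof (rule sum_pos)
      show "finite Y" "Y \<noteq> {}" using N by (auto simp: Y_def)
      show "0 < h P" if "P \<in> Y" for P using that a cnt_vertex by (auto simp: Y_def h_def)
    qed
    ultimately have "(\<Sum>P\<in>X - Y. h P) < 0" by linarith
    then obtain P where P: "P \<in> X - Y" "h P < 0" using sum_nonneg[of "X - Y" h] by force
    define p q r where "p = cnt vertex_\<alpha> P" and "q = cnt vertex_\<beta> P" and "r = cnt vertex_\<gamma> P"
    define x where "x = (P - c) / w"
    define s where "s = p * \<alpha> + q * \<beta> + r * \<gamma>"
    have sT: "(\<Sum>t\<in>T. vertex_sum angle_ccw (A t) (B t) (C t) x) = s"
      unfolding x_def sumT s_def p_def q_def r_def ..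
    have "x \<notin> V ` {1..N}"
    proof
      assume "x \<in> V ` {1..N}"
      then obtain j where j: "j \<in> {1..N}" "x = V j" by blast
      then have "P = ngon_vertex N c w j" using w by (simp add: x_def ngon_vertex_def V_def root_vertex_def field_simps)
      then show False using P(1) j(1) by (simp add: Y_def)
    qed
    \<comment> \<open>Away from the vertices of the polygon, the triangles from the centre have the
      angle sum \<open>2 * pi\<close> at the centre and 0 elsewhere, so the angles of the tiles at
      \<open>x\<close> add up to a multiple of \<open>pi\<close>.\<close>
    then have "\<exists>l::nat. (\<Sum>j\<in>{1..N}. vertex_sum angle_ccw (fan_apex j) (V j) (V (j + 1)) x) = l * pi"
      using fan_angle_sum(1)[OF N] fan_angle_sum(3)[OF N, of x] unfolding V_def
      by (cases "x = 0") (auto intro: exI[of _ 2] exI[of _ 0])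
    then obtain l :: nat where l: "(\<Sum>j\<in>{1..N}. vertex_sum angle_ccw (fan_apex j) (V j) (V (j + 1)) x) = l * pi" ..
    obtain m m' :: nat where "s + m * pi = l * pi + m' * pi"
      using angle_sum_balance[OF famT famJ cover, of x] unfolding sT l by blast
    then have s: "s = of_int (int l + int m' - int m) * pi" by (simp add: algebra_simps)
    define z where "z = int l + int m' - int m"
    have "s \<le> 2 * pi" using angle_sum_le[OF famT cover_le, of x] unfolding sT .
    then have "of_int z \<le> (2 :: real)" unfolding s z_def[symmetric] using pi_gt_zero mult_le_cancel_right_pos by blast
    then have z2: "z \<le> 2" by simp
    have "h P = 0" if "p = 0 \<and> q = 0 \<and> r = 0" using that by (simp add: h_def p_def q_def r_def)
    then have "\<not> (p = 0 \<and> q = 0 \<and> r = 0)" using P(2) less_irrefl by metis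
    moreover have "0 \<le> p * \<alpha>" "0 \<le> q * \<beta>" "0 \<le> r * \<gamma>" using angles by auto
    moreover have "p \<noteq> 0 \<Longrightarrow> 0 < p * \<alpha>" "q \<noteq> 0 \<Longrightarrow> 0 < q * \<beta>" "r \<noteq> 0 \<Longrightarrow> 0 < r * \<gamma>" using angles by auto
    ultimately have "0 < s" unfolding s_def by linarith
    then have "0 < of_int z * pi" unfolding s z_def .
    then have "0 < z" using pi_gt_zero by (simp add: zero_less_mult_iff)
    then have "nat z \<in> {1, 2}" using z2 by auto
    moreover have "s = nat z * pi" using s \<open>0 < z\<close> by (simp add: z_def)
    ultimately show ?thesis
      using P(2) unfolding s_def h_def p_def[symmetric] q_def[symmetric] r_def[symmetric] by blast
  qed
qed

section \<open>The arithmetic of the angles\<close>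

text \<open>The angles are \<open>\<alpha> = (N - 2) \<pi> / 2N\<close>, \<open>\<beta> = (N + 1 - m) \<pi> / 2N\<close> and \<open>\<gamma> = (1 + m) \<pi> / 2N\<close> with
  \<open>m = (A N + B) / C\<close>.\<close>

definition obstructed :: "int \<Rightarrow> int \<Rightarrow> int \<Rightarrow> int \<Rightarrow> bool" where
  "obstructed N A B C \<longleftrightarrow> (A * N + B) mod C = 0 \<and>
    (let m = (A * N + B) div C in \<exists>k\<in>set [3, 5, 7, 13, 17]. gcd k (2 * N) = 1 \<and>
      ((k * (N - 2)) div (2 * N) + (k * (N + 1 - m)) div (2 * N) + (k * (1 + m)) div (2 * N) + (2 * k) div N) mod 2 = 1)"

text \<open>A vertex equation with multiplicities \<open>p\<close>, \<open>q\<close>, \<open>r\<close> and sum \<open>z \<pi>\<close> reads \<open>N D = E\<close>.\<close>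

definition finitely_many_obstructed :: "int \<Rightarrow> int \<Rightarrow> int \<Rightarrow> bool" where
  "finitely_many_obstructed A B C \<longleftrightarrow>
    (\<forall>z\<in>set [1..2]. \<forall>p\<in>set [0..3]. \<forall>q\<in>set [0..(2 * C * z - 1 - p * C) div (C - A)].
      \<forall>r\<in>set [0..(2 * C * z - 1 - p * C - q * (C - A)) div A].
        let D = 2 * C * z - p * C - q * (C - A) - r * A; E = C * (q + r - 2 * p) - B * (q - r) in
        E < 25 * D \<or> E mod D \<noteq> 0 \<or> E div D = 30 \<or> E div D = 42 \<or> obstructed (E div D) A B C)"

text \<open>The lines \<open>C * m = A * N + B\<close> with \<open>A > 0\<close> that a vertex
  equation with more \<open>\<beta>\<close> than \<open>\<gamma>\<close> can force under
  \<open>- 1 < m\<close> and \<open>2 * m \<le> N\<close>; on them \<open>m\<close> grows with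
  \<open>N\<close>.\<close>

definition generic_families :: "(int \<times> int \<times> int) list" where
  "generic_families = [(1, -4, 2), (1, -1, 3), (1, 0, 2), (1, 2, 4), (1, 3, 3), (1, 5, 5), (1, 6, 4), (1, 7, 3),
     (2, 0, 4), (2, 3, 5), (2, 6, 6), (2, 7, 5), (3, 7, 7)]"

text \<open>With \<open>A = 0\<close>, the values of \<open>m = B / C\<close> are 1/3, 1, 5/3, 3 and
  7; here 1 and 3 give the two sets of angles in the theorem.\<close>

definition constant_families :: "(int \<times> int \<times> int) list" where
  "constant_families = [(0, 1, 3), (0, 2, 2), (0, 3, 1), (0, 4, 4), (0, 5, 3), (0, 6, 2), (0, 7, 1)]"

text \<open>A finite evaluation: the ranges of \<open>p\<close>, \<open>q\<close>, \<open>r\<close>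
  cover all that \<open>D \<ge> 1\<close> allows, and each equation \<open>N * D = E\<close> then
  determines a single \<open>N\<close>.\<close>

lemma generic_families_obstructed:
  "\<forall>(A, B, C)\<in>set generic_families. 0 < A \<and> A < C \<and> finitely_many_obstructed A B C"
  by code_simp

text \<open>Solved for \<open>m\<close>, the vertex equation reads \<open>C * m = A * N + B\<close>
  with these \<open>A\<close>, \<open>B\<close>, \<open>C\<close>. The first two alternatives
  contradict \<open>m > - 1\<close> and the next two contradict \<open>2 * m \<le> N\<close>, in
  each case for all \<open>N \<ge> 25\<close>; the listed families are what remains.\<close>

lemma vertex_equation_families:
  "\<forall>z\<in>set [1..2]. \<forall>p\<in>set [0..4::int]. \<forall>q\<in>set [1..7]. \<forall>r\<in>set [0..q - 1].
     let A = p + q - 2 * z; B = q + r - 2 * p; C = q - r in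
     (A < 0 \<and> 25 * A + B + C \<le> 0) \<or> (A = 0 \<and> B + C \<le> 0) \<or> (C < 2 * A \<and> 25 * (C - 2 * A) < 2 * B)
     \<or> (C = 2 * A \<and> 0 < B) \<or> (A, B, C) \<in> set generic_families \<or> (A, B, C) \<in> set constant_families"
  by code_simp

section \<open>Parities of floors and coprime numbers\<close>

lemma sin_floor_sign: "0 \<le> sin (pi * t) * (if even \<lfloor>t\<rfloor> then 1 else - 1)"
proof -
  define f where "f = \<lfloor>t\<rfloor>"
  define u where "u = t - of_int f"
  have u: "0 \<le> u" "u \<le> 1" unfolding u_def f_def by linarith+
  have "0 \<le> sin (pi * u)" using u by (intro sin_ge_zero) (auto simp: mult_le_cancel_left1)
  have "sin (pi * t) = sin (pi * u + of_int f * pi)" by (simp add: u_def algebra_simps)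
  also have "\<dots> = sin (pi * u) * cos (of_int f * pi)" by (simp add: sin_add sin_int_times_real mult.commute)
  also have "cos (of_int f * pi) = (if even f then 1 else - 1)"
    using cos_npi_int[of f] by (auto simp: mult.commute)
  finally show ?thesis using \<open>0 \<le> sin (pi * u)\<close> by (simp add: f_def)
qed

lemma even_floor_sum:
  assumes "0 < sin (pi * a) * sin (pi * b) * sin (pi * c) * sin (pi * d)"
  shows "even (\<lfloor>a\<rfloor> + \<lfloor>b\<rfloor> + \<lfloor>c\<rfloor> + \<lfloor>d\<rfloor>)"
proof (rule ccontr)
  assume odd: "\<not> even (\<lfloor>a\<rfloor> + \<lfloor>b\<rfloor> + \<lfloor>c\<rfloor> + \<lfloor>d\<rfloor>)"
  define s where "s t = (if even \<lfloor>t\<rfloor> then 1 else - 1 :: real)" for t :: real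
  have "0 \<le> (sin (pi * a) * s a) * (sin (pi * b) * s b) * ((sin (pi * c) * s c) * (sin (pi * d) * s d))"
    unfolding s_def by (intro mult_nonneg_nonneg sin_floor_sign)
  also have "\<dots> = (sin (pi * a) * sin (pi * b) * sin (pi * c) * sin (pi * d)) * (s a * s b * s c * s d)"
    by (simp add: mult_ac)
  also have "s a * s b * s c * s d = - 1" using odd by (auto simp: s_def)
  finally show False using assms by simp
qed

text \<open>A common divisor of \<open>k\<close> and \<open>N\<close> divides the small number
  \<open>s\<close>; this yields numbers coprime to \<open>N\<close> next to
  \<open>N / a\<close>.\<close>

lemma coprime_of_linear:
  fixes k N :: nat
  assumes "int N = a * int k + s" and "coprime (int k) s"
  shows "coprime k N"
proof -
  have "gcd (int k) (int N) = gcd (int k) s" unfolding assms(1) by (metis gcd_add_mult add.commute)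
  then have "coprime (int k) (int N)" using assms(2) by (simp add: coprime_iff_gcd_eq_1)
  then show ?thesis by simp
qed

lemma coprime_odd_power_two:
  fixes k :: nat
  assumes "odd k"
  shows "coprime (int k) (2 ^ e)" "coprime (int k) (- (2 ^ e))"
  using assms by simp_all

lemma coprime_three_power: "\<not> 3 dvd (k::nat) \<Longrightarrow> coprime (int k) 3"
proof -
  assume "\<not> 3 dvd k"
  moreover have "prime (3::nat)" by simp
  ultimately have "coprime 3 k" using prime_imp_coprime by blast
  then have "coprime (int 3) (int k)" by (simp only: coprime_int_iff)
  then show ?thesis by (simp add: coprime_commute)
qed

text \<open>The bounds \<open>N / 6\<close> and \<open>N / 4\<close> are the ends of an interval on which the sign condition fails for
  \<open>m = 7\<close>; numbers coprime to \<open>N\<close> are found next to these ends.\<close>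

lemma coprime_between_sixth_and_quarter:
  fixes N :: nat
  assumes N: "N \<ge> 25" "N \<noteq> 30" "N \<noteq> 42"
  shows "\<exists>k. coprime k N \<and> N < 6 * k \<and> 4 * k < N \<and> (even N \<longrightarrow> odd k)"
proof -
  have pow: "coprime (int k) 4" "coprime (int k) 8" "coprime (int k) 2"
    "coprime (int k) (- 4)" "coprime (int k) (- 8)" if "odd k" for k :: nat
    using coprime_odd_power_two[OF that, of 2] coprime_odd_power_two[OF that, of 3]
      coprime_odd_power_two[OF that, of 1] by simp_all
  have three: "coprime (int k) 3" "coprime (int k) (- 3)" "coprime (int k) 9" "coprime (int k) (- 9)"
    if "\<not> 3 dvd k" for k :: nat
  proof -
    show c: "coprime (int k) 3" "coprime (int k) (- 3)" using coprime_three_power[OF that] by simp_all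
    have "coprime (int k) (3 * 3)" unfolding coprime_mult_right_iff using c by simp
    then show "coprime (int k) 9" "coprime (int k) (- 9)" by simp_all
  qed
  have twelve: "coprime (int k) (- 12)" "coprime (int k) (- 24)" if "odd k" "\<not> 3 dvd k" for k :: nat
  proof -
    have "coprime (int k) (4 * 3)" "coprime (int k) (8 * 3)"
      unfolding coprime_mult_right_iff using pow[OF that(1)] three[OF that(2)] by auto
    then show "coprime (int k) (- 12)" "coprime (int k) (- 24)" by simp_all
  qed
  \<comment> \<open>In the cases \<open>a\<close>, \<open>b\<close>, \<open>c\<close>,
    \<open>f\<close>, \<open>g\<close> the witness lies just below \<open>N / 4\<close>, in the
    others just above \<open>N / 6\<close>. The remainder \<open>s\<close> has no prime factors
    other than 2 and 3, and the residues of \<open>N\<close> are split so that \<open>k\<close>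
    avoids those that occur.\<close>
  consider (a) M where "N = 4 * M" "even M" | (b) M where "N = 4 * M" "odd M"
    | (c) M where "N = 4 * M + 2" "odd M"
    | (d1) P where "N = 2 * P" "odd P" "P mod 3 = 1" | (d2) P where "N = 2 * P" "odd P" "P mod 3 = 2"
    | (e1) Q where "N = 6 * Q" "odd Q" "\<not> 3 dvd (Q + 2)" | (e2) Q where "N = 6 * Q" "odd Q" "3 dvd (Q + 2)"
    | (f) M where "N = 4 * M + 1" | (g) M where "N = 4 * M + 3" "\<not> 3 dvd N"
    | (h1) Q R where "N = 3 * Q" "Q = 2 * R + 1" "\<not> 3 dvd (R + 1)"
    | (h2) Q R where "N = 3 * Q" "Q = 2 * R + 1" "3 dvd (R + 1)"
  proof -
    have "N mod 4 = 0 \<or> N mod 4 = 1 \<or> N mod 4 = 2 \<or> N mod 4 = 3" by linarith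
    then show thesis
    proof (elim disjE)
      assume "N mod 4 = 0"
      then have "N = 4 * (N div 4)" by presburger
      then show thesis using a b by blast
    next
      assume "N mod 4 = 1"
      then have "N = 4 * (N div 4) + 1" by presburger
      then show thesis using f by blast
    next
      assume r: "N mod 4 = 3"
      then have eq: "N = 4 * (N div 4) + 3" by presburger
      show thesis
      proof (cases "3 dvd N")
        case False
        then show thesis using eq g by blast
      next
        case True
        then have "N = 3 * (N div 3)" by presburger
        moreover have "N div 3 = 2 * (N div 3 div 2) + 1" using True r by presburger
        ultimately show thesis using h1 h2 by blast
      qed
    next
      assume r: "N mod 4 = 2"
      then have P: "N = 2 * (N div 2)" "odd (N div 2)" by presburger+
      have "N div 2 mod 3 = 0 \<or> N div 2 mod 3 = 1 \<or> N div 2 mod 3 = 2" by linarith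
      then show thesis
      proof (elim disjE)
        assume "N div 2 mod 3 = 0"
        then have "N = 6 * (N div 6)" "odd (N div 6)" using r by presburger+
        then show thesis using e1 e2 by blast
      qed (use P d1 d2 in blast)+
    qed
  qed
  then show ?thesis
  proof cases
    case (a M)
    define k where "k = M - 1"
    have k: "M = k + 1" "odd k" using a N by (auto simp: k_def)
    have "coprime k N" by (rule coprime_of_linear[of _ 4 _ 4]) (use a k pow in auto)
    then show ?thesis using a k N by (intro exI[of _ k]) auto
  next
    case (b M)
    define k where "k = M - 2"
    have k: "M = k + 2" "odd k" using b N by (auto simp: k_def)
    have "coprime k N" by (rule coprime_of_linear[of _ 4 _ 8]) (use b k pow in auto)
    then show ?thesis using b k N by (intro exI[of _ k]) auto
  next
    case (c M)
    have "coprime M N" by (rule coprime_of_linear[of _ 4 _ 2]) (use c pow in auto)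
    then show ?thesis using c N by (intro exI[of _ M]) auto
  next
    case (d1 P)
    define k where "k = (P + 2) div 3"
    have k: "P + 2 = 3 * k" "odd k" using d1 unfolding k_def by presburger+
    have "int N = 6 * int k + (- 4)" using d1 k by linarith
    then have "coprime k N" by (rule coprime_of_linear) (use k pow in auto)
    then show ?thesis using d1 k N by (intro exI[of _ k]) auto
  next
    case (d2 P)
    define k where "k = (P + 4) div 3"
    have k: "P + 4 = 3 * k" "odd k" using d2 unfolding k_def by presburger+
    have "int N = 6 * int k + (- 8)" using d2 k by linarith
    then have "coprime k N" by (rule coprime_of_linear) (use k pow in auto)
    then show ?thesis using d2 k N by (intro exI[of _ k]) auto
  next
    case (e1 Q)
    have Q: "Q \<ge> 9" using e1 N by (cases "Q \<le> 8") presburger+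
    have "int N = 6 * int (Q + 2) + (- 12)" using e1 by simp
    then have "coprime (Q + 2) N" by (rule coprime_of_linear) (use e1 in \<open>intro twelve, auto\<close>)
    then show ?thesis using e1 Q by (intro exI[of _ "Q + 2"]) auto
  next
    case (e2 Q)
    \<comment> \<open>The excluded values 30 and 42 are \<open>Q = 5\<close> and
      \<open>Q = 7\<close>; the witness \<open>Q + 4\<close> lies below \<open>N / 4\<close> only
      for \<open>Q > 8\<close>.\<close>
    have Q: "Q \<ge> 9" using e2 N by (cases "Q \<le> 8") presburger+
    have "int N = 6 * int (Q + 4) + (- 24)" using e2 by simp
    moreover have "\<not> 3 dvd (Q + 4)" using e2 by presburger
    ultimately have "coprime (Q + 4) N" using e2 by (intro coprime_of_linear[of N 6 _ "- 24"] twelve) auto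
    then show ?thesis using e2 Q by (intro exI[of _ "Q + 4"]) auto
  next
    case (f M)
    have "coprime M N" by (rule coprime_of_linear[of _ 4 _ 1]) (use f in auto)
    then show ?thesis using f N by (intro exI[of _ M]) auto
  next
    case (g M)
    have "\<not> 3 dvd M" using g by presburger
    then have "coprime M N" by (intro coprime_of_linear[of _ 4 _ 3] three) (use g in auto)
    then show ?thesis using g N by (intro exI[of _ M]) auto
  next
    case (h1 Q R)
    have "coprime (R + 1) N" by (intro coprime_of_linear[of _ 6 _ "- 3"] three) (use h1 in auto)
    then show ?thesis using h1 N by (intro exI[of _ "R + 1"]) auto
  next
    case (h2 Q R)
    have "\<not> 3 dvd (R + 2)" using h2 by presburger
    then have "coprime (R + 2) N" by (intro coprime_of_linear[of _ 6 _ "- 9"] three) (use h2 in auto)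
    then show ?thesis using h2 N by (intro exI[of _ "R + 2"]) auto
  qed
qed

text \<open>For \<open>m = 1 / 3\<close> and \<open>m = 5 / 3\<close> the common denominator is
  \<open>6 * N\<close>, and \<open>k\<close> has to lie close to \<open>N\<close> on a prescribed
  side. The shift \<open>s\<close> is read off from \<open>N\<close> modulo 6.\<close>

lemma coprime_near:
  fixes N :: nat
  assumes "N \<ge> 5"
  shows "\<exists>s\<in>{1..4}. coprime (N + s) (6 * N)" and "\<exists>s\<in>{1..4}. coprime (N - s) (6 * N)"
proof -
  have six: "coprime k (6 * N)" if "odd k" "\<not> 3 dvd k" "coprime k N" for k :: nat
  proof -
    have "coprime k 3" using coprime_three_power[OF that(2)] by (metis coprime_int_iff of_nat_numeral)
    moreover have "coprime k 2" using that(1) by simp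
    ultimately have "coprime k (2 * 3 * N)" using that(3) by (simp only: coprime_mult_right_iff)
    then show ?thesis by simp
  qed
  have plus: "coprime (N + s) N" if "coprime N s" for s
    using that by (metis coprime_add_one_left coprime_commute coprime_iff_gcd_eq_1 gcd_add1 add.commute)
  have minus: "coprime (N - s) N" if "coprime N s" "s \<le> N" for s
  proof -
    have "gcd (N - s) N = gcd N s" using that(2) by (metis gcd.commute gcd_diff2_nat gcd_diff1_nat diff_diff_cancel diff_le_self)
    then show ?thesis using that(1) by (simp add: coprime_iff_gcd_eq_1)
  qed
  have N3: "coprime N 3" if "\<not> 3 dvd N" using coprime_three_power[OF that] by (metis coprime_int_iff of_nat_numeral)
  have N24: "coprime N 2" "coprime N 4" if "odd N"
    using that coprime_odd_power_two(1)[OF that, of 2] by (simp_all flip: coprime_int_iff)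
  have plus6: "\<exists>s\<in>{1..4}. coprime (N + s) (6 * N)"
    if "odd (N + s)" "\<not> 3 dvd (N + s)" "coprime N s" "s \<in> {1..4}" for s
    using six[OF that(1,2) plus[OF that(3)]] that(4) by blast
  have minus6: "\<exists>s\<in>{1..4}. coprime (N - s) (6 * N)"
    if "odd (N - s)" "\<not> 3 dvd (N - s)" "coprime N s" "s \<in> {1..4}" for s
  proof -
    have "s \<le> N" using that(4) assms by simp
    then show ?thesis using six[OF that(1,2) minus[OF that(3)]] that(4) by blast
  qed
  consider (a) "even N" "N mod 3 = 0" | (b) "even N" "N mod 3 = 1" | (c) "even N" "N mod 3 = 2"
    | (d) "odd N" "N mod 3 = 0" | (e) "odd N" "N mod 3 = 1" | (f) "odd N" "N mod 3 = 2"
    by linarith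
  then have "(\<exists>s\<in>{1..4}. coprime (N + s) (6 * N)) \<and> (\<exists>s\<in>{1..4}. coprime (N - s) (6 * N))"
  proof cases
    case a
    have odd: "odd (N + 1)" "\<not> 3 dvd (N + 1)" "odd (N - 1)" "\<not> 3 dvd (N - 1)"
      using a assms by presburger+
    show ?thesis using plus6[OF odd(1,2)] minus6[OF odd(3,4)] by simp
  next
    case b
    have odd: "odd (N + 1)" "\<not> 3 dvd (N + 1)" "odd (N - 3)" "\<not> 3 dvd (N - 3)"
      using b assms by presburger+
    have "coprime N 3" using b by (intro N3) presburger
    then show ?thesis using plus6[OF odd(1,2)] minus6[OF odd(3,4)] by simp
  next
    case c
    have odd: "odd (N + 3)" "\<not> 3 dvd (N + 3)" "odd (N - 1)" "\<not> 3 dvd (N - 1)"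
      using c assms by presburger+
    have "coprime N 3" using c by (intro N3) presburger
    then show ?thesis using plus6[OF odd(1,2)] minus6[OF odd(3,4)] by simp
  next
    case d
    have odd: "odd (N + 2)" "\<not> 3 dvd (N + 2)" "odd (N - 2)" "\<not> 3 dvd (N - 2)"
      using d assms by presburger+
    note N24[OF d(1)]
    then show ?thesis using plus6[OF odd(1,2)] minus6[OF odd(3,4)] by simp
  next
    case e
    have odd: "odd (N + 4)" "\<not> 3 dvd (N + 4)" "odd (N - 2)" "\<not> 3 dvd (N - 2)"
      using e assms by presburger+
    note N24[OF e(1)]
    then show ?thesis using plus6[OF odd(1,2)] minus6[OF odd(3,4)] by simp
  next
    case f
    have odd: "odd (N + 2)" "\<not> 3 dvd (N + 2)" "odd (N - 4)" "\<not> 3 dvd (N - 4)"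
      using f assms by presburger+
    note N24[OF f(1)]
    then show ?thesis using plus6[OF odd(1,2)] minus6[OF odd(3,4)] by simp
  qed
  then show "\<exists>s\<in>{1..4}. coprime (N + s) (6 * N)" "\<exists>s\<in>{1..4}. coprime (N - s) (6 * N)" by blast+
qed

section \<open>Excluding the candidates for the angles\<close>

locale tile_angle_constraints =
  fixes N :: nat and \<alpha> \<beta> \<gamma> :: real
  assumes N_ge: "N \<ge> 25" and N_ne: "N \<noteq> 30" "N \<noteq> 42"
    and angles_pos: "0 < \<beta>" "0 < \<gamma>"
    and angle_sum: "\<alpha> + \<beta> + \<gamma> = pi"
    and alpha_eq: "\<alpha> = pi / 2 - pi / N"
    and conjugate_sign: "\<And>(n::nat) (k::nat). \<lbrakk>2 * N dvd n; n > 0; coprime k n; \<alpha> * n / pi \<in> \<int>; \<beta> * n / pi \<in> \<int>; \<gamma> * n / pi \<in> \<int>\<rbrakk>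
      \<Longrightarrow> 0 < sin (k * \<alpha>) * sin (k * \<beta>) * sin (k * \<gamma>) * sin (2 * pi * k / N)"
    and excess_at_vertex: "\<And>(a::real) (b::real) (e::real). \<lbrakk>a + b + e = 0; 0 < a\<rbrakk> \<Longrightarrow>
      \<exists>(p::nat) (q::nat) (r::nat) (z::nat). z \<in> {1::nat, 2} \<and>
      p * \<alpha> + q * \<beta> + r * \<gamma> = z * pi \<and> a * p + b * q + e * r < 0"

text \<open>\<open>m\<close> renames \<open>\<gamma>\<close> in a scale where a vertex equation is
  linear in \<open>N\<close> and \<open>m\<close> with integer coefficients. \<open>m = 1\<close>
  means \<open>\<beta> = pi / 2\<close>, and \<open>m = 3\<close> means
  \<open>\<beta> = \<alpha>\<close>.\<close>

locale tile_angle_ratio = tile_angle_constraints +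
  fixes m :: real
  assumes gamma_m: "\<gamma> = pi * ((1 + m) / (2 * N))"
begin

lemma N_pos: "0 < real N" "25 \<le> real N"
  using N_ge by simp_all

lemma alpha_N: "\<alpha> = pi * ((real N - 2) / (2 * N))"
  using N_pos by (simp add: alpha_eq field_simps)

lemma beta_m: "\<beta> = pi * ((real N + 1 - m) / (2 * N))"
proof -
  have "(real N - 2) / (2 * N) + (1 + m) / (2 * N) + (real N + 1 - m) / (2 * N) = 1"
    using N_pos by (simp add: add_divide_distrib[symmetric])
  then have "pi * ((real N - 2) / (2 * N) + (1 + m) / (2 * N) + (real N + 1 - m) / (2 * N)) = pi" by simp
  then have "\<alpha> + \<gamma> + pi * ((real N + 1 - m) / (2 * N)) = pi"
    unfolding alpha_N gamma_m by (simp only: distrib_left)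
  then show ?thesis using angle_sum by linarith
qed

lemma equation_m:
  fixes p q r z :: nat
  assumes "p * \<alpha> + q * \<beta> + r * \<gamma> = z * pi"
  shows "p * (real N - 2) + q * (real N + 1 - m) + r * (1 + m) = 2 * real N * real z"
proof -
  have scaled: "2 * N * \<alpha> = pi * (real N - 2)" "2 * N * \<beta> = pi * (real N + 1 - m)" "2 * N * \<gamma> = pi * (1 + m)"
    unfolding alpha_N beta_m gamma_m using N_pos by simp_all
  have "pi * (p * (real N - 2) + q * (real N + 1 - m) + r * (1 + m))
     = p * (pi * (real N - 2)) + q * (pi * (real N + 1 - m)) + r * (pi * (1 + m))"
    by (simp only: distrib_left mult.left_commute)
  also have "\<dots> = 2 * N * (p * \<alpha> + q * \<beta> + r * \<gamma>)"
    unfolding scaled[symmetric] by (simp only: distrib_left mult_ac)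
  also have "\<dots> = pi * (2 * real N * real z)" unfolding assms by simp
  finally show ?thesis by simp
qed

text \<open>\<open>n\<close> is not fixed to \<open>2 * N\<close> because a fractional
  \<open>m\<close> asks for a larger common denominator.\<close>

lemma even_floors:
  fixes n k :: nat
  assumes "2 * N dvd n" "n > 0" "coprime k n" "(1 + m) * n / (2 * N) \<in> \<int>"
  shows "even (\<lfloor>k * ((real N - 2) / (2 * N))\<rfloor> + \<lfloor>k * ((real N + 1 - m) / (2 * N))\<rfloor>
     + \<lfloor>k * ((1 + m) / (2 * N))\<rfloor> + \<lfloor>2 * real k / N\<rfloor>)"
proof -
  obtain l where l: "n = 2 * N * l" using assms(1) by (auto simp: dvd_def)
  have "\<alpha> * n / pi = of_int ((int N - 2) * int l)"
    unfolding alpha_N using N_pos by (simp add: l)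
  then have a: "\<alpha> * n / pi \<in> \<int>" by (metis Ints_of_int)
  have "\<gamma> * n / pi = (1 + m) * n / (2 * N)" unfolding gamma_m by simp
  then have g: "\<gamma> * n / pi \<in> \<int>" using assms(4) by simp
  have "\<beta> * n / pi = n - \<alpha> * n / pi - \<gamma> * n / pi"
  proof -
    have "\<beta> = pi - \<alpha> - \<gamma>" using angle_sum by simp
    then show ?thesis by (simp add: left_diff_distrib diff_divide_distrib)
  qed
  then have b: "\<beta> * n / pi \<in> \<int>" using a g by auto
  have "0 < sin (k * \<alpha>) * sin (k * \<beta>) * sin (k * \<gamma>) * sin (2 * pi * k / N)"
    by (rule conjugate_sign[OF assms(1-3) a b g])
  then have "0 < sin (pi * (k * ((real N - 2) / (2 * N)))) * sin (pi * (k * ((real N + 1 - m) / (2 * N))))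
     * sin (pi * (k * ((1 + m) / (2 * N)))) * sin (pi * (2 * real k / N))"
  proof -
    have "k * \<alpha> = pi * (k * ((real N - 2) / (2 * N)))" "k * \<beta> = pi * (k * ((real N + 1 - m) / (2 * N)))"
     "k * \<gamma> = pi * (k * ((1 + m) / (2 * N)))" "2 * pi * k / N = pi * (2 * real k / N)"
      unfolding alpha_N beta_m gamma_m by simp_all
    then show ?thesis using \<open>0 < sin (k * \<alpha>) * _ * _ * _\<close> by (simp only:)
  qed
  then show ?thesis by (rule even_floor_sum)
qed

lemma even_divs:
  fixes i :: int and k :: nat
  assumes "m = of_int i" and "coprime k (2 * N)"
  shows "even ((int k * (int N - 2)) div (2 * int N) + (int k * (int N + 1 - i)) div (2 * int N)
     + (int k * (1 + i)) div (2 * int N) + (2 * int k) div int N)"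
proof -
  have "(1 + m) * real (2 * N) / (2 * N) = of_int (1 + i)" using N_pos assms(1) by simp
  then have "(1 + m) * real (2 * N) / (2 * N) \<in> \<int>" by (metis Ints_of_int)
  then have ev: "even (\<lfloor>k * ((real N - 2) / (2 * N))\<rfloor> + \<lfloor>k * ((real N + 1 - m) / (2 * N))\<rfloor>
     + \<lfloor>k * ((1 + m) / (2 * N))\<rfloor> + \<lfloor>2 * real k / N\<rfloor>)"
    using assms(2) N_ge by (intro even_floors[of "2 * N"]) auto
  have fl: "\<lfloor>of_int x / of_int y :: real\<rfloor> = x div y" for x y by (rule floor_divide_of_int_eq)
  have "k * ((real N - 2) / (2 * N)) = of_int (int k * (int N - 2)) / of_int (2 * int N)"
     "k * ((real N + 1 - m) / (2 * N)) = of_int (int k * (int N + 1 - i)) / of_int (2 * int N)"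
     "k * ((1 + m) / (2 * N)) = of_int (int k * (1 + i)) / of_int (2 * int N)"
     "2 * real k / N = of_int (2 * int k) / of_int (int N)"
    by (simp_all add: assms(1))
  then show ?thesis using ev by (simp only: fl)
qed

lemma not_obstructed:
  assumes "of_int C * m = of_int A * N + of_int B" and "C > 0"
  shows "\<not> obstructed (int N) A B C"
proof
  assume "obstructed (int N) A B C"
  define i where "i = (A * int N + B) div C"
  have mod: "(A * int N + B) mod C = 0" using \<open>obstructed (int N) A B C\<close> by (simp add: obstructed_def)
  have "\<exists>k\<in>set [3, 5, 7, 13, 17]. gcd k (2 * int N) = 1 \<and>
    ((k * (int N - 2)) div (2 * int N) + (k * (int N + 1 - i)) div (2 * int N) + (k * (1 + i)) div (2 * int N) + (2 * k) div int N) mod 2 = 1"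
    using \<open>obstructed (int N) A B C\<close> unfolding obstructed_def Let_def i_def[symmetric] by (rule conjunct2)
  then obtain k where k: "k \<in> set [3, 5, 7, 13, 17]" "gcd k (2 * int N) = 1"
    "((k * (int N - 2)) div (2 * int N) + (k * (int N + 1 - i)) div (2 * int N) + (k * (1 + i)) div (2 * int N) + (2 * k) div int N) mod 2 = 1"
    by (elim bexE conjE)
  have "C * i = A * int N + B" using mod by (auto simp: i_def)
  then have "of_int (C * i) = (of_int (A * int N + B) :: real)" by (rule arg_cong)
  then have "of_int C * m = of_int C * of_int i" using assms(1) by simp
  then have m: "m = of_int i" using assms(2) by simp
  have kn: "int (nat k) = k" using k(1) by auto
  have "coprime k (2 * int N)" using k(2) by (simp add: coprime_iff_gcd_eq_1)
  then have "coprime (int (nat k)) (int (2 * N))" unfolding kn by simp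
  then have "coprime (nat k) (2 * N)" by (simp only: coprime_int_iff)
  from even_divs[OF m this] k(3) show False unfolding kn by (simp add: even_iff_mod_2_eq_zero)
qed

lemma generic_family_impossible:
  assumes eq: "of_int C * m = of_int A * N + of_int B" and A: "0 < A" "A < C"
    and fin: "finitely_many_obstructed A B C"
  shows False
proof -
  have C: "C > 0" using A by simp
  \<comment> \<open>The weights have sum 0 and total \<open>- E\<close> at a vertex, where
    \<open>E\<close> is the constant term of the vertex equation after substituting
    \<open>C * m = A * N + B\<close>. So \<open>E > 0\<close>, which excludes the equations with
    \<open>D = E = 0\<close> that hold for every \<open>N\<close>.\<close>
  obtain p q r z :: nat where z: "z \<in> {1, 2}" and pqr: "p * \<alpha> + q * \<beta> + r * \<gamma> = z * pi"
    and neg: "of_int (2 * C) * p + of_int (B - C) * q + of_int (- B - C) * r < (0::real)"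
    using excess_at_vertex[of "of_int (2 * C)" "of_int (B - C)" "of_int (- B - C)"] C by auto
  define D where "D = 2 * C * int z - int p * C - int q * (C - A) - int r * A"
  define E where "E = C * (int q + int r - 2 * int p) - B * (int q - int r)"
  have "of_int (2 * C * int p + (B - C) * int q + (- B - C) * int r) < (of_int 0 :: real)"
    using neg by simp
  then have "2 * C * int p + (B - C) * int q + (- B - C) * int r < 0" by (simp only: of_int_less_iff)
  then have E: "E > 0" by (simp add: E_def algebra_simps)
  have "of_int C * (p * (real N - 2) + q * (real N + 1 - m) + r * (1 + m)) = of_int C * (2 * real N * real z)"
    using equation_m[OF pqr] by simp
  then have "of_int C * p * (real N - 2) + q * (of_int C * (real N + 1) - of_int C * m) + r * (of_int C + of_int C * m)
     = of_int C * (2 * real N * real z)"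
    by (simp add: algebra_simps)
  then have "of_int E = (of_int (int N * D) :: real)"
    unfolding eq by (simp add: E_def D_def algebra_simps)
  then have ED: "E = int N * D" by (simp only: of_int_eq_iff)
  have "0 < int N * D" using E ED by simp
  then have D: "D \<ge> 1" using N_ge by (simp add: zero_less_mult_iff)
  have le_div: "x \<le> X div d" if "x * d \<le> X" "0 < d" for x X d :: int
    using zdiv_mono1[OF that(1,2)] that(2) by simp
  have nonneg: "0 \<le> int q * (C - A)" "0 \<le> int r * A" using A by simp_all
  have z2: "int z \<in> set [1..2]" "int z \<le> 2" using z by auto
  have p: "int p \<in> set [0..3]"
  proof -
    have "2 * C * int z \<le> 2 * C * 2" using z2 C by (intro mult_left_mono) auto
    then have "int p * C < 4 * C" using D nonneg unfolding D_def by linarith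
    then have "int p < 4" using C by (simp add: mult_less_cancel_right)
    then show ?thesis by simp
  qed
  have q: "int q \<in> set [0..(2 * C * int z - 1 - int p * C) div (C - A)]"
    using le_div[of "int q" "C - A" "2 * C * int z - 1 - int p * C"] D nonneg A unfolding D_def by simp
  have r: "int r \<in> set [0..(2 * C * int z - 1 - int p * C - int q * (C - A)) div A]"
    using le_div[of "int r" A "2 * C * int z - 1 - int p * C - int q * (C - A)"] D A unfolding D_def by simp
  have "E < 25 * D \<or> E mod D \<noteq> 0 \<or> E div D = 30 \<or> E div D = 42 \<or> obstructed (E div D) A B C"
    unfolding D_def E_def
    by (rule fin[unfolded finitely_many_obstructed_def Let_def, THEN bspec, OF z2(1), THEN bspec, OF p,
        THEN bspec, OF q, THEN bspec, OF r])
  moreover have "E div D = int N" "E mod D = 0" using ED D by simp_all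
  moreover have "25 * D \<le> E" unfolding ED using N_ge D by (intro mult_right_mono) auto
  ultimately show False using N_ne not_obstructed[OF eq C] by auto
qed

lemma excess_equation:
  obtains p q r z :: nat where "z \<in> {1, 2}" "p * \<alpha> + q * \<beta> + r * \<gamma> = z * pi" "r < q"
proof -
  \<comment> \<open>The weight of \<open>\<alpha>\<close> has to be positive, and
    \<open>\<epsilon>\<close> makes it a tie-break: \<open>r * \<gamma> \<le> 2 * pi\<close> gives
    \<open>\<epsilon> * r \<le> 1 / 2\<close>, so the weights force \<open>r \<le> q\<close>, and in
    the case \<open>r = q\<close> also \<open>p < q\<close>.\<close>
  define \<epsilon> where "\<epsilon> = \<gamma> / (4 * pi)"
  have eps: "0 < \<epsilon>" using angles_pos by (simp add: \<epsilon>_def)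
  obtain p q r z :: nat where z: "z \<in> {1, 2}" and pqr: "p * \<alpha> + q * \<beta> + r * \<gamma> = z * pi"
    and neg: "\<epsilon> * p + (- 1) * q + (1 - \<epsilon>) * r < 0"
    using excess_at_vertex[of \<epsilon> "- 1" "1 - \<epsilon>"] eps by auto
  have a0: "0 < \<alpha>" unfolding alpha_N using N_pos by (intro mult_pos_pos divide_pos_pos) auto
  have nonneg: "0 \<le> p * \<alpha>" "0 \<le> q * \<beta>" "0 \<le> r * \<gamma>" using angles_pos a0 by simp_all
  have zpi: "z * pi \<le> 2 * pi" using z by (intro mult_right_mono) auto
  have "r * \<gamma> \<le> 2 * pi" using pqr nonneg zpi by linarith
  then have "\<epsilon> * r \<le> 1 / 2" by (simp add: \<epsilon>_def field_simps)
  moreover have "0 \<le> \<epsilon> * p" using eps by simp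
  ultimately have "real r - 1 / 2 < q" using neg by (simp add: algebra_simps)
  then have "r \<le> q" by linarith
  have "r \<noteq> q"
  proof
    assume "r = q"
    then have "\<epsilon> * p < \<epsilon> * q" using neg by (simp add: algebra_simps)
    then have pq: "p < q" using eps by simp
    have eq: "p * (real N - 2) + q * (real N + 2) = 2 * real N * real z"
      using equation_m[OF pqr] \<open>r = q\<close> by (simp add: algebra_simps)
    then have "of_int (2 * (int q - int p)) = (of_int (int N * (2 * int z - int p - int q)) :: real)"
      by (simp add: algebra_simps)
    then have int: "2 * (int q - int p) = int N * (2 * int z - int p - int q)" by (simp only: of_int_eq_iff)
    then have "0 < int N * (2 * int z - int p - int q)" using pq by simp
    then have "1 \<le> 2 * int z - int p - int q" by (simp add: zero_less_mult_iff)
    then have "int N * 1 \<le> 2 * (int q - int p)" unfolding int by (intro mult_left_mono) auto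
    \<comment> \<open>From \<open>25 \<le> N\<close> and \<open>N \<le> 2 * (q - p)\<close>. So many
      pairs of \<open>\<beta>\<close> and \<open>\<gamma>\<close> exceed the total angle
      \<open>2 * pi\<close>.\<close>
    then have "q \<ge> 13" using N_ge by presburger
    then have "13 * (real N + 2) \<le> q * (real N + 2)" using N_pos by (intro mult_right_mono) auto
    moreover have "0 \<le> p * (real N - 2)" using N_pos by simp
    moreover have "2 * real N * real z \<le> 2 * real N * 2" using z by (intro mult_left_mono) auto
    moreover define X Y W where "X = q * (real N + 2)" and "Y = p * (real N - 2)" and "W = 2 * real N * real z"
    ultimately have "13 * real N + 26 \<le> X" "0 \<le> Y" "W \<le> 4 * real N" "Y + X = W"
      using eq by simp_all
    then show False using N_pos by linarith
  qed
  then show ?thesis using that z pqr \<open>r \<le> q\<close> by simp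
qed

lemma family_cases:
  assumes "\<gamma> \<le> \<beta>"
  shows "\<exists>(A, B, C)\<in>set constant_families. of_int C * m = of_int A * N + of_int B"
proof -
  obtain p q r z :: nat where z: "z \<in> {1, 2}" and pqr: "p * \<alpha> + q * \<beta> + r * \<gamma> = z * pi" and rq: "r < q"
    using excess_equation .
  have m: "- 1 < m" "2 * m \<le> N"
  proof -
    have "0 < (1 + m) / (2 * N)" using angles_pos(2) gamma_m zero_less_mult_pos pi_gt_zero by metis
    then show "- 1 < m" using N_pos by (simp add: zero_less_divide_iff)
    have "(1 + m) / (2 * N) \<le> (real N + 1 - m) / (2 * N)"
      using assms gamma_m beta_m mult_le_cancel_left_pos[OF pi_gt_zero] by metis
    then show "2 * m \<le> N" using N_pos by (simp add: divide_le_cancel)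
  qed
  note eq = equation_m[OF pqr]
  define A B C where "A = int p + int q - 2 * int z" and "B = int q + int r - 2 * int p" and "C = int q - int r"
  have C: "C > 0" using rq by (simp add: C_def)
  have line: "of_int C * m = of_int A * N + of_int B"
    using eq by (simp add: A_def B_def C_def algebra_simps)
  have z2: "2 * real N * real z \<le> 2 * real N * 2" using z by (intro mult_left_mono) auto
  have r0: "0 \<le> r * (1 + m)" using m by simp
  \<comment> \<open>Five angles \<open>\<alpha>\<close> exceed \<open>2 * pi\<close>, and so do
    eight angles \<open>\<beta>\<close>, because \<open>2 * m \<le> N\<close> gives
    \<open>\<beta> > pi / 4\<close>.\<close>
  have p: "int p \<in> set [0..4]"
  proof -
    have "q * (real N + 1 - m) \<ge> 0" using m N_pos by (intro mult_nonneg_nonneg) auto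
    then have "p * (real N - 2) \<le> 4 * N" using eq z2 r0 by linarith
    moreover have "5 * (real N - 2) \<le> p * (real N - 2)" if "p \<ge> 5" using that N_pos by (intro mult_right_mono) auto
    ultimately have "p < 5" using N_pos by (cases "p < 5") auto
    then show ?thesis by simp
  qed
  have q: "int q \<in> set [1..7]"
  proof -
    have "p * (real N - 2) \<ge> 0" using N_pos by simp
    then have "q * (real N + 1 - m) \<le> 4 * N" using eq z2 r0 by linarith
    moreover have "8 * (real N + 1 - m) \<le> q * (real N + 1 - m)" if "q \<ge> 8"
      using that m N_pos by (intro mult_right_mono) auto
    ultimately have "q < 8" using m N_pos by (cases "q < 8") auto
    then show ?thesis using rq by simp
  qed
  have r: "int r \<in> set [0..int q - 1]" using rq by simp
  have "int z \<in> set [1..2]" using z by auto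
  with vertex_equation_families p q r
  have cases: "(A < 0 \<and> 25 * A + B + C \<le> 0) \<or> (A = 0 \<and> B + C \<le> 0) \<or> (C < 2 * A \<and> 25 * (C - 2 * A) < 2 * B)
     \<or> (C = 2 * A \<and> 0 < B) \<or> (A, B, C) \<in> set generic_families \<or> (A, B, C) \<in> set constant_families"
    unfolding Let_def A_def B_def C_def by blast
  have "of_int C * (- 1) < of_int C * m" using m(1) C by (intro mult_strict_left_mono) auto
  then have low: "of_int (A * int N + B + C) > (of_int 0 :: real)" unfolding line by simp
  then have low: "A * int N + B + C > 0" by (simp only: of_int_less_iff)
  have "of_int C * (2 * m) \<le> of_int C * real N" using m(2) C by (intro mult_left_mono) auto
  then have "of_int (2 * (A * int N + B)) \<le> (of_int (C * int N) :: real)" using line by (simp add: algebra_simps)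
  then have up: "2 * (A * int N + B) \<le> C * int N" by (simp only: of_int_le_iff)
  have N25: "int N \<ge> 25" using N_ge by simp
  from cases show ?thesis
  proof (elim disjE conjE)
    assume *: "A < 0" "25 * A + B + C \<le> 0"
    have "A * int N \<le> A * 25" using * N25 by (intro mult_left_mono_neg) auto
    then show ?thesis using * low by linarith
  next
    assume "A = 0" "B + C \<le> 0"
    then show ?thesis using low by simp
  next
    assume *: "C < 2 * A" "25 * (C - 2 * A) < 2 * B"
    have "(C - 2 * A) * int N \<le> (C - 2 * A) * 25" using * N25 by (intro mult_left_mono_neg) auto
    then show ?thesis using * up by (simp add: algebra_simps)
  next
    assume "C = 2 * A" "0 < B"
    then show ?thesis using up by simp
  next
    assume "(A, B, C) \<in> set generic_families"
    then have "0 < A" "A < C" "finitely_many_obstructed A B C" using generic_families_obstructed by auto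
    then show ?thesis using generic_family_impossible[OF line] by blast
  next
    assume "(A, B, C) \<in> set constant_families"
    then show ?thesis using line by blast
  qed
qed

text \<open>For \<open>k = 2 * l + 1\<close> slightly above \<open>N\<close> the four floors are
  \<open>l - 1\<close>, \<open>l\<close>, 0 and 2, with an odd sum. Slightly below \<open>N\<close>
  the last one would be 1 and the sum even, so the side matters.\<close>

lemma m_ne_third: "m \<noteq> 1 / 3"
proof
  assume m: "m = 1 / 3"
  obtain s where s: "s \<in> {1..4}" "coprime (N + s) (6 * N)" using coprime_near(1)[of N] N_ge by auto
  define k where "k = N + s"
  define t where "t = real s / N"
  have t: "0 < t" "t < 1 / 4" using s(1) N_pos by (auto simp: t_def field_simps)
  have kt: "real k / N = 1 + t" using N_pos by (simp add: k_def t_def field_simps)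
  have "coprime k (2 * (3 * N))" using s(2) by (simp add: k_def)
  then have "coprime k 2" unfolding coprime_mult_right_iff by blast
  then have "odd k" by simp
  then obtain l where l: "k = 2 * l + 1" by (elim oddE)
  have "(1 + m) * real (6 * N) / (2 * N) = of_int 4" using m N_pos by simp
  then have int: "(1 + m) * real (6 * N) / (2 * N) \<in> \<int>" by (metis Ints_of_int)
  have "even (\<lfloor>k * ((real N - 2) / (2 * N))\<rfloor> + \<lfloor>k * ((real N + 1 - m) / (2 * N))\<rfloor>
     + \<lfloor>k * ((1 + m) / (2 * N))\<rfloor> + \<lfloor>2 * real k / N\<rfloor>)"
    using s(2) N_ge int by (intro even_floors[of "6 * N"]) (auto simp: k_def)
  moreover have "k * ((real N - 2) / (2 * N)) = l - 1 / 2 - t"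
  proof -
    have "k * ((real N - 2) / (2 * N)) = k / 2 - real k / N" using N_pos by (simp add: field_simps)
    then show ?thesis unfolding kt by (simp add: l)
  qed
  moreover have "k * ((real N + 1 - m) / (2 * N)) = l + 5 / 6 + t / 3"
  proof -
    have "k * ((real N + 1 - m) / (2 * N)) = k / 2 + (real k / N) / 3" using N_pos m by (simp add: field_simps)
    then show ?thesis unfolding kt by (simp add: l field_simps)
  qed
  moreover have "k * ((1 + m) / (2 * N)) = 2 / 3 + t * 2 / 3"
  proof -
    have "k * ((1 + m) / (2 * N)) = 2 / 3 * (real k / N)" using N_pos m by (simp add: field_simps)
    then show ?thesis unfolding kt by simp
  qed
  moreover have "2 * real k / N = 2 + 2 * t" using kt by simp
  moreover have "\<lfloor>l - 1 / 2 - t\<rfloor> = int l - 1" "\<lfloor>l + 5 / 6 + t / 3\<rfloor> = int l" "\<lfloor>2 / 3 + t * 2 / 3\<rfloor> = 0" "\<lfloor>2 + 2 * t\<rfloor> = 2"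
    using t by (intro floor_unique; simp)+
  ultimately show False by simp
qed

text \<open>For \<open>k = 2 * l + 1\<close> slightly below \<open>N\<close> the four floors are
  \<open>l - 1\<close>, \<open>l\<close>, 1 and 1, with an odd sum; here it is above
  \<open>N\<close> that the sum would be even.\<close>

lemma m_ne_five_thirds: "m \<noteq> 5 / 3"
proof
  assume m: "m = 5 / 3"
  obtain s where s: "s \<in> {1..4}" "coprime (N - s) (6 * N)" using coprime_near(2)[of N] N_ge by auto
  define k where "k = N - s"
  define t where "t = real s / N"
  have t: "0 < t" "t < 1 / 4" using s(1) N_pos by (auto simp: t_def field_simps)
  have "s \<le> N" using s(1) N_ge by simp
  then have kt: "real k / N = 1 - t" using N_pos by (simp add: k_def t_def field_simps of_nat_diff)
  have "coprime k (2 * (3 * N))" using s(2) by (simp add: k_def)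
  then have "coprime k 2" unfolding coprime_mult_right_iff by blast
  then have "odd k" by simp
  then obtain l where l: "k = 2 * l + 1" by (elim oddE)
  have "(1 + m) * real (6 * N) / (2 * N) = of_int 8" using m N_pos by simp
  then have int: "(1 + m) * real (6 * N) / (2 * N) \<in> \<int>" by (metis Ints_of_int)
  have "even (\<lfloor>k * ((real N - 2) / (2 * N))\<rfloor> + \<lfloor>k * ((real N + 1 - m) / (2 * N))\<rfloor>
     + \<lfloor>k * ((1 + m) / (2 * N))\<rfloor> + \<lfloor>2 * real k / N\<rfloor>)"
    using s(2) N_ge int by (intro even_floors[of "6 * N"]) (auto simp: k_def)
  moreover have "k * ((real N - 2) / (2 * N)) = l - 1 / 2 + t"
  proof -
    have "k * ((real N - 2) / (2 * N)) = k / 2 - real k / N" using N_pos by (simp add: field_simps)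
    then show ?thesis unfolding kt by (simp add: l)
  qed
  moreover have "k * ((real N + 1 - m) / (2 * N)) = l + 1 / 6 + t / 3"
  proof -
    have "k * ((real N + 1 - m) / (2 * N)) = k / 2 - (real k / N) / 3" using N_pos m by (simp add: field_simps)
    then show ?thesis unfolding kt by (simp add: l field_simps)
  qed
  moreover have "k * ((1 + m) / (2 * N)) = 4 / 3 - t * 4 / 3"
  proof -
    have "k * ((1 + m) / (2 * N)) = 4 / 3 * (real k / N)" using N_pos m by (simp add: field_simps)
    then show ?thesis unfolding kt by simp
  qed
  moreover have "2 * real k / N = 2 - 2 * t" using kt by simp
  moreover have "\<lfloor>l - 1 / 2 + t\<rfloor> = int l - 1" "\<lfloor>l + 1 / 6 + t / 3\<rfloor> = int l" "\<lfloor>4 / 3 - t * 4 / 3\<rfloor> = 1" "\<lfloor>2 - 2 * t\<rfloor> = 1"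
    using t by (intro floor_unique; simp)+
  ultimately show False by simp
qed

text \<open>Let \<open>t = k / N\<close> with odd \<open>k = 2 * l + 1\<close>. The bound
  \<open>t > 1 / 6\<close> lowers the floor belonging to \<open>\<beta>\<close> to
  \<open>l - 1\<close>, while \<open>t < 1 / 4\<close> keeps the one belonging to
  \<open>\<gamma>\<close> at 0; the sum is then \<open>2 * l - 1\<close>.\<close>

lemma m_ne_seven: "m \<noteq> 7"
proof
  assume m: "m = 7"
  obtain k where k: "coprime k N" "N < 6 * k" "4 * k < N" "even N \<longrightarrow> odd k"
    using coprime_between_sixth_and_quarter N_ge N_ne by blast
  \<comment> \<open>If \<open>k\<close> is even, then \<open>N\<close> is odd and
    \<open>k + N\<close> is an odd replacement that is still coprime to \<open>N\<close>; it shifts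
    \<open>t\<close> by 1, and the sum of the floors is odd again.\<close>
  define k' where "k' = (if odd k then k else k + N)"
  have "odd k'" using k(4) by (auto simp: k'_def)
  then obtain l where l: "k' = 2 * l + 1" by (elim oddE)
  have "coprime k' N"
    using k(1) by (simp add: k'_def coprime_iff_gcd_eq_1)
  then have cop: "coprime k' (2 * N)" using \<open>odd k'\<close> by simp
  have "(1 + m) * real (2 * N) / (2 * N) = of_int 8" using m N_pos by simp
  then have int: "(1 + m) * real (2 * N) / (2 * N) \<in> \<int>" by (metis Ints_of_int)
  have ev: "even (\<lfloor>k' * ((real N - 2) / (2 * N))\<rfloor> + \<lfloor>k' * ((real N + 1 - m) / (2 * N))\<rfloor>
     + \<lfloor>k' * ((1 + m) / (2 * N))\<rfloor> + \<lfloor>2 * real k' / N\<rfloor>)"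
    using cop N_ge int by (intro even_floors[of "2 * N"]) auto
  define t where "t = real k / N"
  have t: "1 / 6 < t" "t < 1 / 4" using k N_pos by (auto simp: t_def field_simps)
  define \<tau> where "\<tau> = real k' / N"
  have \<tau>: "\<tau> = t \<or> \<tau> = t + 1" using N_pos by (auto simp: \<tau>_def t_def k'_def field_simps)
  have k'2: "k' / 2 = l + 1 / 2" by (simp add: l)
  have f: "k' * ((real N - 2) / (2 * N)) = l + 1 / 2 - \<tau>" "k' * ((real N + 1 - m) / (2 * N)) = l + 1 / 2 - 3 * \<tau>"
     "k' * ((1 + m) / (2 * N)) = 4 * \<tau>" "2 * real k' / N = 2 * \<tau>"
    unfolding k'2[symmetric] \<tau>_def using N_pos m by (simp_all add: field_simps)
  from \<tau> show False
  proof
    assume "\<tau> = t"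
    moreover have "\<lfloor>l + 1 / 2 - t\<rfloor> = int l" "\<lfloor>l + 1 / 2 - 3 * t\<rfloor> = int l - 1" "\<lfloor>4 * t\<rfloor> = 0" "\<lfloor>2 * t\<rfloor> = 0"
      using t by (intro floor_unique; simp)+
    ultimately show False using ev unfolding f by simp
  next
    assume "\<tau> = t + 1"
    moreover have "\<lfloor>l + 1 / 2 - (t + 1)\<rfloor> = int l - 1" "\<lfloor>l + 1 / 2 - 3 * (t + 1)\<rfloor> = int l - 4" "\<lfloor>4 * (t + 1)\<rfloor> = 4"
        "\<lfloor>2 * (t + 1)\<rfloor> = 2"
      using t by (intro floor_unique; simp)+
    ultimately show False using ev unfolding f by simp
  qed
qed

lemma possible_angles:
  assumes "\<gamma> \<le> \<beta>"
  shows "(\<gamma> = pi / N \<and> \<beta> = pi / 2) \<or> (\<gamma> = 2 * pi / N \<and> \<beta> = \<alpha>)"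
proof -
  have "3 * m = 1 \<or> 2 * m = 2 \<or> m = 3 \<or> 4 * m = 4 \<or> 3 * m = 5 \<or> 2 * m = 6 \<or> m = 7"
    using family_cases[OF assms] by (simp add: constant_families_def)
  then have "m = 1 \<or> m = 3" using m_ne_third m_ne_five_thirds m_ne_seven by auto
  then show ?thesis
  proof
    assume "m = 1"
    then show ?thesis using gamma_m beta_m N_pos by simp
  next
    assume "m = 3"
    then show ?thesis using gamma_m beta_m alpha_N N_pos by simp
  qed
qed

end

lemma tile_angles_possible:
  assumes "tile_angle_constraints N \<alpha> \<beta> \<gamma>" and "\<gamma> \<le> \<beta>"
  shows "(\<gamma> = pi / N \<and> \<beta> = pi / 2) \<or> (\<gamma> = 2 * pi / N \<and> \<beta> = \<alpha>)"
proof -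
  interpret tile_angle_constraints N \<alpha> \<beta> \<gamma> by (rule assms)
  interpret tile_angle_ratio N \<alpha> \<beta> \<gamma> "2 * N * \<gamma> / pi - 1"
    by unfold_locales (use N_ge in simp)
  show ?thesis by (rule possible_angles[OF assms(2)])
qed

text \<open>The conditions treat \<open>\<beta>\<close> and \<open>\<gamma>\<close> alike once the
  weights \<open>b\<close> and \<open>e\<close> are exchanged; this is what allows
  \<open>\<gamma> \<le> \<beta>\<close> to be assumed.\<close>

lemma tile_angle_constraints_swap:
  assumes "tile_angle_constraints N \<alpha> \<beta> \<gamma>"
  shows "tile_angle_constraints N \<alpha> \<gamma> \<beta>"
proof -
  interpret tile_angle_constraints N \<alpha> \<beta> \<gamma> by (rule assms)
  show ?thesis
  proof
    show "0 < sin (k * \<alpha>) * sin (k * \<gamma>) * sin (k * \<beta>) * sin (2 * pi * k / N)"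
      if "2 * N dvd n" "n > 0" "coprime k n" "\<alpha> * n / pi \<in> \<int>" "\<gamma> * n / pi \<in> \<int>" "\<beta> * n / pi \<in> \<int>" for n k :: nat
      using conjugate_sign[OF that(1-4,6,5)] by (simp add: mult_ac)
    show "\<exists>(p::nat) (q::nat) (r::nat) (z::nat). z \<in> {1::nat, 2} \<and>
      p * \<alpha> + q * \<gamma> + r * \<beta> = z * pi \<and> a * p + b * q + e * r < 0" if abe: "a + b + e = 0" "0 < a" for a b e :: real
    proof -
      have "a + e + b = 0" using abe(1) by simp
      then obtain p q r z :: nat where "z \<in> {1, 2}" "p * \<alpha> + q * \<beta> + r * \<gamma> = z * pi" "a * p + e * q + b * r < 0"
        using excess_at_vertex[of a e b] abe(2) by blast
      then show ?thesis by (intro exI[of _ p] exI[of _ r] exI[of _ q] exI[of _ z]) (auto simp: algebra_simps)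
    qed
  qed (use N_ge N_ne angles_pos angle_sum alpha_eq in auto)
qed

theorem theorem6:
  fixes N :: nat and c w :: complex and \<alpha> \<beta> \<gamma> :: real and T :: "tile set"
  assumes "N \<ge> 25" and "N \<noteq> 30" and "N \<noteq> 42"
    and "w \<noteq> 0"
    and "tiling (regular_ngon N c w) \<alpha> \<beta> \<gamma> T"
    and "\<alpha> / pi \<in> \<rat>" and "\<beta> / pi \<in> \<rat>" and "\<gamma> / pi \<in> \<rat>"
    and "\<forall>j\<in>{1..N}. vertex_equation T (ngon_vertex N c w j) 2 0 0"
  shows "\<exists>(\<beta>', \<gamma>') \<in> {(\<beta>, \<gamma>), (\<gamma>, \<beta>)}.
           (\<alpha> = ngon_angle N / 2 \<and> \<gamma>' = ngon_angle N / 2 \<and> \<beta>' = 2 * pi / real N) \<or>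
           (\<alpha> = ngon_angle N / 2 \<and> \<beta>' = pi / real N \<and> \<gamma>' = pi / 2)"
proof -
  have N3: "N \<ge> 3" using assms(1) by simp
  note constraints = tiling_constraints[OF N3 assms(4,5,9)]
  have half: "ngon_angle N / 2 = pi / 2 - pi / N"
    using assms(1) by (simp add: ngon_angle_def field_simps)
  have tac: "tile_angle_constraints N \<alpha> \<beta> \<gamma>"
  proof unfold_locales
    show "25 \<le> N" "N \<noteq> 30" "N \<noteq> 42" by (rule assms)+
    show "0 < \<beta>" "0 < \<gamma>" "\<alpha> + \<beta> + \<gamma> = pi" using constraints(1) by auto
    show "\<alpha> = pi / 2 - pi / N" using constraints(2) half by simp
  qed (fact constraints(3), fact constraints(4))
  show ?thesis
  \<comment> \<open>The smaller of the two angles takes the place of \<open>\<beta>'\<close>, so the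
    pair is swapped when \<open>\<gamma> \<le> \<beta>\<close>.\<close>
  proof (cases "\<gamma> \<le> \<beta>")
    case True
    have "(\<gamma> = pi / N \<and> \<beta> = pi / 2) \<or> (\<gamma> = 2 * pi / N \<and> \<beta> = \<alpha>)"
      by (rule tile_angles_possible[OF tac True])
    then show ?thesis using constraints(2) by auto
  next
    case False
    have "(\<beta> = pi / N \<and> \<gamma> = pi / 2) \<or> (\<beta> = 2 * pi / N \<and> \<gamma> = \<alpha>)"
      using False by (intro tile_angles_possible[OF tile_angle_constraints_swap[OF tac]]) simp
    then show ?thesis using constraints(2) by auto
  qed
qed

end
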